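(* Let $k$ be a commutative ring, $\mathcal U$ a small category, $\mathcal A$ a prestack of $k$-linear categories on $\mathcal U$ and $M$ an $\mathcal A$-bimodule. Let $\mathcal F:\mathbf C^\bullet_{\mathrm{GS}}(\mathcal A,M)\to\mathbf C^\bullet_{\mathcal U}(\tilde{\mathcal A},\tilde M)$ and $\mathcal G:\mathbf C^\bullet_{\mathcal U}(\tilde{\mathcal A},\tilde M)\to\mathbf C^\bullet_{\mathrm{GS}}(\mathcal A,M)$ be the maps defined in the context. If $\phi\in\mathbf C^n_{\mathrm{GS}}(\mathcal A,M)$ is a normalized reduced cochain, then $\mathcal G\mathcal F(\phi)=\phi$.
   Context: **Prestacks.** A prestack $\mathcal A=(\mathcal A,m,f,c)$ on $\mathcal U$ consists of: for each object $U$ a $k$-linear category $\mathcal A(U)$ with composition written as juxtaposition; for each $u:V\to U$ a $k$-linear functor $u^*=f^u:\mathcal A(U)\to\mathcal A(V)$, with $(1_U)^*=1$; for $v:W\to V$, $u:V\to U$ a natural isomorphism $c^{u,v}:v^*u^*\to(uv)^*$, equal to the identity if $u$ or $v$ is an identity, such that $c^{u,vw}(c^{v,w}u^* )=c^{uv,w}(w^*c^{u,v})$ for all $w:T\to W$. **Bimodules.** An $\mathcal A$-bimodule $M$ consists of $k$-modules $M^U(A,B)$ for $A,B\in\mathcal A(U)$, $k$-linearly contravariant in $A$ and covariant in $B$ (actions written $b\,x\,a$), and $k$-linear maps $M^u:M^U(A,B)\to M^V(u^*A,u^*B)$ for $u:V\to U$ with $M^{1_U}=\mathrm{id}$, $M^u(bxa)=u^*(b)M^u(x)u^*(a)$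 and $M^{uv}(x)\,c^{u,v,A}=c^{u,v,B}\,M^v(M^u(x))$. **Simplices.** A $p$-simplex of the nerve $\mathcal N_p(\mathcal U)$ is $\sigma=(u_1,\dots,u_p)$, $U_0\xrightarrow{u_1}U_1\to\cdots\xrightarrow{u_p}U_p$; $\|\sigma\|=u_p\cdots u_1$. Put $\sigma^*=(u_p\cdots u_1)^*$, $\sigma^\star=u_1^*\cdots u_p^*:\mathcal A(U_p)\to\mathcal A(U_0)$ (identities if $p=0$), $L_k\sigma=(u_1,\dots,u_k)$, $R_k\sigma=(u_{k+1},\dots,u_p)$, $\partial_i\sigma=(u_1,\dots,u_{i+1}u_i,\dots,u_p)$ for $1\le i\le p-1$. Put $c^{\sigma,k}=c^{u_p\cdots u_{k+1},\,u_k\cdots u_1}:(L_k\sigma)^*(R_k\sigma)^*\to\sigma^*$ (identity for $k=0,p$) and, for $1\le k\le p-1$, $\epsilon^{\sigma,k}=u_1^*\cdots u_{k-1}^*c^{u_{k+1},u_k}u_{k+2}^*\cdots u_p^*:\sigma^\star\to(\partial_k\sigma)^\star$; components at $A$ are written $c^{\sigma,k,A}$, $\epsilon^{\sigma,k,A}$. A $q$-simplex $a=(a_1,\dots,a_q)$ in a category is $A_0\xrightarrow{a_q}A_1\to\cdots\xrightarrow{a_1}A_q$, so $a_i:A_{q-i}\to A_{q-i+1}$. **Cochains.** $\mathbf C^{p,q}(\mathcal A,M)=\prod_{\sigma\in\mathcal N_p(\mathcal U)}\prod_{A_0,\dots,A_q\in\mathcal A(U_p)}\mathrm{Hom}_k\big(\mathcal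 A(U_p)(A_{q-1},A_q)\otimes\cdots\otimes\mathcal A(U_p)(A_0,A_1),M^{U_0}(\sigma^\star A_0,\sigma^*A_q)\big)$ (for $q=0$ just $M^{U_0}(\sigma^\star A_0,\sigma^*A_0)$), and $\mathbf C^n_{\mathrm{GS}}(\mathcal A,M)=\prod_{p+q=n}\mathbf C^{p,q}(\mathcal A,M)$. A cochain $\phi=(\phi^\sigma)_\sigma$ is normalized if $\phi^\sigma(a)=0$ whenever some $a_i$ is an identity, and reduced if $\phi^\sigma=0$ whenever some arrow $u_i$ of $\sigma$ is an identity. **Paths.** For $\sigma=(u_1,\dots,u_n)$, $n\ge1$, the paths $r=(r_1,\dots,r_{n-1})\in\mathcal P(\sigma)$ are chains of natural transformations $T_0\xrightarrow{r_{n-1}}T_1\to\cdots\xrightarrow{r_1}T_{n-1}$ from $T_0=\sigma^\star$ to $T_{n-1}=\sigma^*$, with a sign $(-1)^r$: $\mathcal P(u_1)$ has only the empty path (with $T_0=u_1^*$, sign $1$); for $n\ge2$, $\mathcal P(\sigma)=\{(r_1,\dots,r_{n-2},\epsilon^{\sigma,i}):1\le i\le n-1,\ r\in\mathcal P(\partial_i\sigma)\}$ with sign $(-1)^i(-1)^r$. Paths are indexed by the choices made ($(n-1)!$ of them). The composite $\|r\|=r_1\cdots r_{n-1}:\sigma^\star\to\sigma^*$ does not depend on $r\in\mathcal P(\sigma)$. **Shuffles.** $S_{m,l}$ is the set of permutations $\beta$ of $\{1,\dots,m+l\}$ increasing on $\{1,\dots,m\}$ and on $\{m+1,\dots,m+l\}$;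 $(-1)^\beta$ is its sign; $\beta$ acts on lists by placing the $i$-th entry in position $\beta(i)$. Given an $m$-simplex $a$ in $\mathcal A(U)$ and a chain $r=(r_1,\dots,r_l)$, $T_0\xrightarrow{r_l}\cdots\xrightarrow{r_1}T_l$, of natural transformations of functors $\mathcal A(U)\to\mathcal A(V)$, shuffle the list $(a_1,\dots,a_m,r_1,\dots,r_l)$ by $\beta$. Then $\beta(a,r)=(b_1,\dots,b_{m+l})$ is the simplex in $\mathcal A(V)$ from $T_0(A_0)$ to $T_l(A_m)$ with $b_x=T_{l-y}(a_i)$ if position $x$ holds $a_i$ and $y$ of the $r$'s are in positions $<x$, and $b_x=r_i(A_{m-y})$ if position $x$ holds $r_i$ and $y$ of the $a$'s are in positions $<x$. **The $\mathcal U$-graded category and its Hochschild cochains.** $\tilde{\mathcal A}(U)=\mathrm{Ob}\,\mathcal A(U)$; for $u:V\to U$, $A\in\mathcal A(V)$, $B\in\mathcal A(U)$, $\tilde{\mathcal A}_u(A,B)=\mathcal A(V)(A,u^*B)$ and $\tilde M_u(A,B)=M^V(A,u^*B)$. A chain $\tilde a=(\tilde a_1,\dots,\tilde a_n)$ over $\sigma=(u_1,\dots,u_n)$ has $A_i\in\mathcal A(U_i)$ and $\tilde a_i\in\tilde{\mathcal A}_{u_{n+1-i}}(A_{n-i},A_{n+1-i})$. $\mathbf C^n_{\mathcal U}(\tilde{\mathcal A},\tilde M)=\prod_{\sigma,A_0,\dots,A_n}\mathrm{Hom}_k\big(\bigotimes_{i=1}^n\tilde{\mathcal A}_{u_{n+1-i}}(A_{n-i},A_{n+1-i}),\tilde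 M_{u_n\cdots u_1}(A_0,A_n)\big)$. **Partitions.** $\mathrm{Part}(n)$ is the set of $\bar m=(m_k,\dots,m_1)$ with $m_i\ge1$, $\sum m_i=n$ (only the empty one if $n=0$); $(-1)^{\bar m}=(-1)^{n-k}$. For an $n$-simplex $\sigma$, cut $\sigma$ into consecutive pieces $\sigma[m_k],\sigma[m_{k-1}],\dots,\sigma[m_1]$ of lengths $m_k,\dots,m_1$ (so $\sigma[m_k]=(u_1,\dots,u_{m_k})$). Let $c^{\sigma,\bar m}:\sigma[m_k]^*\cdots\sigma[m_1]^*\to\sigma^*$ be $\|r\|$ for any $r\in\mathcal P(\|\sigma[m_k]\|,\dots,\|\sigma[m_1]\|)$ (identity for the empty partition). **The map $\mathcal F$.** For $\tilde a$ over $\sigma$ put $\underline{\tilde a}_i=u_1^*\cdots u_{n-i}^*\tilde a_i$ and $\tilde a_{i,\dots,n}=\underline{\tilde a}_i\cdots\underline{\tilde a}_n:A_0\to u_1^*\cdots u_{n+1-i}^*A_{n+1-i}$ in $\mathcal A(U_0)$ (identity of $A_0$ if $i=n+1$). Define recursively a family $\mathrm{Seq}(\sigma,\tilde a,\bar m)$ of $n$-simplices in $\mathcal A(U_0)$ from $A_0$ to $\sigma[m_k]^*\cdots\sigma[m_1]^*A_n$, with signs (indexed by all choices made): for $n=0$ it is the $0$-simplex $A_0$ with sign $1$; for $k=1$ it consists of $(r_1(A_n),\dots,r_{n-1}(A_n),\tilde a_{1,\dots,n})$, $r\in\mathcal P(\sigma)$, with sign $(-1)^r$; for $k\ge2$ it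 consists of $(\beta(\xi,s),\tilde a_{n+1-m_k,\dots,n})$ for $\xi\in\mathrm{Seq}(R_{m_k}\sigma,(\tilde a_1,\dots,\tilde a_{n-m_k}),(m_{k-1},\dots,m_1))$, $s\in\mathcal P(L_{m_k}\sigma)$, $\beta\in S_{n-m_k,m_k-1}$, with sign $(-1)^s(-1)^\beta(-1)^\xi$. For $\phi\in\mathbf C^{p,n-p}(\mathcal A,M)$, $$\mathcal F(\phi)(\tilde a)=\sum_{\bar m\in\mathrm{Part}(n-p)}\ \sum_{\xi\in\mathrm{Seq}(R_p\sigma,(\tilde a_1,\dots,\tilde a_{n-p}),\bar m)}(-1)^{\bar m}(-1)^\xi\,c^{\sigma,p,A_n}\,(L_p\sigma)^*(c^{R_p\sigma,\bar m,A_n})\,\phi^{L_p\sigma}(\xi)\,\tilde a_{n+1-p,\dots,n},$$ extended additively to $\mathbf C^n_{\mathrm{GS}}(\mathcal A,M)$. **The map $\mathcal G$.** Let $\sigma$ be a $p$-simplex and $\bar m=(m_k,\dots,m_1)\in\mathrm{Part}(p)$. For paths $r^i\in\mathcal P(\sigma[m_i])$, $T^i_0\to\cdots\to T^i_{m_i-1}$, put $\bar r^i=(1_{\sigma[m_i]^*},r^i_1,\dots,r^i_{m_i-1})$ (its first entry is the $i$-th head). $\bar S_{\bar m}$ is the set of conditioned shuffles: permutations $\gamma$ of $\{1,\dots,p\}$, acting on the concatenated list $(\bar r^1,\dots,\bar r^k)$ by placing the $x$-th entry in position $\gamma(x)$, that preserve the order inside each block and such that the heads occur in the order $1,2,\dots,k$.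 $\mathrm{Seqq}(\sigma,\bar m)$ is the family of all $\zeta=(\gamma,(r^i)_i)$, with sign $(-1)^\zeta=(-1)^\gamma\prod_i(-1)^{r^i}$ and associated list $\underline\zeta$. For a $q$-simplex $a$ in $\mathcal A(U_p)$ and $\beta\in S_{q,p}$, let $\underline b_1,\dots,\underline b_{p+q}$ be the shuffle by $\beta$ of the list $(a_1,\dots,a_q,\underline\zeta)$. The chain $a*_\beta\zeta=(b_1,\dots,b_{p+q})$ in $\tilde{\mathcal A}$, from $\sigma^\star A_0$ over $U_0$ to $A_q$ over $U_p$, is defined as follows: if among $\underline b_1,\dots,\underline b_{x-1}$ there are $y$ of the $a$'s, the heads $1,\dots,l$, and $x_j$ entries of $r^j$ ($j\le l$), put $F_j=T^j_{m_j-1-x_j}$ and $X=F_l\cdots F_1(A_{q-y})$, an object over $W=U_{p-m_1-\cdots-m_l}$. If $\underline b_x=a_{y+1}$, then $b_x=F_l\cdots F_1(a_{y+1})$, of degree $1_W$; if $\underline b_x=r^j_{x_j+1}$, then $b_x=F_l\cdots F_{j+1}\,r^j_{x_j+1}\,F_{j-1}\cdots F_1(A_{q-y})$, of degree $1_W$; if $\underline b_x$ is the head $l+1$, then $b_x=1\in\tilde{\mathcal A}_{\|\sigma[m_{l+1}]\|}(\sigma[m_{l+1}]^*X,X)$. For $\psi\in\mathbf C^{p+q}_{\mathcal U}(\tilde{\mathcal A},\tilde M)$, the component of $\mathcal G(\psi)$ in $\mathbf C^{p,q}(\mathcal A,M)$ is $$\mathcal G(\psi)^\sigma(a)=\sum_{\bar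 m\in\mathrm{Part}(p)}\ \sum_{\zeta\in\mathrm{Seqq}(\sigma,\bar m)}\ \sum_{\beta\in S_{q,p}}(-1)^\beta(-1)^\zeta\,\psi(a*_\beta\zeta).$$ *)

theory Defs
  imports "HOL-Algebra.Module" "HOL-Combinatorics.Permutations"
begin

section \<open>Categories and linear categories\<close>

record ('o, 'f) cat =
  Ob :: "'o set"
  Arr :: "'f set"
  Src :: "'f \<Rightarrow> 'o"
  Tgt :: "'f \<Rightarrow> 'o"
  Idn :: "'o \<Rightarrow> 'f"
  Comp :: "'f \<Rightarrow> 'f \<Rightarrow> 'f" (infixr \<open>\<bullet>\<index>\<close> 70)

text \<open>Composition is in the usual order: \<open>g \<bullet> f\<close> is ``first f, then g''.\<close>

locale category =
  fixes C :: "('o, 'f, 'x) cat_scheme" (structure)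
  assumes Src_Ob: "f \<in> Arr C \<Longrightarrow> Src C f \<in> Ob C"
    and Tgt_Ob: "f \<in> Arr C \<Longrightarrow> Tgt C f \<in> Ob C"
    and Idn_Arr: "A \<in> Ob C \<Longrightarrow> Idn C A \<in> Arr C"
    and Src_Idn: "A \<in> Ob C \<Longrightarrow> Src C (Idn C A) = A"
    and Tgt_Idn: "A \<in> Ob C \<Longrightarrow> Tgt C (Idn C A) = A"
    and Comp_Arr: "\<lbrakk>g \<in> Arr C; f \<in> Arr C; Src C g = Tgt C f\<rbrakk> \<Longrightarrow> g \<bullet> f \<in> Arr C"
    and Src_Comp: "\<lbrakk>g \<in> Arr C; f \<in> Arr C; Src C g = Tgt C f\<rbrakk> \<Longrightarrow> Src C (g \<bullet> f) = Src C f"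
    and Tgt_Comp: "\<lbrakk>g \<in> Arr C; f \<in> Arr C; Src C g = Tgt C f\<rbrakk> \<Longrightarrow> Tgt C (g \<bullet> f) = Tgt C g"
    and Comp_Idn_left: "f \<in> Arr C \<Longrightarrow> Idn C (Tgt C f) \<bullet> f = f"
    and Comp_Idn_right: "f \<in> Arr C \<Longrightarrow> f \<bullet> Idn C (Src C f) = f"
    and Comp_assoc: "\<lbrakk>h \<in> Arr C; g \<in> Arr C; f \<in> Arr C; Src C h = Tgt C g; Src C g = Tgt C f\<rbrakk>
      \<Longrightarrow> (h \<bullet> g) \<bullet> f = h \<bullet> (g \<bullet> f)"

definition linear_map ::
  "('k, 'r) ring_scheme \<Rightarrow> ('k, 'x) module \<Rightarrow> ('k, 'y) module \<Rightarrow> ('x \<Rightarrow> 'y) \<Rightarrow> bool" where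
  "linear_map R M N f \<longleftrightarrow>
     (\<forall>x\<in>carrier M. f x \<in> carrier N) \<and>
     (\<forall>x\<in>carrier M. \<forall>y\<in>carrier M. f (x \<oplus>\<^bsub>M\<^esub> y) = f x \<oplus>\<^bsub>N\<^esub> f y) \<and>
     (\<forall>r\<in>carrier R. \<forall>x\<in>carrier M. f (r \<odot>\<^bsub>M\<^esub> x) = r \<odot>\<^bsub>N\<^esub> f x)"

text \<open>Linear maps out of \<open>M\<^sub>1 \<otimes> \<dots> \<otimes> M\<^sub>n\<close>, as multilinear maps on lists
  \<open>[x\<^sub>1, \<dots>, x\<^sub>n]\<close>; for \<open>n = 0\<close> this is just an element of \<open>N\<close>.\<close>

definition multilinear ::
  "('k, 'r) ring_scheme \<Rightarrow> ('k, 'x) module list \<Rightarrow> ('k, 'y) module \<Rightarrow> ('x list \<Rightarrow> 'y) \<Rightarrow> bool" where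
  "multilinear R Ms N f \<longleftrightarrow>
     (\<forall>xs \<in> listset (map carrier Ms). f xs \<in> carrier N \<and>
        (\<forall>i < length Ms. linear_map R (Ms ! i) N (\<lambda>x. f (xs[i := x]))))"

record ('k, 'o, 'f) lincat = "('o, 'f) cat" +
  Hom :: "'o \<Rightarrow> 'o \<Rightarrow> ('k, 'f) module"

locale linear_category = cring R + category C
  for R :: "('k, 'r) ring_scheme" and C :: "('k, 'o, 'f, 'x) lincat_scheme" (structure) +
  assumes Hom_module: "\<lbrakk>A \<in> Ob C; B \<in> Ob C\<rbrakk> \<Longrightarrow> module R (Hom C A B)"
    and Hom_carrier: "\<lbrakk>A \<in> Ob C; B \<in> Ob C\<rbrakk>
      \<Longrightarrow> carrier (Hom C A B) = {f \<in> Arr C. Src C f = A \<and> Tgt C f = B}"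
    and Comp_linear_right: "\<lbrakk>A \<in> Ob C; B \<in> Ob C; D \<in> Ob C; g \<in> carrier (Hom C B D)\<rbrakk>
      \<Longrightarrow> linear_map R (Hom C A B) (Hom C A D) (\<lambda>f. g \<bullet> f)"
    and Comp_linear_left: "\<lbrakk>A \<in> Ob C; B \<in> Ob C; D \<in> Ob C; f \<in> carrier (Hom C A B)\<rbrakk>
      \<Longrightarrow> linear_map R (Hom C B D) (Hom C A D) (\<lambda>g. g \<bullet> f)"

locale linear_functor = C: linear_category R C + D: linear_category R D
  for R :: "('k, 'r) ring_scheme"
    and C :: "('k, 'o, 'f, 'x) lincat_scheme" and D :: "('k, 'p, 'g, 'y) lincat_scheme"
    and Fo :: "'o \<Rightarrow> 'p" and Fa :: "'f \<Rightarrow> 'g" +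
  assumes functor_Ob: "A \<in> Ob C \<Longrightarrow> Fo A \<in> Ob D"
    and functor_linear: "\<lbrakk>A \<in> Ob C; B \<in> Ob C\<rbrakk>
      \<Longrightarrow> linear_map R (Hom C A B) (Hom D (Fo A) (Fo B)) Fa"
    and functor_Idn: "A \<in> Ob C \<Longrightarrow> Fa (Idn C A) = Idn D (Fo A)"
    and functor_Comp: "\<lbrakk>g \<in> Arr C; f \<in> Arr C; Src C g = Tgt C f\<rbrakk>
      \<Longrightarrow> Fa (g \<bullet>\<^bsub>C\<^esub> f) = Fa g \<bullet>\<^bsub>D\<^esub> Fa f"

definition is_iso :: "('o, 'f, 'x) cat_scheme \<Rightarrow> 'f \<Rightarrow> bool" where
  "is_iso C f \<longleftrightarrow> f \<in> Arr C \<and>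
     (\<exists>g\<in>Arr C. Src C g = Tgt C f \<and> Tgt C g = Src C f \<and>
        g \<bullet>\<^bsub>C\<^esub> f = Idn C (Src C f) \<and> f \<bullet>\<^bsub>C\<^esub> g = Idn C (Tgt C f))"

section \<open>Prestacks and bimodules\<close>

text \<open>\<open>pob u\<close> and \<open>parr u\<close> are the object and arrow part of \<open>u\<^sup>*\<close>; \<open>tw u v A\<close> is
  the component \<open>c\<^bsup>u,v,A\<^esup> : v\<^sup>* u\<^sup>* A \<rightarrow> (u v)\<^sup>* A\<close>.\<close>

record ('k, 'o, 'u, 'a, 'h) prestack =
  pcat :: "'o \<Rightarrow> ('k, 'a, 'h) lincat"
  pob :: "'u \<Rightarrow> 'a \<Rightarrow> 'a"
  parr :: "'u \<Rightarrow> 'h \<Rightarrow> 'h"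
  tw :: "'u \<Rightarrow> 'u \<Rightarrow> 'a \<Rightarrow> 'h"

locale prestack = cring R + category \<U>
  for R :: "('k, 'r) ring_scheme" and \<U> :: "('o, 'u) cat"
    and \<A> :: "('k, 'o, 'u, 'a, 'h) prestack" +
  assumes pcat_linear: "U \<in> Ob \<U> \<Longrightarrow> linear_category R (pcat \<A> U)"
    and pullback_functor: "u \<in> Arr \<U> \<Longrightarrow>
      linear_functor R (pcat \<A> (Tgt \<U> u)) (pcat \<A> (Src \<U> u)) (pob \<A> u) (parr \<A> u)"
    and pob_Idn: "\<lbrakk>U \<in> Ob \<U>; A \<in> Ob (pcat \<A> U)\<rbrakk> \<Longrightarrow> pob \<A> (Idn \<U> U) A = A"
    and parr_Idn: "\<lbrakk>U \<in> Ob \<U>; f \<in> Arr (pcat \<A> U)\<rbrakk> \<Longrightarrow> parr \<A> (Idn \<U> U) f = f"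
    and tw_Hom: "\<lbrakk>u \<in> Arr \<U>; v \<in> Arr \<U>; Src \<U> u = Tgt \<U> v; A \<in> Ob (pcat \<A> (Tgt \<U> u))\<rbrakk>
      \<Longrightarrow> tw \<A> u v A \<in> carrier (Hom (pcat \<A> (Src \<U> v))
            (pob \<A> v (pob \<A> u A)) (pob \<A> (u \<bullet>\<^bsub>\<U>\<^esub> v) A))"
    and tw_iso: "\<lbrakk>u \<in> Arr \<U>; v \<in> Arr \<U>; Src \<U> u = Tgt \<U> v; A \<in> Ob (pcat \<A> (Tgt \<U> u))\<rbrakk>
      \<Longrightarrow> is_iso (pcat \<A> (Src \<U> v)) (tw \<A> u v A)"
    and tw_natural: "\<lbrakk>u \<in> Arr \<U>; v \<in> Arr \<U>; Src \<U> u = Tgt \<U> v; f \<in> Arr (pcat \<A> (Tgt \<U> u))\<rbrakk>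
      \<Longrightarrow> tw \<A> u v (Tgt (pcat \<A> (Tgt \<U> u)) f) \<bullet>\<^bsub>pcat \<A> (Src \<U> v)\<^esub> parr \<A> v (parr \<A> u f)
        = parr \<A> (u \<bullet>\<^bsub>\<U>\<^esub> v) f \<bullet>\<^bsub>pcat \<A> (Src \<U> v)\<^esub> tw \<A> u v (Src (pcat \<A> (Tgt \<U> u)) f)"
    and tw_Idn_right: "\<lbrakk>u \<in> Arr \<U>; A \<in> Ob (pcat \<A> (Tgt \<U> u))\<rbrakk>
      \<Longrightarrow> tw \<A> u (Idn \<U> (Src \<U> u)) A = Idn (pcat \<A> (Src \<U> u)) (pob \<A> u A)"
    and tw_Idn_left: "\<lbrakk>v \<in> Arr \<U>; A \<in> Ob (pcat \<A> (Tgt \<U> v))\<rbrakk>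
      \<Longrightarrow> tw \<A> (Idn \<U> (Tgt \<U> v)) v A = Idn (pcat \<A> (Src \<U> v)) (pob \<A> v A)"
    and tw_coherence: "\<lbrakk>u \<in> Arr \<U>; v \<in> Arr \<U>; w \<in> Arr \<U>; Src \<U> u = Tgt \<U> v; Src \<U> v = Tgt \<U> w;
        A \<in> Ob (pcat \<A> (Tgt \<U> u))\<rbrakk>
      \<Longrightarrow> tw \<A> u (v \<bullet>\<^bsub>\<U>\<^esub> w) A \<bullet>\<^bsub>pcat \<A> (Src \<U> w)\<^esub> tw \<A> v w (pob \<A> u A)
        = tw \<A> (u \<bullet>\<^bsub>\<U>\<^esub> v) w A \<bullet>\<^bsub>pcat \<A> (Src \<U> w)\<^esub> parr \<A> w (tw \<A> u v A)"

text \<open>\<open>bact U b x a\<close> is the two-sided action \<open>b x a\<close>, a map \<open>M\<^sup>U(A, B) \<rightarrow> M\<^sup>U(A', B')\<close> for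
  \<open>a : A' \<rightarrow> A\<close> and \<open>b : B \<rightarrow> B'\<close>; \<open>bres u A B\<close> is \<open>M\<^sup>u\<close> on \<open>M\<^sup>U(A, B)\<close>.\<close>

record ('k, 'o, 'u, 'a, 'h, 'm) bimodule =
  bmod :: "'o \<Rightarrow> 'a \<Rightarrow> 'a \<Rightarrow> ('k, 'm) module"
  bact :: "'o \<Rightarrow> 'h \<Rightarrow> 'm \<Rightarrow> 'h \<Rightarrow> 'm"
  bres :: "'u \<Rightarrow> 'a \<Rightarrow> 'a \<Rightarrow> 'm \<Rightarrow> 'm"

locale prestack_bimodule = prestack R \<U> \<A>
  for R :: "('k, 'r) ring_scheme" and \<U> :: "('o, 'u) cat"
    and \<A> :: "('k, 'o, 'u, 'a, 'h) prestack"
    and M :: "('k, 'o, 'u, 'a, 'h, 'm) bimodule" +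
  assumes bmod_module: "\<lbrakk>U \<in> Ob \<U>; A \<in> Ob (pcat \<A> U); B \<in> Ob (pcat \<A> U)\<rbrakk>
      \<Longrightarrow> module R (bmod M U A B)"
    and bact_linear: "\<lbrakk>U \<in> Ob \<U>; A \<in> Ob (pcat \<A> U); B \<in> Ob (pcat \<A> U);
        A' \<in> Ob (pcat \<A> U); B' \<in> Ob (pcat \<A> U);
        a \<in> carrier (Hom (pcat \<A> U) A' A); b \<in> carrier (Hom (pcat \<A> U) B B')\<rbrakk>
      \<Longrightarrow> linear_map R (bmod M U A B) (bmod M U A' B') (\<lambda>x. bact M U b x a)"
    and bact_linear_left: "\<lbrakk>U \<in> Ob \<U>; A \<in> Ob (pcat \<A> U); B \<in> Ob (pcat \<A> U);
        A' \<in> Ob (pcat \<A> U); B' \<in> Ob (pcat \<A> U);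
        a \<in> carrier (Hom (pcat \<A> U) A' A); x \<in> carrier (bmod M U A B)\<rbrakk>
      \<Longrightarrow> linear_map R (Hom (pcat \<A> U) B B') (bmod M U A' B') (\<lambda>b. bact M U b x a)"
    and bact_linear_right: "\<lbrakk>U \<in> Ob \<U>; A \<in> Ob (pcat \<A> U); B \<in> Ob (pcat \<A> U);
        A' \<in> Ob (pcat \<A> U); B' \<in> Ob (pcat \<A> U);
        b \<in> carrier (Hom (pcat \<A> U) B B'); x \<in> carrier (bmod M U A B)\<rbrakk>
      \<Longrightarrow> linear_map R (Hom (pcat \<A> U) A' A) (bmod M U A' B') (\<lambda>a. bact M U b x a)"
    and bact_Idn: "\<lbrakk>U \<in> Ob \<U>; A \<in> Ob (pcat \<A> U); B \<in> Ob (pcat \<A> U); x \<in> carrier (bmod M U A B)\<rbrakk>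
      \<Longrightarrow> bact M U (Idn (pcat \<A> U) B) x (Idn (pcat \<A> U) A) = x"
    and bact_Comp: "\<lbrakk>U \<in> Ob \<U>; a \<in> Arr (pcat \<A> U); a' \<in> Arr (pcat \<A> U);
        b \<in> Arr (pcat \<A> U); b' \<in> Arr (pcat \<A> U);
        Src (pcat \<A> U) a = Tgt (pcat \<A> U) a'; Src (pcat \<A> U) b' = Tgt (pcat \<A> U) b;
        x \<in> carrier (bmod M U (Tgt (pcat \<A> U) a) (Src (pcat \<A> U) b))\<rbrakk>
      \<Longrightarrow> bact M U (b' \<bullet>\<^bsub>pcat \<A> U\<^esub> b) x (a \<bullet>\<^bsub>pcat \<A> U\<^esub> a') = bact M U b' (bact M U b x a) a'"
    and bres_linear: "\<lbrakk>u \<in> Arr \<U>; A \<in> Ob (pcat \<A> (Tgt \<U> u)); B \<in> Ob (pcat \<A> (Tgt \<U> u))\<rbrakk>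
      \<Longrightarrow> linear_map R (bmod M (Tgt \<U> u) A B) (bmod M (Src \<U> u) (pob \<A> u A) (pob \<A> u B))
            (bres M u A B)"
    and bres_Idn: "\<lbrakk>U \<in> Ob \<U>; A \<in> Ob (pcat \<A> U); B \<in> Ob (pcat \<A> U); x \<in> carrier (bmod M U A B)\<rbrakk>
      \<Longrightarrow> bres M (Idn \<U> U) A B x = x"
    and bres_bact: "\<lbrakk>u \<in> Arr \<U>; a \<in> Arr (pcat \<A> (Tgt \<U> u)); b \<in> Arr (pcat \<A> (Tgt \<U> u));
        x \<in> carrier (bmod M (Tgt \<U> u) (Tgt (pcat \<A> (Tgt \<U> u)) a) (Src (pcat \<A> (Tgt \<U> u)) b))\<rbrakk>
      \<Longrightarrow> bres M u (Src (pcat \<A> (Tgt \<U> u)) a) (Tgt (pcat \<A> (Tgt \<U> u)) b) (bact M (Tgt \<U> u) b x a)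
        = bact M (Src \<U> u) (parr \<A> u b)
            (bres M u (Tgt (pcat \<A> (Tgt \<U> u)) a) (Src (pcat \<A> (Tgt \<U> u)) b) x)
            (parr \<A> u a)"
    and bres_tw: "\<lbrakk>u \<in> Arr \<U>; v \<in> Arr \<U>; Src \<U> u = Tgt \<U> v;
        A \<in> Ob (pcat \<A> (Tgt \<U> u)); B \<in> Ob (pcat \<A> (Tgt \<U> u));
        x \<in> carrier (bmod M (Tgt \<U> u) A B)\<rbrakk>
      \<Longrightarrow> bact M (Src \<U> v) (Idn (pcat \<A> (Src \<U> v)) (pob \<A> (u \<bullet>\<^bsub>\<U>\<^esub> v) B))
            (bres M (u \<bullet>\<^bsub>\<U>\<^esub> v) A B x) (tw \<A> u v A)
        = bact M (Src \<U> v) (tw \<A> u v B)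
            (bres M v (pob \<A> u A) (pob \<A> u B) (bres M u A B x))
            (Idn (pcat \<A> (Src \<U> v)) (pob \<A> v (pob \<A> u A)))"

section \<open>Shuffles and partitions\<close>

text \<open>Positions are counted from 0. A permutation \<open>\<beta>\<close> acts on a list by placing the entry
  at position \<open>i\<close> into position \<open>\<beta> i\<close>.\<close>

definition place :: "(nat \<Rightarrow> nat) \<Rightarrow> 'x list \<Rightarrow> 'x list" where
  "place \<beta> xs = permute_list (inv_into UNIV \<beta>) xs"

definition shuffle_perms :: "nat \<Rightarrow> nat \<Rightarrow> (nat \<Rightarrow> nat) set" where
  "shuffle_perms m l =
     {\<beta>. \<beta> permutes {..<m + l} \<and> strict_mono_on {..<m} \<beta> \<and> strict_mono_on {m..<m + l} \<beta>}"

text \<open>A partition \<open>(m\<^sub>k, \<dots>, m\<^sub>1)\<close> is the list \<open>[m\<^sub>k, \<dots>, m\<^sub>1]\<close>;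
  \<open>part ms j\<close> is \<open>m\<^sub>j\<close>.\<close>

definition partitions :: "nat \<Rightarrow> nat list set" where
  "partitions n = {ms. (\<forall>m\<in>set ms. 1 \<le> m) \<and> sum_list ms = n}"

definition part_sign :: "nat \<Rightarrow> nat list \<Rightarrow> int" where
  "part_sign n ms = (-1) ^ (n - length ms)"

definition part :: "nat list \<Rightarrow> nat \<Rightarrow> nat" where
  "part ms j = ms ! (length ms - j)"

section \<open>Simplices\<close>

text \<open>A simplex \<open>(u\<^sub>1, \<dots>, u\<^sub>p)\<close> of the nerve is the pair \<open>(U\<^sub>0, [u\<^sub>1, \<dots>, u\<^sub>p])\<close>;
  the initial object is recorded for the sake of \<open>p = 0\<close>.\<close>

type_synonym ('o, 'u) nsimplex = "'o \<times> 'u list"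

definition nvert :: "('o, 'u, 'x) cat_scheme \<Rightarrow> ('o, 'u) nsimplex \<Rightarrow> nat \<Rightarrow> 'o" where
  "nvert \<U> \<sigma> i = (if i = 0 then fst \<sigma> else Tgt \<U> (snd \<sigma> ! (i - 1)))"

definition nend :: "('o, 'u, 'x) cat_scheme \<Rightarrow> ('o, 'u) nsimplex \<Rightarrow> 'o" where
  "nend \<U> \<sigma> = nvert \<U> \<sigma> (length (snd \<sigma>))"

definition nerve :: "('o, 'u, 'x) cat_scheme \<Rightarrow> nat \<Rightarrow> ('o, 'u) nsimplex set" where
  "nerve \<U> p = {\<sigma>. length (snd \<sigma>) = p \<and> fst \<sigma> \<in> Ob \<U> \<and>
     (\<forall>i<p. snd \<sigma> ! i \<in> Arr \<U> \<and> Src \<U> (snd \<sigma> ! i) = nvert \<U> \<sigma> i)}"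

definition nleft :: "nat \<Rightarrow> ('o, 'u) nsimplex \<Rightarrow> ('o, 'u) nsimplex" where
  "nleft k \<sigma> = (fst \<sigma>, take k (snd \<sigma>))"

definition nright :: "('o, 'u, 'x) cat_scheme \<Rightarrow> nat \<Rightarrow> ('o, 'u) nsimplex \<Rightarrow> ('o, 'u) nsimplex" where
  "nright \<U> k \<sigma> = (nvert \<U> \<sigma> k, drop k (snd \<sigma>))"

definition ncomp :: "('o, 'u, 'x) cat_scheme \<Rightarrow> ('o, 'u) nsimplex \<Rightarrow> 'u" where
  "ncomp \<U> \<sigma> = foldl (\<lambda>w u. u \<bullet>\<^bsub>\<U>\<^esub> w) (Idn \<U> (fst \<sigma>)) (snd \<sigma>)"

text \<open>The list \<open>\<sigma>[m\<^sub>k], \<dots>, \<sigma>[m\<^sub>1]\<close>; then \<open>piece \<U> \<sigma> ms j\<close> is \<open>\<sigma>[m\<^sub>j]\<close>.\<close>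

fun pieces :: "('o, 'u, 'x) cat_scheme \<Rightarrow> ('o, 'u) nsimplex \<Rightarrow> nat list \<Rightarrow> ('o, 'u) nsimplex list" where
  "pieces \<U> \<sigma> [] = []"
| "pieces \<U> \<sigma> (m # ms) = nleft m \<sigma> # pieces \<U> (nright \<U> m \<sigma>) ms"

definition piece :: "('o, 'u, 'x) cat_scheme \<Rightarrow> ('o, 'u) nsimplex \<Rightarrow> nat list \<Rightarrow> nat \<Rightarrow> ('o, 'u) nsimplex" where
  "piece \<U> \<sigma> ms j = pieces \<U> \<sigma> ms ! (length ms - j)"

text \<open>\<open>face \<U> i [u\<^sub>1, \<dots>, u\<^sub>p] = [u\<^sub>1, \<dots>, u\<^sub>i\<^sub>+\<^sub>1 u\<^sub>i, \<dots>, u\<^sub>p]\<close> for \<open>1 \<le> i < p\<close>.\<close>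

definition face :: "('o, 'u, 'x) cat_scheme \<Rightarrow> nat \<Rightarrow> 'u list \<Rightarrow> 'u list" where
  "face \<U> i us = take (i - 1) us @ [us ! i \<bullet>\<^bsub>\<U>\<^esub> us ! (i - 1)] @ drop (i + 1) us"

text \<open>A simplex \<open>(a\<^sub>1, \<dots>, a\<^sub>q)\<close> in a linear category is \<open>(A\<^sub>0, [a\<^sub>1, \<dots>, a\<^sub>q])\<close>, with
  \<open>a\<^sub>i : A\<^bsub>q-i\<^esub> \<rightarrow> A\<^bsub>q-i+1\<^esub>\<close>, so the list is in composition order, opposite to the
  convention for the nerve. \<open>vert C a j\<close> is \<open>A\<^sub>j\<close>.\<close>

type_synonym ('a, 'h) simplex = "'a \<times> 'h list"

definition vert :: "('a, 'h, 'x) cat_scheme \<Rightarrow> ('a, 'h) simplex \<Rightarrow> nat \<Rightarrow> 'a" where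
  "vert C a j = (if j = 0 then fst a else Tgt C (snd a ! (length (snd a) - j)))"

definition simplices :: "('k, 'a, 'h, 'x) lincat_scheme \<Rightarrow> nat \<Rightarrow> ('a, 'h) simplex set" where
  "simplices C q = {a. length (snd a) = q \<and> (\<forall>j\<le>q. vert C a j \<in> Ob C) \<and>
     (\<forall>i\<in>{1..q}. snd a ! (i - 1) \<in> carrier (Hom C (vert C a (q - i)) (vert C a (q - i + 1))))}"

section \<open>Chains of natural transformations and paths\<close>

text \<open>A functor is its pair of object and arrow part, a natural transformation its family of
  components, and a chain \<open>T\<^sub>0 \<rightarrow> \<dots> \<rightarrow> T\<^sub>l\<close> of natural transformations \<open>(r\<^sub>1, \<dots>, r\<^sub>l)\<close>, with
  \<open>r\<^sub>i : T\<^bsub>l-i\<^esub> \<rightarrow> T\<^bsub>l-i+1\<^esub>\<close>, is the pair \<open>([T\<^sub>0, \<dots>, T\<^sub>l], [r\<^sub>1, \<dots>, r\<^sub>l])\<close>.\<close>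

type_synonym ('a, 'h) funct = "('a \<Rightarrow> 'a) \<times> ('h \<Rightarrow> 'h)"
type_synonym ('a, 'h) ntchain = "('a, 'h) funct list \<times> ('a \<Rightarrow> 'h) list"

text \<open>The simplex \<open>\<beta>(a, r)\<close>, without its initial object \<open>T\<^sub>0 A\<^sub>0\<close>; \<open>C\<close> is the category in which
  \<open>a\<close> lives.\<close>

definition shuffle_chain ::
  "('a, 'h, 'x) cat_scheme \<Rightarrow> (nat \<Rightarrow> nat) \<Rightarrow> ('a, 'h) simplex \<Rightarrow> ('a, 'h) ntchain \<Rightarrow> 'h list" where
  "shuffle_chain C \<beta> a r =
     (let m = length (snd a); l = length (snd r);
          L = place \<beta> (map Inl (snd a) @ map Inr (snd r))
      in map (\<lambda>x. case L ! x of
             Inl f \<Rightarrow> snd (fst r ! (l - length (filter (Not \<circ> isl) (take x L)))) f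
           | Inr t \<Rightarrow> t (vert C a (m - length (filter isl (take x L)))))
         [0..<m + l])"

text \<open>A path of an \<open>n\<close>-simplex is determined by the list of the \<open>n - 1\<close> successive choices
  of a face index.\<close>

fun path_choices :: "nat \<Rightarrow> nat list set" where
  "path_choices 0 = {[]}"
| "path_choices (Suc 0) = {[]}"
| "path_choices (Suc (Suc n)) = {i # is |i is. i \<in> {1..Suc n} \<and> is \<in> path_choices (Suc n)}"

fun path_sign :: "nat list \<Rightarrow> int" where
  "path_sign [] = 1"
| "path_sign (i # is) = (-1) ^ i * path_sign is"

context
  fixes \<U> :: "('o, 'u) cat"
    and \<A> :: "('k, 'o, 'u, 'a, 'h) prestack"
begin

text \<open>\<open>\<sigma>\<^sup>\<star> = u\<^sub>1\<^sup>* \<dots> u\<^sub>p\<^sup>*\<close>\<close>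

definition star :: "'u list \<Rightarrow> ('a, 'h) funct" where
  "star us = (foldr (pob \<A>) us, foldr (parr \<A>) us)"

text \<open>\<open>\<epsilon>\<^bsup>\<sigma>,i\<^esup> = u\<^sub>1\<^sup>* \<dots> u\<^bsub>i-1\<^esub>\<^sup>* c\<^bsup>u\<^sub>i\<^sub>+\<^sub>1,u\<^sub>i\<^esup> u\<^bsub>i+2\<^esub>\<^sup>* \<dots> u\<^sub>p\<^sup>*\<close>\<close>

definition eps :: "'u list \<Rightarrow> nat \<Rightarrow> 'a \<Rightarrow> 'h" where
  "eps us i A =
     snd (star (take (i - 1) us)) (tw \<A> (us ! i) (us ! (i - 1)) (fst (star (drop (i + 1) us)) A))"

fun path_functs :: "'u list \<Rightarrow> nat list \<Rightarrow> ('a, 'h) funct list" where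
  "path_functs us [] = [star us]"
| "path_functs us (i # is) = star us # path_functs (face \<U> i us) is"

fun path_nts :: "'u list \<Rightarrow> nat list \<Rightarrow> ('a \<Rightarrow> 'h) list" where
  "path_nts us [] = []"
| "path_nts us (i # is) = path_nts (face \<U> i us) is @ [eps us i]"

text \<open>The component at \<open>A\<close> of \<open>\<parallel>r\<parallel> = r\<^sub>1 \<dots> r\<^bsub>n-1\<^esub>\<close>; \<open>U\<close> is the initial object of the simplex.\<close>

definition path_comp :: "'o \<Rightarrow> 'u list \<Rightarrow> nat list \<Rightarrow> 'a \<Rightarrow> 'h" where
  "path_comp U us is A =
     foldr (\<lambda>r g. r A \<bullet>\<^bsub>pcat \<A> U\<^esub> g) (path_nts us is) (Idn (pcat \<A> U) (fst (star us) A))"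

text \<open>\<open>c\<^bsup>\<sigma>,k,A\<^esup>\<close>. For \<open>k = 0\<close> and \<open>k = p\<close> one of the two composites below is an identity arrow,
  so in a prestack this is the identity.\<close>

definition tw_cut :: "('o, 'u) nsimplex \<Rightarrow> nat \<Rightarrow> 'a \<Rightarrow> 'h" where
  "tw_cut \<sigma> k A = tw \<A> (ncomp \<U> (nright \<U> k \<sigma>)) (ncomp \<U> (nleft k \<sigma>)) A"

text \<open>\<open>c\<^bsup>\<sigma>,m,A\<^esup>\<close> for a partition \<open>m\<close>. As the composite does not depend on the path,
  an arbitrary one is chosen.\<close>

definition tw_part :: "('o, 'u) nsimplex \<Rightarrow> nat list \<Rightarrow> 'a \<Rightarrow> 'h" where
  "tw_part \<sigma> ms A =
     (if ms = [] then Idn (pcat \<A> (fst \<sigma>)) A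
      else path_comp (fst \<sigma>) (map (ncomp \<U>) (pieces \<U> \<sigma> ms))
             (SOME is. is \<in> path_choices (length ms)) A)"

section \<open>The graded category and the two cochain modules\<close>

definition gr_Hom :: "'u \<Rightarrow> 'a \<Rightarrow> 'a \<Rightarrow> ('k, 'h) module" where
  "gr_Hom u A B = Hom (pcat \<A> (Src \<U> u)) A (pob \<A> u B)"

definition gr_bmod :: "('k, 'o, 'u, 'a, 'h, 'm) bimodule \<Rightarrow> 'u \<Rightarrow> 'a \<Rightarrow> 'a \<Rightarrow> ('k, 'm) module" where
  "gr_bmod M u A B = bmod M (Src \<U> u) A (pob \<A> u B)"

text \<open>A chain over \<open>\<sigma>\<close> is \<open>([A\<^sub>0, \<dots>, A\<^sub>n], [a\<^sub>1, \<dots>, a\<^sub>n])\<close>; here all objects are recorded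
  since an element of \<open>gr_Hom u A B\<close> does not determine \<open>B\<close>.\<close>

definition gr_Homs :: "('o, 'u) nsimplex \<Rightarrow> 'a list \<Rightarrow> ('k, 'h) module list" where
  "gr_Homs \<sigma> As = (let n = length (snd \<sigma>) in
     map (\<lambda>i. gr_Hom (snd \<sigma> ! (n - i)) (As ! (n - i)) (As ! (n + 1 - i))) [1..<n + 1])"

definition gr_objects :: "('o, 'u) nsimplex \<Rightarrow> 'a list set" where
  "gr_objects \<sigma> = {As. length As = length (snd \<sigma>) + 1 \<and>
     (\<forall>i\<le>length (snd \<sigma>). As ! i \<in> Ob (pcat \<A> (nvert \<U> \<sigma> i)))}"

definition gr_chains :: "('o, 'u) nsimplex \<Rightarrow> ('a list \<times> 'h list) set" where
  "gr_chains \<sigma> = {(As, as). As \<in> gr_objects \<sigma> \<and> as \<in> listset (map carrier (gr_Homs \<sigma> As))}"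

text \<open>Cochains are extensional: \<open>undefined\<close> outside their domain.\<close>

definition U_cochains ::
  "('k, 'r) ring_scheme \<Rightarrow> ('k, 'o, 'u, 'a, 'h, 'm) bimodule \<Rightarrow> nat
    \<Rightarrow> (('o, 'u) nsimplex \<Rightarrow> 'a list \<times> 'h list \<Rightarrow> 'm) set" where
  "U_cochains R M n = {\<psi>.
     (\<forall>\<sigma>\<in>nerve \<U> n. \<forall>As\<in>gr_objects \<sigma>.
        multilinear R (gr_Homs \<sigma> As) (gr_bmod M (ncomp \<U> \<sigma>) (As ! 0) (As ! n)) (\<lambda>as. \<psi> \<sigma> (As, as))) \<and>
     (\<forall>\<sigma> c. \<not> (\<sigma> \<in> nerve \<U> n \<and> c \<in> gr_chains \<sigma>) \<longrightarrow> \<psi> \<sigma> c = undefined)}"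

text \<open>The value module \<open>M\<^bsup>U\<^sub>0\<^esup>(\<sigma>\<^sup>\<star> A, \<sigma>\<^sup>* B)\<close>.\<close>

definition GS_bmod ::
  "('k, 'o, 'u, 'a, 'h, 'm) bimodule \<Rightarrow> ('o, 'u) nsimplex \<Rightarrow> 'a \<Rightarrow> 'a \<Rightarrow> ('k, 'm) module" where
  "GS_bmod M \<sigma> A B = bmod M (fst \<sigma>) (fst (star (snd \<sigma>)) A) (pob \<A> (ncomp \<U> \<sigma>) B)"

text \<open>An element of \<open>C\<^bsup>n\<^esup>\<^sub>G\<^sub>S = \<Prod>\<^bsub>p+q=n\<^esub> C\<^bsup>p,q\<^esup>\<close> is a single function \<open>\<phi>\<close>, whose restriction
  to \<open>p\<close>-simplices \<open>\<sigma>\<close> is the component in \<open>C\<^bsup>p,n-p\<^esup>\<close>.\<close>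

definition GS_dom :: "nat \<Rightarrow> (('o, 'u) nsimplex \<times> ('a, 'h) simplex) set" where
  "GS_dom n = {(\<sigma>, a). \<exists>p q. p + q = n \<and> \<sigma> \<in> nerve \<U> p \<and> a \<in> simplices (pcat \<A> (nend \<U> \<sigma>)) q}"

definition GS_cochains ::
  "('k, 'r) ring_scheme \<Rightarrow> ('k, 'o, 'u, 'a, 'h, 'm) bimodule \<Rightarrow> nat
    \<Rightarrow> (('o, 'u) nsimplex \<Rightarrow> ('a, 'h) simplex \<Rightarrow> 'm) set" where
  "GS_cochains R M n = {\<phi>.
     (\<forall>p q. p + q = n \<longrightarrow> (\<forall>\<sigma>\<in>nerve \<U> p. \<forall>As.
        length As = q + 1 \<and> set As \<subseteq> Ob (pcat \<A> (nend \<U> \<sigma>)) \<longrightarrow>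
        multilinear R
          (map (\<lambda>i. Hom (pcat \<A> (nend \<U> \<sigma>)) (As ! (q - i)) (As ! (q - i + 1))) [1..<q + 1])
          (GS_bmod M \<sigma> (As ! 0) (As ! q)) (\<lambda>as. \<phi> \<sigma> (As ! 0, as)))) \<and>
     (\<forall>\<sigma> a. (\<sigma>, a) \<notin> GS_dom n \<longrightarrow> \<phi> \<sigma> a = undefined)}"

definition GS_zero ::
  "('k, 'o, 'u, 'a, 'h, 'm) bimodule \<Rightarrow> ('o, 'u) nsimplex \<Rightarrow> ('a, 'h) simplex \<Rightarrow> 'm" where
  "GS_zero M \<sigma> a =
     \<zero>\<^bsub>GS_bmod M \<sigma> (fst a) (vert (pcat \<A> (nend \<U> \<sigma>)) a (length (snd a)))\<^esub>"

definition normalized ::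
  "('k, 'o, 'u, 'a, 'h, 'm) bimodule \<Rightarrow> nat \<Rightarrow> (('o, 'u) nsimplex \<Rightarrow> ('a, 'h) simplex \<Rightarrow> 'm) \<Rightarrow> bool" where
  "normalized M n \<phi> \<longleftrightarrow> (\<forall>(\<sigma>, a) \<in> GS_dom n.
     (\<exists>f\<in>set (snd a). \<exists>A\<in>Ob (pcat \<A> (nend \<U> \<sigma>)). f = Idn (pcat \<A> (nend \<U> \<sigma>)) A)
       \<longrightarrow> \<phi> \<sigma> a = GS_zero M \<sigma> a)"

definition reduced ::
  "('k, 'o, 'u, 'a, 'h, 'm) bimodule \<Rightarrow> nat \<Rightarrow> (('o, 'u) nsimplex \<Rightarrow> ('a, 'h) simplex \<Rightarrow> 'm) \<Rightarrow> bool" where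
  "reduced M n \<phi> \<longleftrightarrow> (\<forall>(\<sigma>, a) \<in> GS_dom n.
     (\<exists>u\<in>set (snd \<sigma>). \<exists>U\<in>Ob \<U>. u = Idn \<U> U) \<longrightarrow> \<phi> \<sigma> a = GS_zero M \<sigma> a)"

section \<open>The map F\<close>

text \<open>\<open>gr_under \<sigma> as i = u\<^sub>1\<^sup>* \<dots> u\<^bsub>n-i\<^esub>\<^sup>* a\<^sub>i\<close>, and \<open>gr_comp \<sigma> (As, as) i\<close> is the composite
  \<open>a\<^bsub>i,\<dots>,n\<^esub>\<close> of these for the indices \<open>i, \<dots>, n\<close>.\<close>

definition gr_under :: "('o, 'u) nsimplex \<Rightarrow> 'h list \<Rightarrow> nat \<Rightarrow> 'h" where
  "gr_under \<sigma> as i = snd (star (take (length (snd \<sigma>) - i) (snd \<sigma>))) (as ! (i - 1))"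

definition gr_comp :: "('o, 'u) nsimplex \<Rightarrow> 'a list \<times> 'h list \<Rightarrow> nat \<Rightarrow> 'h" where
  "gr_comp \<sigma> c i =
     foldr (\<lambda>j g. gr_under \<sigma> (snd c) j \<bullet>\<^bsub>pcat \<A> (fst \<sigma>)\<^esub> g) [i..<length (snd \<sigma>) + 1]
       (Idn (pcat \<A> (fst \<sigma>)) (fst c ! 0))"

text \<open>The part of a chain over \<open>\<sigma>\<close> that lies over \<open>R\<^sub>p \<sigma>\<close>.\<close>

definition gr_tail :: "nat \<Rightarrow> 'a list \<times> 'h list \<Rightarrow> 'a list \<times> 'h list" where
  "gr_tail p c = (drop p (fst c), take (length (snd c) - p) (snd c))"

text \<open>The family \<open>Seq(\<sigma>, c, ms)\<close>: each member is indexed by the list of choices made, one entry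
  \<open>(path, shuffle)\<close> for each part of \<open>ms\<close>. The last part involves no shuffle; its
  entry carries the identity.\<close>

fun seq_index :: "nat list \<Rightarrow> (nat list \<times> (nat \<Rightarrow> nat)) list set" where
  "seq_index [] = {[]}"
| "seq_index [m] = {[(is, id)] |is. is \<in> path_choices m}"
| "seq_index (m # m' # ms) =
     {(is, \<beta>) # z |is \<beta> z. is \<in> path_choices m \<and>
        \<beta> \<in> shuffle_perms (sum_list (m' # ms)) (m - 1) \<and> z \<in> seq_index (m' # ms)}"

fun seq_sign :: "(nat list \<times> (nat \<Rightarrow> nat)) list \<Rightarrow> int" where
  "seq_sign [] = 1"
| "seq_sign ((is, \<beta>) # z) = path_sign is * sign \<beta> * seq_sign z"

fun seq_arrows ::
  "('o, 'u) nsimplex \<Rightarrow> 'a list \<times> 'h list \<Rightarrow> nat list \<Rightarrow> (nat list \<times> (nat \<Rightarrow> nat)) list \<Rightarrow> 'h list" where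
  "seq_arrows \<sigma> c [m] ((is, \<beta>) # z) =
     map (\<lambda>r. r (fst c ! m)) (path_nts (snd \<sigma>) is) @ [gr_comp \<sigma> c 1]"
| "seq_arrows \<sigma> c (m # m' # ms) ((is, \<beta>) # z) =
     (let n = length (snd \<sigma>); us = take m (snd \<sigma>)
      in shuffle_chain (pcat \<A> (nvert \<U> \<sigma> m)) \<beta>
           (fst c ! m, seq_arrows (nright \<U> m \<sigma>) (gr_tail m c) (m' # ms) z)
           (path_functs us is, path_nts us is)
         @ [gr_comp \<sigma> c (n + 1 - m)])"
| "seq_arrows \<sigma> c _ _ = []"

definition F_map ::
  "('k, 'o, 'u, 'a, 'h, 'm) bimodule \<Rightarrow> nat \<Rightarrow> (('o, 'u) nsimplex \<Rightarrow> ('a, 'h) simplex \<Rightarrow> 'm)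
    \<Rightarrow> ('o, 'u) nsimplex \<Rightarrow> 'a list \<times> 'h list \<Rightarrow> 'm" where
  "F_map M n \<phi> \<sigma> c =
     (if \<sigma> \<in> nerve \<U> n \<and> c \<in> gr_chains \<sigma> then
        (let N = gr_bmod M (ncomp \<U> \<sigma>) (fst c ! 0) (fst c ! n); C = pcat \<A> (fst \<sigma>); A\<^sub>n = fst c ! n
         in \<Oplus>\<^bsub>N\<^esub>p\<in>{0..n}. \<Oplus>\<^bsub>N\<^esub>ms\<in>partitions (n - p). \<Oplus>\<^bsub>N\<^esub>z\<in>seq_index ms.
              [(part_sign (n - p) ms * seq_sign z)] \<cdot>\<^bsub>N\<^esub>
                bact M (fst \<sigma>)
                  (tw_cut \<sigma> p A\<^sub>n
                    \<bullet>\<^bsub>C\<^esub> parr \<A> (ncomp \<U> (nleft p \<sigma>)) (tw_part (nright \<U> p \<sigma>) ms A\<^sub>n))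
                  (\<phi> (nleft p \<sigma>) (fst c ! p, seq_arrows (nright \<U> p \<sigma>) (gr_tail p c) ms z))
                  (gr_comp \<sigma> c (n + 1 - p)))
      else undefined)"

end

section \<open>The map G\<close>

text \<open>Symbolic entries of the shuffled list, with indices counted from 1: \<open>Arrow i\<close> stands for \<open>a\<^sub>i\<close>,
  \<open>Head j\<close> for the \<open>j\<close>-th head and \<open>Step j i\<close> for \<open>r\<^bsup>j\<^esup>\<^sub>i\<close>.\<close>


datatype entry = is_Arrow: Arrow nat | is_Head: Head nat | Step nat nat

definition seqq_list :: "nat list \<Rightarrow> entry list" where
  "seqq_list ms = concat (map (\<lambda>j. Head j # map (Step j) [1..<part ms j]) [1..<length ms + 1])"

definition block_start :: "nat list \<Rightarrow> nat \<Rightarrow> nat" where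
  "block_start ms j = (\<Sum>i\<in>{1..<j}. part ms i)"

definition cond_shuffles :: "nat list \<Rightarrow> (nat \<Rightarrow> nat) set" where
  "cond_shuffles ms = {\<gamma>. \<gamma> permutes {..<sum_list ms} \<and>
     (\<forall>j\<in>{1..length ms}. strict_mono_on {block_start ms j..<block_start ms j + part ms j} \<gamma>) \<and>
     strict_mono_on (block_start ms ` {1..length ms}) \<gamma>}"

text \<open>An index \<open>(\<gamma>, [r\<^sup>1, \<dots>, r\<^sup>k])\<close> of the family \<open>Seqq\<close>, each path being given by its choices.\<close>

definition seqq_index :: "nat list \<Rightarrow> ((nat \<Rightarrow> nat) \<times> nat list list) set" where
  "seqq_index ms = {(\<gamma>, rs). \<gamma> \<in> cond_shuffles ms \<and> length rs = length ms \<and>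
     (\<forall>j\<in>{1..length ms}. rs ! (j - 1) \<in> path_choices (part ms j))}"

definition seqq_sign :: "(nat \<Rightarrow> nat) \<times> nat list list \<Rightarrow> int" where
  "seqq_sign z = sign (fst z) * (\<Prod>r\<leftarrow>snd z. path_sign r)"

text \<open>In the following definitions \<open>pre\<close> is the list of the entries before the current position.\<close>

definition n_arrows :: "entry list \<Rightarrow> nat" where
  "n_arrows pre = length (filter is_Arrow pre)"

definition n_heads :: "entry list \<Rightarrow> nat" where
  "n_heads pre = length (filter is_Head pre)"

definition n_steps :: "nat \<Rightarrow> entry list \<Rightarrow> nat" where
  "n_steps j pre = length (filter (\<lambda>e. \<exists>i. e = Step j i) pre)"

context
  fixes \<U> :: "('o, 'u) cat"
    and \<A> :: "('k, 'o, 'u, 'a, 'h) prestack"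
    and \<sigma> :: "('o, 'u) nsimplex" and ms :: "nat list" and rs :: "nat list list"
    and a :: "('a, 'h) simplex"
begin

text \<open>The functor \<open>F\<^sub>j = T\<^bsup>j\<^esup>\<^bsub>m\<^sub>j - 1 - x\<^sub>j\<^esub>\<close>.\<close>

definition star_funct :: "entry list \<Rightarrow> nat \<Rightarrow> ('a, 'h) funct" where
  "star_funct pre j =
     path_functs \<U> \<A> (snd (piece \<U> \<sigma> ms j)) (rs ! (j - 1)) ! (part ms j - 1 - n_steps j pre)"

text \<open>The object \<open>A\<^bsub>q-y\<^esub>\<close>, and \<open>X = F\<^sub>l \<dots> F\<^sub>1 A\<^bsub>q-y\<^esub>\<close>.\<close>

definition star_base :: "entry list \<Rightarrow> 'a" where
  "star_base pre = vert (pcat \<A> (nend \<U> \<sigma>)) a (length (snd a) - n_arrows pre)"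

definition star_object :: "entry list \<Rightarrow> 'a" where
  "star_object pre = fold (\<lambda>j. fst (star_funct pre j)) [1..<n_heads pre + 1] (star_base pre)"

fun star_arrow :: "entry list \<Rightarrow> entry \<Rightarrow> 'h" where
  "star_arrow pre (Arrow i) =
     fold (\<lambda>j. snd (star_funct pre j)) [1..<n_heads pre + 1] (snd a ! (i - 1))"
| "star_arrow pre (Step j i) =
     fold (\<lambda>j'. snd (star_funct pre j')) [j + 1..<n_heads pre + 1]
       ((path_nts \<U> \<A> (snd (piece \<U> \<sigma> ms j)) (rs ! (j - 1)) ! (i - 1))
         (fold (\<lambda>j'. fst (star_funct pre j')) [1..<j] (star_base pre)))"
| "star_arrow pre (Head j) =
     Idn (pcat \<A> (fst (piece \<U> \<sigma> ms j))) (pob \<A> (ncomp \<U> (piece \<U> \<sigma> ms j)) (star_object pre))"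

fun star_degree :: "entry list \<Rightarrow> entry \<Rightarrow> 'u" where
  "star_degree pre (Head j) = ncomp \<U> (piece \<U> \<sigma> ms j)"
| "star_degree pre _ =
     Idn \<U> (nvert \<U> \<sigma> (length (snd \<sigma>) - (\<Sum>j\<in>{1..n_heads pre}. part ms j)))"

end

definition star_entries :: "nat \<Rightarrow> nat list \<Rightarrow> (nat \<Rightarrow> nat) \<Rightarrow> (nat \<Rightarrow> nat) \<Rightarrow> entry list" where
  "star_entries q ms \<beta> \<gamma> = place \<beta> (map Arrow [1..<q + 1] @ place \<gamma> (seqq_list ms))"

context
  fixes \<U> :: "('o, 'u) cat"
    and \<A> :: "('k, 'o, 'u, 'a, 'h) prestack"
begin

text \<open>The chain \<open>a *\<^sub>\<beta> \<zeta>\<close>, and the simplex of the nerve over which it lies; the latter lists the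
  degrees in reverse order.\<close>

definition star_simplex ::
  "('o, 'u) nsimplex \<Rightarrow> nat list \<Rightarrow> nat \<Rightarrow> (nat \<Rightarrow> nat) \<Rightarrow> (nat \<Rightarrow> nat) \<times> nat list list
    \<Rightarrow> ('o, 'u) nsimplex" where
  "star_simplex \<sigma> ms q \<beta> z =
     (let es = star_entries q ms \<beta> (fst z)
      in (fst \<sigma>, rev (map (\<lambda>x. star_degree \<U> \<sigma> ms (take x es) (es ! x)) [0..<length es])))"

definition star_chain ::
  "('o, 'u) nsimplex \<Rightarrow> nat list \<Rightarrow> ('a, 'h) simplex \<Rightarrow> (nat \<Rightarrow> nat) \<Rightarrow> (nat \<Rightarrow> nat) \<times> nat list list
    \<Rightarrow> 'a list \<times> 'h list" where
  "star_chain \<sigma> ms a \<beta> z =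
     (let es = star_entries (length (snd a)) ms \<beta> (fst z)
      in (rev (map (\<lambda>x. star_object \<U> \<A> \<sigma> ms (snd z) a (take x es)) [0..<length es + 1]),
          map (\<lambda>x. star_arrow \<U> \<A> \<sigma> ms (snd z) a (take x es) (es ! x)) [0..<length es]))"

definition G_map ::
  "('k, 'o, 'u, 'a, 'h, 'm) bimodule \<Rightarrow> nat \<Rightarrow> (('o, 'u) nsimplex \<Rightarrow> 'a list \<times> 'h list \<Rightarrow> 'm)
    \<Rightarrow> ('o, 'u) nsimplex \<Rightarrow> ('a, 'h) simplex \<Rightarrow> 'm" where
  "G_map M n \<psi> \<sigma> a =
     (if (\<sigma>, a) \<in> GS_dom \<U> \<A> n then
        (let p = length (snd \<sigma>); q = length (snd a);
             N = GS_bmod \<U> \<A> M \<sigma> (fst a) (vert (pcat \<A> (nend \<U> \<sigma>)) a q)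
         in \<Oplus>\<^bsub>N\<^esub>ms\<in>partitions p. \<Oplus>\<^bsub>N\<^esub>z\<in>seqq_index ms. \<Oplus>\<^bsub>N\<^esub>\<beta>\<in>shuffle_perms q p.
              [(sign \<beta> * seqq_sign z)] \<cdot>\<^bsub>N\<^esub>
                \<psi> (star_simplex \<sigma> ms q \<beta> z) (star_chain \<sigma> ms a \<beta> z))
      else undefined)"

end

end

theory Submission
  imports Defs
begin

text \<open>
  In \<open>G (F \<phi>)\<close> no cancellation takes place: every summand but one vanishes by itself, and the
  remaining one is \<open>\<phi>\<close>.

  Let \<open>\<sigma>\<close> be a \<open>p\<close>-simplex, \<open>a\<close> a \<open>q\<close>-simplex and \<open>n = p + q\<close>. A summand of \<open>G\<close> evaluates its
  argument at a chain that is read off from a word of \<open>n\<close> letters: arrows of \<open>a\<close>, heads, and steps of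
  paths. A head contributes an identity morphism over a piece of \<open>\<sigma>\<close>; an arrow or a step contributes
  a morphism over an identity of the base category. So at each position of the chain the morphism or
  its degree is an identity. A summand of \<open>F\<close> cuts off the last \<open>p'\<close> letters, evaluates \<open>\<phi>\<close> over the
  string of their degrees, and does so at a simplex built by \<open>Seq\<close> from the other letters.

  \<^item> If a letter that is cut off is not a head, then the string of degrees contains an identity
    and the value is zero because \<open>\<phi>\<close> is reduced.
  \<^item> If all letters that are cut off are heads and another head remains, then each simplex of
    \<open>Seq\<close> contains an identity (\<open>seq_arrows_simplex\<close>) and the value is zero because \<open>\<phi>\<close> is
    normalized. Indeed, a part of the partition that meets only heads contributes a composite of
    identities. A part of size at least two that meets a letter of another kind contributes a path,
    and in a path each arrow of the base is merged with a neighbour at some stage; when this happens to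
    an identity, the step of the path is an identity transformation. The only parts to escape are
    single letters that are not heads, and these cannot cover the remaining head.
  \<^item> If all heads are cut off, then no step can be left over, since a step comes after the head of
    its block. So the word consists of the arrows followed by heads (\<open>star_word_split\<close>). This forces
    \<open>p' = p\<close>, all parts of the partition of \<open>p\<close> equal to one, and both permutations equal to the
    identity (\<open>star_entries_main\<close>).

  In the last case the argument of the second one applies to the partition that occurs in \<open>F\<close> as well
  and excludes parts of size at least two. In the single summand that is left, the simplex is \<open>a\<close>, and
  the twists and the composite acting on \<open>\<phi>\<close> are identities (\<open>F_term_main\<close>).

  The vanishing arguments refer to elements of the right modules, so most of the work is to see
  that the words of \<open>G\<close> do give chains (\<open>chain_mem\<close>) and that \<open>Seq\<close> consists of simplices with
  the right end points (\<open>seq_arrows_simplex\<close>).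
\<close>

section \<open>Permutations acting on lists\<close>

lemma in_listset_iff: "xs \<in> listset As \<longleftrightarrow> length xs = length As \<and> (\<forall>i<length As. xs ! i \<in> As ! i)"
proof (induction As arbitrary: xs)
  case (Cons A As)
  show ?case
    by (cases xs) (auto simp: set_Cons_def Cons.IH nth_Cons split: nat.splits)
qed auto

lemma length_place [simp]: "length (place \<beta> xs) = length xs"
  by (simp add: place_def)

lemma place_id [simp]: "place id xs = xs"
  by (simp add: place_def inv_id[unfolded id_def] id_def)

lemma set_place: "\<beta> permutes {..<length xs} \<Longrightarrow> set (place \<beta> xs) = set xs"
  unfolding place_def by (simp add: permutes_inv set_permute_list)

lemma nth_place:
  assumes "\<beta> permutes {..<length xs}" "i < length xs"
  shows "place \<beta> xs ! \<beta> i = xs ! i"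
proof -
  have "\<beta> i < length xs" using assms permutes_in_image by fastforce
  then have "place \<beta> xs ! \<beta> i = xs ! inv_into UNIV \<beta> (\<beta> i)"
    unfolding place_def permute_list_def by simp
  also have "\<dots> = xs ! i" by (simp add: permutes_inverses(2)[OF assms(1)])
  finally show ?thesis .
qed

text \<open>A permutation that is increasing on the positions of a subword moves this subword as a whole
  without changing it. Applied to shuffles and to conditioned shuffles, this determines the prefix
  counts on which the functors and objects in a shuffled chain depend.\<close>

lemma filter_place:
  assumes \<beta>: "\<beta> permutes {..<length xs}"
    and mono: "strict_mono_on {i. i < length xs \<and> P (xs ! i)} \<beta>"
  shows "filter P (place \<beta> xs) = filter P xs"
proof -
  let ?n = "length xs" and ?\<alpha> = "inv_into UNIV \<beta>"
  let ?I = "filter (\<lambda>i. P (xs ! i)) [0..<?n]"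
  have lt: "\<beta> i < ?n \<longleftrightarrow> i < ?n" for i using permutes_in_image[OF \<beta>] by auto
  have filt: "filter (\<lambda>i. P (xs ! ?\<alpha> i)) [0..<?n] = map \<beta> ?I"
  proof (rule strict_sorted_equal)
    show "sorted_wrt (<) (map \<beta> ?I)"
      unfolding sorted_wrt_map
      by (rule sorted_wrt_mono_rel[of _ "(<)"]) 
        (auto intro: strict_mono_onD[OF mono] simp: sorted_wrt_filter)
    show "set (filter (\<lambda>i. P (xs ! ?\<alpha> i)) [0..<?n]) = set (map \<beta> ?I)"
    proof (intro equalityI subsetI)
      fix j assume "j \<in> set (filter (\<lambda>i. P (xs ! ?\<alpha> i)) [0..<?n])"
      then have "j = \<beta> (?\<alpha> j)" "?\<alpha> j < ?n" "P (xs ! ?\<alpha> j)"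
        using permutes_inverses(1)[OF \<beta>] lt[of "?\<alpha> j"] by auto
      then show "j \<in> set (map \<beta> ?I)" by auto
    qed (use lt permutes_inverses(2)[OF \<beta>] in auto)
  qed (simp add: sorted_wrt_filter)
  have "filter P (place \<beta> xs) = map ((!) xs \<circ> ?\<alpha>) (filter (\<lambda>i. P (xs ! ?\<alpha> i)) [0..<?n])"
    unfolding place_def permute_list_def by (simp add: filter_map comp_def)
  also have "\<dots> = map ((!) xs) ?I"
    unfolding filt by (simp add: permutes_inverses(2)[OF \<beta>])
  also have "\<dots> = filter P xs"
  proof -
    have "filter P (map ((!) xs) [0..<?n]) = map ((!) xs) ?I"
      by (simp only: filter_map comp_def)
    then show ?thesis by (simp only: map_nth)
  qed
  finally show ?thesis .
qed

lemma place_eq_imp_id: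
  assumes \<beta>: "\<beta> permutes {..<length xs}" and "distinct xs" "place \<beta> xs = xs"
  shows "\<beta> = id"
proof
  fix i
  show "\<beta> i = id i"
  proof (cases "i < length xs")
    case True
    then have "\<beta> i < length xs" using permutes_in_image[OF \<beta>] by auto
    then show ?thesis using nth_place[OF \<beta> True] assms(2,3) True by (simp add: nth_eq_iff_index_eq)
  next
    case False
    then show ?thesis using \<beta> by (simp add: permutes_def)
  qed
qed

lemma nth_filter_prefix:
  assumes "filter P xs = ys" "x < length xs" "P (xs ! x)"
  shows "length (filter P (take x xs)) < length ys"
    and "xs ! x = ys ! length (filter P (take x xs))"
proof -
  have "xs = take x xs @ xs ! x # drop (Suc x) xs" using assms(2) by (simp add: id_take_nth_drop)
  then have *: "ys = filter P (take x xs) @ xs ! x # filter P (drop (Suc x) xs)"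
    using assms(1,3) by (metis filter.simps(2) filter_append)
  show "length (filter P (take x xs)) < length ys" using * by (metis length_append less_add_same_cancel1 length_greater_0_conv list.distinct(1))
  show "xs ! x = ys ! length (filter P (take x xs))" using * by (metis nth_append_length)
qed

lemma shuffle_perms_0 [simp]: "shuffle_perms m 0 = {id}"
proof -
  have "\<beta> = id" if "\<beta> \<in> shuffle_perms m 0" for \<beta>
  proof -
    let ?xs = "[0..<m]"
    have p: "\<beta> permutes {..<length ?xs}" and m: "strict_mono_on {..<m} \<beta>"
      using that by (auto simp: shuffle_perms_def)
    have "filter (\<lambda>_. True) (place \<beta> ?xs) = filter (\<lambda>_. True) ?xs"
      by (rule filter_place[OF p]) (use m in \<open>simp add: lessThan_def\<close>)
    then show ?thesis using place_eq_imp_id[OF p] by simp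
  qed
  then show ?thesis by (auto simp: shuffle_perms_def permutes_id strict_mono_on_def)
qed

section \<open>The index sets of the sums\<close>

lemma finite_shuffle_perms [simp]: "finite (shuffle_perms m l)"
  by (rule finite_subset[OF _ finite_permutations[of "{..<m + l}"]]) (auto simp: shuffle_perms_def)

lemma length_le_sum_list: "\<forall>m\<in>set ms. 1 \<le> m \<Longrightarrow> length ms \<le> sum_list (ms :: nat list)"
  by (induction ms) auto

lemma finite_partitions [simp]: "finite (partitions n)"
proof (rule finite_subset)
  show "partitions n \<subseteq> {ms. set ms \<subseteq> {..n} \<and> length ms \<le> n}"
  proof
    fix ms assume ms: "ms \<in> partitions n"
    then show "ms \<in> {ms. set ms \<subseteq> {..n} \<and> length ms \<le> n}"
      using ms length_le_sum_list by (auto simp: partitions_def intro: member_le_sum_list)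
  qed
  show "finite {ms. set ms \<subseteq> {..n} \<and> length ms \<le> n}"
    by (rule finite_lists_length_le) simp
qed

lemma length_path_choices: "is \<in> path_choices m \<Longrightarrow> length is = m - 1"
  by (induction m arbitrary: "is" rule: path_choices.induct) auto

lemma finite_path_choices [simp]: "finite (path_choices m)"
proof (induction m rule: path_choices.induct)
  case (3 n)
  have "path_choices (Suc (Suc n)) = (\<lambda>(i, is). i # is) ` ({1..Suc n} \<times> path_choices (Suc n))"
    by auto
  then show ?case using 3 by (metis finite_imageI finite_SigmaI finite_atLeastAtMost)
qed auto

lemma path_choices_nonempty: "path_choices m \<noteq> {}"
  by (induction m rule: path_choices.induct) auto

lemma finite_seq_index [simp]: "finite (seq_index ms)"
proof (induction ms rule: seq_index.induct)
  case (2 m)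
  have "seq_index [m] = (\<lambda>is. [(is, id)]) ` path_choices m" by auto
  then show ?case by simp
next
  case (3 m m' ms)
  have "seq_index (m # m' # ms) = (\<lambda>(is, \<beta>, z). (is, \<beta>) # z) `
      (path_choices m \<times> shuffle_perms (sum_list (m' # ms)) (m - 1) \<times> seq_index (m' # ms))"
    by (auto simp: image_iff)
  then show ?case using 3 by (metis finite_imageI finite_SigmaI finite_path_choices finite_shuffle_perms)
qed auto

lemma finite_seqq_index [simp]: "finite (seqq_index ms)"
proof (rule finite_subset)
  let ?P = "\<Union>j\<in>{1..length ms}. path_choices (part ms j)"
  show "seqq_index ms \<subseteq> {\<gamma>. \<gamma> permutes {..<sum_list ms}} \<times> {rs. set rs \<subseteq> ?P \<and> length rs = length ms}"
  proof (clarsimp simp: seqq_index_def cond_shuffles_def)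
    fix rs :: "nat list list" and r
    assume *: "length rs = length ms" "r \<in> set rs"
      "\<forall>j\<in>{Suc 0..length ms}. rs ! (j - Suc 0) \<in> path_choices (part ms j)"
    then obtain i where "i < length rs" "r = rs ! i" by (auto simp: in_set_conv_nth)
    then show "\<exists>j\<in>{Suc 0..length ms}. r \<in> path_choices (part ms j)"
      using * by (intro bexI[of _ "Suc i"]) (auto dest: bspec[of _ _ "Suc i"])
  qed
  show "finite ({\<gamma>. \<gamma> permutes {..<sum_list ms}} \<times> {rs. set rs \<subseteq> ?P \<and> length rs = length ms})"
    by (intro finite_SigmaI finite_permutations finite_lists_length_eq) auto
qed

lemma path_choices_Cons:
  "i # is \<in> path_choices m \<longleftrightarrow> 1 \<le> i \<and> i < m \<and> is \<in> path_choices (m - 1)"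
proof (cases m)
  case (Suc m')
  then show ?thesis by (cases m') auto
qed auto

lemma path_choices_Nil: "[] \<in> path_choices m \<longleftrightarrow> m \<le> 1"
proof (cases m)
  case (Suc m')
  then show ?thesis by (cases m') auto
qed auto

lemma partitions_Cons: "m # ms \<in> partitions n \<longleftrightarrow> 1 \<le> m \<and> m \<le> n \<and> ms \<in> partitions (n - m)"
  by (auto simp: partitions_def)

lemma partitions_Nil: "[] \<in> partitions n \<longleftrightarrow> n = 0"
  by (auto simp: partitions_def)

text \<open>The clause for a single part, where the permutation is the identity, is the general one for an
  empty rest, so that inductions over partitions need only one step.\<close>

lemma seq_index_Cons:
  assumes "z \<in> seq_index (m # ms)"
  obtains "is" \<beta> z' where "z = (is, \<beta>) # z'" "is \<in> path_choices m"
    "\<beta> \<in> shuffle_perms (sum_list ms) (m - 1)" "z' \<in> seq_index ms"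
proof (cases ms)
  case Nil
  have "id \<in> shuffle_perms 0 (m - 1)"
    by (auto simp: shuffle_perms_def permutes_id strict_mono_on_def)
  then show thesis using assms Nil that by auto
next
  case (Cons m' ms')
  then show thesis using assms that by auto
qed

lemma seq_index_single_id: "(is, \<beta>) # z \<in> seq_index [m] \<Longrightarrow> \<beta> = id"
  by auto

lemma seq_index_ones: "seq_index (replicate n 1) = {replicate n ([], id)}"
proof (induction n)
  case (Suc n)
  have "seq_index (1 # ms) = (\<lambda>z. ([], id) # z) ` seq_index ms" for ms
    by (cases ms) (auto simp: image_iff)
  then have "seq_index (replicate (Suc n) 1) = (\<lambda>z. ([], id) # z) ` {replicate n ([], id)}"
    unfolding replicate_Suc Suc.IH[symmetric] by blast
  then show ?case unfolding image_insert image_empty replicate_Suc .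
qed simp

section \<open>Strings of composable arrows\<close>

text \<open>Strings of composable arrows of the base as a recursive predicate with both end points; it is
  equivalent to membership in the nerve (\<open>mem_nerve_iff\<close>), and it splits along concatenations.\<close>

fun npath :: "('o, 'u, 'x) cat_scheme \<Rightarrow> 'o \<Rightarrow> 'u list \<Rightarrow> 'o \<Rightarrow> bool" where
  "npath C U [] V \<longleftrightarrow> U = V \<and> U \<in> Ob C"
| "npath C U (u # us) V \<longleftrightarrow> u \<in> Arr C \<and> Src C u = U \<and> npath C (Tgt C u) us V"

lemma length_face: "1 \<le> i \<Longrightarrow> i < length us \<Longrightarrow> length (face C i us) = length us - 1"
  by (simp add: face_def)

lemma nvert_Cons_Suc: "nvert C (U, u # us) (Suc i) = nvert C (Tgt C u, us) i"
  by (cases i) (simp_all add: nvert_def)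

lemma nvert_0 [simp]: "nvert C \<sigma> 0 = fst \<sigma>"
  by (simp add: nvert_def)

lemma nend_Nil: "nend C (U, []) = U"
  by (simp add: nend_def)

lemma nend_Cons: "nend C (U, u # us) = nend C (Tgt C u, us)"
  by (simp add: nend_def nvert_Cons_Suc)

lemma split_around_face:
  assumes "1 \<le> i" "i < length us"
  shows "us = take (i - 1) us @ [us ! (i - 1), us ! i] @ drop (i + 1) us"
proof -
  obtain j where i: "i = Suc j" using assms(1) by (cases i) auto
  have "us = take j us @ us ! j # drop (Suc j) us" using assms i by (simp add: id_take_nth_drop)
  moreover have "drop (Suc j) us = us ! Suc j # drop (Suc (Suc j)) us"
    using assms i by (simp add: Cons_nth_drop_Suc)
  ultimately show ?thesis using i by simp
qed

context category
begin

lemma npath_Ob: "npath C U us V \<Longrightarrow> U \<in> Ob C" "npath C U us V \<Longrightarrow> V \<in> Ob C"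
  by (induction us arbitrary: U) (auto simp: Src_Ob)

lemma npath_append: "npath C U (us @ vs) V \<longleftrightarrow> (\<exists>W. npath C U us W \<and> npath C W vs V)"
  by (induction us arbitrary: U) (auto simp: npath_Ob)

lemma npath_imp_nend: "npath C U us V \<Longrightarrow> nend C (U, us) = V"
  by (induction us arbitrary: U) (auto simp: nend_Nil nend_Cons)

lemma mem_nerve_iff: "\<sigma> \<in> nerve C p \<longleftrightarrow> length (snd \<sigma>) = p \<and> npath C (fst \<sigma>) (snd \<sigma>) (nend C \<sigma>)"
proof (cases \<sigma>)
  case (Pair U us)
  have "(U, us) \<in> nerve C (length us) \<longleftrightarrow> npath C U us (nend C (U, us))"
  proof (induction us arbitrary: U)
    case Nil
    then show ?case by (simp add: nerve_def nend_Nil)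
  next
    case (Cons u us)
    have "(U, u # us) \<in> nerve C (length (u # us)) \<longleftrightarrow>
        u \<in> Arr C \<and> Src C u = U \<and> (Tgt C u, us) \<in> nerve C (length us)"
      by (auto simp: nerve_def All_less_Suc2 nvert_Cons_Suc Src_Ob Tgt_Ob)
    then show ?case by (simp add: Cons.IH nend_Cons)
  qed
  then show ?thesis using Pair by (auto simp: nerve_def)
qed

lemma npath_take_drop:
  assumes "npath C U us V" "k \<le> length us"
  shows "npath C U (take k us) (nvert C (U, us) k)" "npath C (nvert C (U, us) k) (drop k us) V"
proof -
  obtain W where W: "npath C U (take k us) W" "npath C W (drop k us) V"
    using assms(1) npath_append[of U "take k us" "drop k us"] by auto
  have "nend C (U, take k us) = W" using W(1) by (rule npath_imp_nend)
  moreover have "nend C (U, take k us) = nvert C (U, us) k"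
    using assms(2) by (auto simp: nend_def nvert_def)
  ultimately show "npath C U (take k us) (nvert C (U, us) k)"
    "npath C (nvert C (U, us) k) (drop k us) V" using W by auto
qed

lemma ncomp_Nil [simp]: "ncomp C (U, []) = Idn C U"
  by (simp add: ncomp_def)

text \<open>The composite is a left fold starting from an identity. The last clause says what the fold does
  for an arbitrary start, and it has to be proved along with the typing, on which associativity
  depends.\<close>

lemma ncomp_Cons_aux:
  assumes "npath C U us V"
  shows "ncomp C (U, us) \<in> Arr C \<and> Src C (ncomp C (U, us)) = U \<and> Tgt C (ncomp C (U, us)) = V \<and>
    (\<forall>w\<in>Arr C. Tgt C w = U \<longrightarrow> foldl (\<lambda>w u. u \<bullet> w) w us = ncomp C (U, us) \<bullet> w)"
  using assms
proof (induction us arbitrary: U)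
  case Nil
  then show ?case by (auto simp: Idn_Arr Src_Idn Tgt_Idn Comp_Idn_left)
next
  case (Cons u us)
  then have u: "u \<in> Arr C" "Src C u = U" "npath C (Tgt C u) us V" by auto
  note IH = Cons.IH[OF u(3)]
  have *: "ncomp C (U, u # us) = ncomp C (Tgt C u, us) \<bullet> u"
    using u IH Comp_Idn_right[OF u(1)] by (simp add: ncomp_def)
  have "foldl (\<lambda>w u. u \<bullet> w) w (u # us) = ncomp C (U, u # us) \<bullet> w" if "w \<in> Arr C" "Tgt C w = U" for w
    using that u IH by (simp add: * Comp_assoc Comp_Arr Tgt_Comp)
  then show ?case using * IH u by (simp add: Comp_Arr Src_Comp Tgt_Comp)
qed

lemma ncomp_Arr:
  assumes "npath C U us V"
  shows "ncomp C (U, us) \<in> Arr C" "Src C (ncomp C (U, us)) = U" "Tgt C (ncomp C (U, us)) = V"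
  using ncomp_Cons_aux[OF assms] by auto

lemma ncomp_append:
  assumes "npath C U us W" "npath C W vs V"
  shows "ncomp C (U, us @ vs) = ncomp C (W, vs) \<bullet> ncomp C (U, us)"
proof -
  have "ncomp C (U, us @ vs) = foldl (\<lambda>w u. u \<bullet> w) (ncomp C (U, us)) vs"
    by (simp add: ncomp_def)
  then show ?thesis using ncomp_Cons_aux[OF assms(2)] ncomp_Arr[OF assms(1)] by auto
qed

lemma ncomp_singleton: "u \<in> Arr C \<Longrightarrow> ncomp C (Src C u, [u]) = u"
  using Comp_Idn_right[of u] by (simp add: ncomp_def)

lemma npath_face:
  assumes "npath C U us V" "1 \<le> i" "i < length us"
  shows "npath C U (face C i us) V"
proof -
  let ?x = "us ! (i - 1)" and ?y = "us ! i"
  have "npath C U (take (i - 1) us @ [?x, ?y] @ drop (i + 1) us) V"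
    using assms split_around_face[of i us] by simp
  then show ?thesis
    unfolding face_def by (auto simp: npath_append Comp_Arr Src_Comp Tgt_Comp)
qed

text \<open>Replacing two neighbours by their composite is associativity; hence all paths of a simplex end in
  the pullback along the same arrow.\<close>

lemma ncomp_face:
  assumes "npath C U us V" "1 \<le> i" "i < length us"
  shows "ncomp C (U, face C i us) = ncomp C (U, us)"
proof -
  let ?x = "us ! (i - 1)" and ?y = "us ! i"
  have us: "us = take (i - 1) us @ [?x, ?y] @ drop (i + 1) us"
    using assms split_around_face by blast
  then obtain W where W: "npath C U (take (i - 1) us) W" "npath C W ([?x, ?y] @ drop (i + 1) us) V"
    using assms(1) by (metis npath_append)
  then have x: "?x \<in> Arr C" "Src C ?x = W" "?y \<in> Arr C" "Src C ?y = Tgt C ?x"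
    and r: "npath C (Tgt C ?y) (drop (i + 1) us) V" by auto
  have W': "npath C W ([?y \<bullet> ?x] @ drop (i + 1) us) V"
    using x r by (simp add: Comp_Arr Src_Comp Tgt_Comp)
  have "foldl (\<lambda>w u. u \<bullet> w) (Idn C W) [?x, ?y] = ?y \<bullet> ?x"
    using x Comp_Idn_right[OF x(1)] by simp
  moreover have "foldl (\<lambda>w u. u \<bullet> w) (Idn C W) [?y \<bullet> ?x] = ?y \<bullet> ?x"
    using x Comp_Idn_right[of "?y \<bullet> ?x"] by (simp add: Comp_Arr Src_Comp)
  ultimately have "ncomp C (W, [?x, ?y] @ drop (i + 1) us) = ncomp C (W, [?y \<bullet> ?x] @ drop (i + 1) us)"
    by (simp only: ncomp_def fst_conv snd_conv foldl_append)
  then show ?thesis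
    using ncomp_append[OF W] ncomp_append[OF W(1) W'] us unfolding face_def by (metis (no_types))
qed

end

lemma nvert_nright: "nvert C (nright C k \<sigma>) i = nvert C \<sigma> (k + i)" if "k + i \<le> length (snd \<sigma>)"
  using that by (auto simp: nvert_def nright_def)

lemma nvert_nleft: "i \<le> k \<Longrightarrow> nvert C (nleft k \<sigma>) i = nvert C \<sigma> i"
  by (auto simp: nvert_def nleft_def)

lemma nend_nleft: "k \<le> length (snd \<sigma>) \<Longrightarrow> nend C (nleft k \<sigma>) = nvert C \<sigma> k"
  by (simp add: nend_def nvert_nleft) (simp add: nleft_def nvert_nleft[unfolded nleft_def])

lemma nend_nright: "k \<le> length (snd \<sigma>) \<Longrightarrow> nend C (nright C k \<sigma>) = nend C \<sigma>"
  by (simp add: nend_def nright_def nvert_nright[unfolded nright_def])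

lemma fst_nleft [simp]: "fst (nleft k \<sigma>) = fst \<sigma>" and snd_nleft [simp]: "snd (nleft k \<sigma>) = take k (snd \<sigma>)"
  and fst_nright [simp]: "fst (nright C k \<sigma>) = nvert C \<sigma> k"
  and snd_nright [simp]: "snd (nright C k \<sigma>) = drop k (snd \<sigma>)"
  by (simp_all add: nleft_def nright_def)

context category
begin

lemma nerve_npath:
  assumes "\<sigma> \<in> nerve C n" "k \<le> n"
  shows "npath C (fst \<sigma>) (take k (snd \<sigma>)) (nvert C \<sigma> k)"
    "npath C (nvert C \<sigma> k) (drop k (snd \<sigma>)) (nend C \<sigma>)"
  using npath_take_drop[of "fst \<sigma>" "snd \<sigma>" "nend C \<sigma>" k] assms by (auto simp: mem_nerve_iff)

lemma nleft_nerve: "\<sigma> \<in> nerve C n \<Longrightarrow> k \<le> n \<Longrightarrow> nleft k \<sigma> \<in> nerve C k"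
  using nerve_npath(1)[of \<sigma> n k] npath_imp_nend by (auto simp: mem_nerve_iff nleft_def)

lemma nright_nerve: "\<sigma> \<in> nerve C n \<Longrightarrow> k \<le> n \<Longrightarrow> nright C k \<sigma> \<in> nerve C (n - k)"
  using nerve_npath(2)[of \<sigma> n k] npath_imp_nend by (auto simp: mem_nerve_iff nright_def)

lemma nerve_nth:
  assumes "\<sigma> \<in> nerve C n" "i < n"
  shows "snd \<sigma> ! i \<in> Arr C" "Src C (snd \<sigma> ! i) = nvert C \<sigma> i" "Tgt C (snd \<sigma> ! i) = nvert C \<sigma> (Suc i)"
  using assms by (auto simp: nerve_def nvert_def)

lemma nvert_Ob: "\<sigma> \<in> nerve C n \<Longrightarrow> i \<le> n \<Longrightarrow> nvert C \<sigma> i \<in> Ob C"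
  using nerve_npath(1) npath_Ob(2) by blast

end

lemma length_pieces [simp]: "length (pieces C \<sigma> ms) = length ms"
  by (induction ms arbitrary: \<sigma>) auto

section \<open>Pullbacks and paths\<close>

context prestack
begin

lemma fibre_category: "V \<in> Ob \<U> \<Longrightarrow> category (pcat \<A> V)"
  using pcat_linear unfolding linear_category_def by blast

text \<open>The carriers of the hom modules, but empty unless the ends are objects: membership then carries
  all typing information.\<close>

definition arrows :: "'o \<Rightarrow> 'a \<Rightarrow> 'a \<Rightarrow> 'h set" where
  "arrows V A B = {f \<in> Arr (pcat \<A> V). V \<in> Ob \<U> \<and> Src (pcat \<A> V) f = A \<and> Tgt (pcat \<A> V) f = B}"

lemma arrows_Ob:
  assumes "f \<in> arrows V A B"
  shows "V \<in> Ob \<U>" "A \<in> Ob (pcat \<A> V)" "B \<in> Ob (pcat \<A> V)"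
  using assms fibre_category[of V] unfolding arrows_def
  by (auto intro: category.Src_Ob category.Tgt_Ob)

lemma carrier_Hom:
  "\<lbrakk>V \<in> Ob \<U>; A \<in> Ob (pcat \<A> V); B \<in> Ob (pcat \<A> V)\<rbrakk> \<Longrightarrow> carrier (Hom (pcat \<A> V) A B) = arrows V A B"
  using linear_category.Hom_carrier[OF pcat_linear] by (auto simp: arrows_def)

lemma arrows_carrier: "f \<in> arrows V A B \<Longrightarrow> f \<in> carrier (Hom (pcat \<A> V) A B)"
  using arrows_Ob[of f V A B] carrier_Hom by auto

lemma Idn_arrows: "V \<in> Ob \<U> \<Longrightarrow> A \<in> Ob (pcat \<A> V) \<Longrightarrow> Idn (pcat \<A> V) A \<in> arrows V A A"
  using fibre_category[of V] by (simp add: arrows_def category.Idn_Arr category.Src_Idn category.Tgt_Idn)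

lemma Comp_arrows:
  "g \<in> arrows V B D \<Longrightarrow> f \<in> arrows V A B \<Longrightarrow> g \<bullet>\<^bsub>pcat \<A> V\<^esub> f \<in> arrows V A D"
  using fibre_category[of V] by (auto simp: arrows_def category.Comp_Arr category.Src_Comp category.Tgt_Comp)

lemma Comp_Idn:
  assumes "f \<in> arrows V A B"
  shows "Idn (pcat \<A> V) B \<bullet>\<^bsub>pcat \<A> V\<^esub> f = f" "f \<bullet>\<^bsub>pcat \<A> V\<^esub> Idn (pcat \<A> V) A = f"
  using assms fibre_category[of V]
  by (auto simp: arrows_def category.Comp_Idn_left category.Comp_Idn_right)

text \<open>The part of functoriality that typing and the vanishing arguments depend on: objects, hom sets
  and identities are preserved.\<close>

definition fibre_map :: "'o \<Rightarrow> 'o \<Rightarrow> ('a, 'h) funct \<Rightarrow> bool" where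
  "fibre_map V W T \<longleftrightarrow> V \<in> Ob \<U> \<and> W \<in> Ob \<U> \<and>
     (\<forall>A\<in>Ob (pcat \<A> V). fst T A \<in> Ob (pcat \<A> W)) \<and>
     (\<forall>A B. \<forall>f\<in>arrows V A B. snd T f \<in> arrows W (fst T A) (fst T B)) \<and>
     (\<forall>A\<in>Ob (pcat \<A> V). snd T (Idn (pcat \<A> V) A) = Idn (pcat \<A> W) (fst T A))"

lemma fibre_mapD:
  assumes "fibre_map V W T"
  shows "V \<in> Ob \<U>" "W \<in> Ob \<U>" "A \<in> Ob (pcat \<A> V) \<Longrightarrow> fst T A \<in> Ob (pcat \<A> W)"
    "f \<in> arrows V A B \<Longrightarrow> snd T f \<in> arrows W (fst T A) (fst T B)"
    "A \<in> Ob (pcat \<A> V) \<Longrightarrow> snd T (Idn (pcat \<A> V) A) = Idn (pcat \<A> W) (fst T A)"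
  using assms unfolding fibre_map_def by auto

lemma fibre_map_pullback:
  assumes "u \<in> Arr \<U>"
  shows "fibre_map (Tgt \<U> u) (Src \<U> u) (pob \<A> u, parr \<A> u)"
proof -
  have 1: "Tgt \<U> u \<in> Ob \<U>" "Src \<U> u \<in> Ob \<U>" using assms Tgt_Ob Src_Ob by auto
  interpret linear_functor R "pcat \<A> (Tgt \<U> u)" "pcat \<A> (Src \<U> u)" "pob \<A> u" "parr \<A> u"
    by (rule pullback_functor[OF assms])
  have "parr \<A> u f \<in> arrows (Src \<U> u) (pob \<A> u A) (pob \<A> u B)" if f: "f \<in> arrows (Tgt \<U> u) A B" for f A B
    using functor_linear[of A B] arrows_Ob[OF f] arrows_carrier[OF f] functor_Ob
      carrier_Hom[OF 1(2), of "pob \<A> u A" "pob \<A> u B"]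
    unfolding linear_map_def by auto
  then show ?thesis using 1 functor_Ob functor_Idn unfolding fibre_map_def by auto
qed

lemma fibre_map_comp:
  "fibre_map V W T \<Longrightarrow> fibre_map W X S \<Longrightarrow> fibre_map V X (fst S \<circ> fst T, snd S \<circ> snd T)"
  unfolding fibre_map_def by auto

lemma star_Nil: "star \<A> [] = (id, id)"
  by (simp add: star_def id_def)

lemma star_append: "star \<A> (us @ vs) = (fst (star \<A> us) \<circ> fst (star \<A> vs), snd (star \<A> us) \<circ> snd (star \<A> vs))"
  by (auto simp: star_def)

lemma star_single: "star \<A> [u] = (pob \<A> u, parr \<A> u)"
  by (simp add: star_def comp_def)

lemma fibre_map_id: "V \<in> Ob \<U> \<Longrightarrow> fibre_map V V (id, id)"
  unfolding fibre_map_def by auto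

lemma fibre_map_star: "npath \<U> U us V \<Longrightarrow> fibre_map V U (star \<A> us)"
proof (induction us arbitrary: U)
  case Nil
  then show ?case using fibre_map_id by (auto simp: star_Nil)
next
  case (Cons u us)
  then have "fibre_map V (Tgt \<U> u) (star \<A> us)" "fibre_map (Tgt \<U> u) U (star \<A> [u])"
    using fibre_map_pullback[of u] by (auto simp: star_single)
  from fibre_map_comp[OF this] show ?case using star_append[of "[u]" us] by simp
qed

lemma tw_arrows:
  assumes "u \<in> Arr \<U>" "v \<in> Arr \<U>" "Src \<U> u = Tgt \<U> v" "A \<in> Ob (pcat \<A> (Tgt \<U> u))"
  shows "tw \<A> u v A \<in> arrows (Src \<U> v) (pob \<A> v (pob \<A> u A)) (pob \<A> (u \<bullet>\<^bsub>\<U>\<^esub> v) A)"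
proof -
  have "pob \<A> u A \<in> Ob (pcat \<A> (Src \<U> u))"
    using fibre_mapD(3)[OF fibre_map_pullback[OF assms(1)]] assms(4) by simp
  then have "pob \<A> v (pob \<A> u A) \<in> Ob (pcat \<A> (Src \<U> v))"
    using fibre_mapD(3)[OF fibre_map_pullback[OF assms(2)], of "pob \<A> u A"] assms(3) by simp
  moreover have "pob \<A> (u \<bullet>\<^bsub>\<U>\<^esub> v) A \<in> Ob (pcat \<A> (Src \<U> v))"
    using fibre_mapD(3)[OF fibre_map_pullback[OF Comp_Arr[OF assms(1-3)]], of A] assms
    by (simp add: Tgt_Comp Src_Comp)
  ultimately show ?thesis using tw_Hom[OF assms] carrier_Hom[OF Src_Ob[OF assms(2)]] by simp
qed

text \<open>The normalization of the twists, in the form in which an identity among the two arrows is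
  known only as the identity of some object.\<close>

lemma tw_Idn:
  assumes "u \<in> Arr \<U>" "v \<in> Arr \<U>" "Src \<U> u = Tgt \<U> v" "A \<in> Ob (pcat \<A> (Tgt \<U> u))"
    and Z: "Z \<in> Ob \<U>" "u = Idn \<U> Z \<or> v = Idn \<U> Z"
  shows "tw \<A> u v A = Idn (pcat \<A> (Src \<U> v)) (pob \<A> v (pob \<A> u A))"
  using Z(2)
proof
  assume u: "u = Idn \<U> Z"
  then have "Tgt \<U> v = Z" "A \<in> Ob (pcat \<A> Z)" using assms Src_Idn Tgt_Idn by auto
  then show ?thesis using tw_Idn_left[OF assms(2), of A] pob_Idn[OF Z(1), of A] u by simp
next
  assume v: "v = Idn \<U> Z"
  then have uZ: "Src \<U> u = Z" "Src \<U> v = Z" using assms Src_Idn Tgt_Idn by auto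
  then have "pob \<A> u A \<in> Ob (pcat \<A> Z)"
    using fibre_mapD(3)[OF fibre_map_pullback[OF assms(1)]] assms(4) by simp
  then show ?thesis using tw_Idn_right[OF assms(1,4)] pob_Idn[OF Z(1), of "pob \<A> u A"] uZ v by simp
qed

lemma eps_arrows:
  assumes p: "npath \<U> U us V" and i: "1 \<le> i" "i < length us" and A: "A \<in> Ob (pcat \<A> V)"
  shows "eps \<A> us i A \<in> arrows U (fst (star \<A> us) A) (fst (star \<A> (face \<U> i us)) A)"
proof -
  let ?x = "us ! (i - 1)" and ?y = "us ! i"
  let ?X = "fst (star \<A> (drop (i + 1) us)) A"
  have us: "us = take (i - 1) us @ [?x, ?y] @ drop (i + 1) us"
    using i split_around_face by blast
  then obtain W where W: "npath \<U> U (take (i - 1) us) W" "npath \<U> W ([?x, ?y] @ drop (i + 1) us) V"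
    using p by (metis npath_append)
  then have x: "?x \<in> Arr \<U>" "Src \<U> ?x = W" "?y \<in> Arr \<U>" "Src \<U> ?y = Tgt \<U> ?x"
    and r: "npath \<U> (Tgt \<U> ?y) (drop (i + 1) us) V" by auto
  have X: "?X \<in> Ob (pcat \<A> (Tgt \<U> ?y))"
    using fibre_mapD(3)[OF fibre_map_star[OF r] A] .
  have "eps \<A> us i A \<in> arrows U (fst (star \<A> (take (i - 1) us)) (pob \<A> ?x (pob \<A> ?y ?X)))
      (fst (star \<A> (take (i - 1) us)) (pob \<A> (?y \<bullet>\<^bsub>\<U>\<^esub> ?x) ?X))"
    unfolding eps_def
    by (rule fibre_mapD(4)[OF fibre_map_star[OF W(1)]]) (use tw_arrows[OF x(3,1,4) X] x(2) in simp)
  moreover have "fst (star \<A> us) A = fst (star \<A> (take (i - 1) us)) (pob \<A> ?x (pob \<A> ?y ?X))"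
    by (subst us) (simp add: star_append star_def)
  moreover have "fst (star \<A> (face \<U> i us)) A = fst (star \<A> (take (i - 1) us)) (pob \<A> (?y \<bullet>\<^bsub>\<U>\<^esub> ?x) ?X)"
    unfolding face_def by (simp add: star_append star_def)
  ultimately show ?thesis by simp
qed

text \<open>Merging an identity of the base with a neighbour costs nothing. This is the source of all
  identities produced by paths.\<close>

lemma eps_Idn:
  assumes p: "npath \<U> U us V" and i: "1 \<le> i" "i < length us" and A: "A \<in> Ob (pcat \<A> V)"
    and idn: "Z \<in> Ob \<U>" "us ! i = Idn \<U> Z \<or> us ! (i - 1) = Idn \<U> Z"
  shows "eps \<A> us i A = Idn (pcat \<A> U) (fst (star \<A> us) A)"
proof -
  let ?x = "us ! (i - 1)" and ?y = "us ! i"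
  let ?X = "fst (star \<A> (drop (i + 1) us)) A"
  have us: "us = take (i - 1) us @ [?x, ?y] @ drop (i + 1) us"
    using i split_around_face by blast
  then obtain W where W: "npath \<U> U (take (i - 1) us) W" "npath \<U> W ([?x, ?y] @ drop (i + 1) us) V"
    using p by (metis npath_append)
  then have x: "?x \<in> Arr \<U>" "Src \<U> ?x = W" "?y \<in> Arr \<U>" "Src \<U> ?y = Tgt \<U> ?x"
    and r: "npath \<U> (Tgt \<U> ?y) (drop (i + 1) us) V" by auto
  have X: "?X \<in> Ob (pcat \<A> (Tgt \<U> ?y))"
    using fibre_mapD(3)[OF fibre_map_star[OF r] A] .
  have Y: "pob \<A> ?y ?X \<in> Ob (pcat \<A> (Tgt \<U> ?x))"
    using fibre_mapD(3)[OF fibre_map_pullback[OF x(3)]] X x(4) by simp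
  have "tw \<A> ?y ?x ?X = Idn (pcat \<A> W) (pob \<A> ?x (pob \<A> ?y ?X))"
    using tw_Idn[OF x(3,1,4) X idn] x(2) by simp
  moreover have "pob \<A> ?x (pob \<A> ?y ?X) \<in> Ob (pcat \<A> W)"
    using fibre_mapD(3)[OF fibre_map_pullback[OF x(1)] Y] x by simp
  ultimately have "eps \<A> us i A = Idn (pcat \<A> U) (fst (star \<A> (take (i - 1) us)) (pob \<A> ?x (pob \<A> ?y ?X)))"
    unfolding eps_def using fibre_mapD(5)[OF fibre_map_star[OF W(1)]] by simp
  moreover have "fst (star \<A> us) A = fst (star \<A> (take (i - 1) us)) (pob \<A> ?x (pob \<A> ?y ?X))"
    by (subst us) (simp add: star_append star_def)
  ultimately show ?thesis by simp
qed

text \<open>The two lists of a chain of transformations run in opposite directions: the functors from the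
  source on, the transformations from the target on.\<close>

definition ntrans_chain :: "'o \<Rightarrow> 'o \<Rightarrow> ('a, 'h) ntchain \<Rightarrow> bool" where
  "ntrans_chain V U r \<longleftrightarrow> (let l = length (snd r) in length (fst r) = l + 1 \<and>
     (\<forall>T\<in>set (fst r). fibre_map V U T) \<and>
     (\<forall>i<l. \<forall>A\<in>Ob (pcat \<A> V).
        (snd r ! i) A \<in> arrows U (fst (fst r ! (l - 1 - i)) A) (fst (fst r ! (l - i)) A)))"

lemma length_path_functs [simp]: "length (path_functs \<U> \<A> us is) = length is + 1"
  by (induction "is" arbitrary: us) auto

lemma length_path_nts [simp]: "length (path_nts \<U> \<A> us is) = length is"
  by (induction "is" arbitrary: us) auto

lemma path_functs_0: "path_functs \<U> \<A> us is ! 0 = star \<A> us"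
  by (cases "is") auto

lemma ntrans_chain_path:
  assumes "npath \<U> U us V" "is \<in> path_choices (length us)"
  shows "ntrans_chain V U (path_functs \<U> \<A> us is, path_nts \<U> \<A> us is)"
  using assms
proof (induction "is" arbitrary: us)
  case Nil
  then show ?case by (simp add: ntrans_chain_def fibre_map_star)
next
  case (Cons i "is")
  then have i: "1 \<le> i" "i < length us" and is_len: "is \<in> path_choices (length us - 1)"
    by (auto simp: path_choices_Cons)
  let ?T = "path_functs \<U> \<A> (face \<U> i us) is" and ?r = "path_nts \<U> \<A> (face \<U> i us) is"
  have IH: "ntrans_chain V U (?T, ?r)"
    using Cons.IH[OF npath_face[OF Cons.prems(1) i]] is_len length_face[OF i] by metis
  have "((?r @ [eps \<A> us i]) ! j) A \<in> arrows U
      (fst ((star \<A> us # ?T) ! (length is - j)) A) (fst ((star \<A> us # ?T) ! (Suc (length is) - j)) A)"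
    if j: "j < Suc (length is)" and A: "A \<in> Ob (pcat \<A> V)" for j A
  proof (cases "j = length is")
    case True
    then show ?thesis
      using eps_arrows[OF Cons.prems(1) i A] path_functs_0[of "face \<U> i us" "is"]
      by (simp add: nth_append)
  next
    case False
    then have j': "j < length is" using j by simp
    then have "(?r ! j) A \<in> arrows U (fst (?T ! (length is - 1 - j)) A) (fst (?T ! (length is - j)) A)"
      using IH A unfolding ntrans_chain_def Let_def by simp
    moreover have "Suc (length is) - j = Suc (length is - j)" "length is - j = Suc (length is - 1 - j)"
      using j' by auto
    ultimately show ?thesis using j' by (simp add: nth_append del: diff_Suc_Suc)
  qed
  then show ?case
    using IH fibre_map_star[OF Cons.prems(1)] unfolding ntrans_chain_def Let_def by simp
qed

text \<open>After all choices one arrow is left, and it is the composite of the simplex.\<close>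

lemma path_functs_last:
  assumes "npath \<U> U us V" "is \<in> path_choices (length us)" "us \<noteq> []"
  shows "path_functs \<U> \<A> us is ! length is = star \<A> [ncomp \<U> (U, us)]"
  using assms
proof (induction "is" arbitrary: us)
  case Nil
  then have "length us = 1" by (cases us) (auto simp: path_choices_Nil)
  then obtain u where us: "us = [u]" by (auto simp: length_Suc_conv)
  then show ?case using Nil ncomp_singleton[of u] by simp
next
  case (Cons i "is")
  then have i: "1 \<le> i" "i < length us" and is_len: "is \<in> path_choices (length us - 1)"
    by (auto simp: path_choices_Cons)
  have ne: "face \<U> i us \<noteq> []" by (simp add: face_def)
  have "is \<in> path_choices (length (face \<U> i us))" using is_len length_face[OF i] by metis
  then show ?case
    using Cons.IH[OF npath_face[OF Cons.prems(1) i] _ ne] ncomp_face[OF Cons.prems(1) i] by simp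
qed

text \<open>Each arrow of a string of length at least two is merged with a neighbour by some choice of the
  path. Follow the given identity until this happens; then \<open>eps_Idn\<close> applies.\<close>

lemma path_contains_identity:
  assumes "npath \<U> U us V" "is \<in> path_choices (length us)" "2 \<le> length us"
    and "Z \<in> Ob \<U>" "Idn \<U> Z \<in> set us"
  shows "\<exists>r\<in>set (path_nts \<U> \<A> us is). \<forall>A\<in>Ob (pcat \<A> V). \<exists>X\<in>Ob (pcat \<A> U). r A = Idn (pcat \<A> U) X"
  using assms
proof (induction "is" arbitrary: us)
  case Nil
  then show ?case by (simp add: path_choices_Nil)
next
  case (Cons i "is")
  then have i: "1 \<le> i" "i < length us" and is_len: "is \<in> path_choices (length us - 1)"
    by (auto simp: path_choices_Cons)
  show ?case
  proof (cases "us ! i = Idn \<U> Z \<or> us ! (i - 1) = Idn \<U> Z")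
    case True
    then show ?thesis
      using eps_Idn[OF Cons.prems(1) i _ Cons.prems(4)] fibre_mapD(3)[OF fibre_map_star[OF Cons.prems(1)]]
      by auto
  next
    case False
    have us: "us = take (i - 1) us @ [us ! (i - 1), us ! i] @ drop (i + 1) us"
      using i split_around_face by blast
    then have "set us = set (take (i - 1) us) \<union> {us ! (i - 1), us ! i} \<union> set (drop (i + 1) us)"
      by (metis Un_assoc list.set(1,2) set_append Un_insert_left sup_bot_left)
    then have mem: "Idn \<U> Z \<in> set (take (i - 1) us) \<union> set (drop (i + 1) us)"
      using False Cons.prems(5) by auto
    then have "Idn \<U> Z \<in> set (face \<U> i us)" by (auto simp: face_def)
    moreover have "2 \<le> length (face \<U> i us)"
    proof -
      have "2 \<le> length us - 1"
        using mem i by (cases "i = 1"; cases "length us = i + 1") auto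
      then show ?thesis using length_face[OF i] by metis
    qed
    moreover have "is \<in> path_choices (length (face \<U> i us))" using is_len length_face[OF i] by metis
    ultimately show ?thesis
      using Cons.IH[OF npath_face[OF Cons.prems(1) i]] Cons.prems(4) by auto
  qed
qed

end

section \<open>Simplices and shuffles with natural transformations\<close>

text \<open>The property of the entries of a simplex on which a normalized cochain vanishes.\<close>

definition (in prestack) has_identity :: "'o \<Rightarrow> 'h list \<Rightarrow> bool" where
  "has_identity V fs \<longleftrightarrow> (\<exists>f\<in>set fs. \<exists>A\<in>Ob (pcat \<A> V). f = Idn (pcat \<A> V) A)"

context prestack
begin

lemma mem_simplices_iff:
  assumes W: "W \<in> Ob \<U>"
  shows "a \<in> simplices (pcat \<A> W) q \<longleftrightarrow> length (snd a) = q \<and> fst a \<in> Ob (pcat \<A> W) \<and>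
    (\<forall>i<q. snd a ! i \<in> arrows W (vert (pcat \<A> W) a (q - 1 - i)) (vert (pcat \<A> W) a (q - i)))"
    (is "?L \<longleftrightarrow> ?R")
proof
  assume L: ?L
  have "snd a ! i \<in> arrows W (vert (pcat \<A> W) a (q - 1 - i)) (vert (pcat \<A> W) a (q - i))" if i: "i < q" for i
  proof -
    have "snd a ! (Suc i - 1) \<in> carrier (Hom (pcat \<A> W) (vert (pcat \<A> W) a (q - Suc i)) (vert (pcat \<A> W) a (q - Suc i + 1)))"
    proof -
      have "Suc i \<in> {1..q}" using i by simp
      then show ?thesis using L unfolding simplices_def by blast
    qed
    moreover have "q - Suc i + 1 = q - i" using i by simp
    moreover have "vert (pcat \<A> W) a (q - Suc i) \<in> Ob (pcat \<A> W)" "vert (pcat \<A> W) a (q - i) \<in> Ob (pcat \<A> W)"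
      using L by (auto simp: simplices_def)
    ultimately show ?thesis using carrier_Hom[OF W] by simp
  qed
  moreover have "fst a \<in> Ob (pcat \<A> W)" "length (snd a) = q"
    using L by (auto simp: simplices_def vert_def)
  ultimately show ?R by blast
next
  assume R: ?R
  have "vert (pcat \<A> W) a j \<in> Ob (pcat \<A> W)" if "j \<le> q" for j
  proof (cases j)
    case (Suc j')
    then have "q - j < q" using that by simp
    then have "snd a ! (q - j) \<in> arrows W (vert (pcat \<A> W) a (q - 1 - (q - j))) (vert (pcat \<A> W) a (q - (q - j)))"
      using R by blast
    then show ?thesis using arrows_Ob(3) that by fastforce
  qed (use R in \<open>simp add: vert_def\<close>)
  moreover have "snd a ! (i - 1) \<in> carrier (Hom (pcat \<A> W) (vert (pcat \<A> W) a (q - i)) (vert (pcat \<A> W) a (q - i + 1)))"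
    if "i \<in> {1..q}" for i
  proof -
    have "q - 1 - (i - 1) = q - i" "q - (i - 1) = q - i + 1" "i - 1 < q" using that by auto
    then show ?thesis using R arrows_carrier by metis
  qed
  ultimately show ?L using R by (auto simp: simplices_def)
qed

text \<open>A list of arrows is most easily shown to be a simplex by exhibiting its vertices \<open>X\<close>, numbered
  like the arrows from the target on.\<close>

lemma simplicesI:
  assumes W: "W \<in> Ob \<U>" and X: "X (length as) \<in> Ob (pcat \<A> W)"
    and as: "\<And>i. i < length as \<Longrightarrow> as ! i \<in> arrows W (X (Suc i)) (X i)"
  shows "(X (length as), as) \<in> simplices (pcat \<A> W) (length as)"
    and "j \<le> length as \<Longrightarrow> vert (pcat \<A> W) (X (length as), as) j = X (length as - j)"
proof -
  have v: "vert (pcat \<A> W) (X (length as), as) j = X (length as - j)" if "j \<le> length as" for j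
    using as[of "length as - j"] that by (cases j) (auto simp: vert_def arrows_def)
  then show "j \<le> length as \<Longrightarrow> vert (pcat \<A> W) (X (length as), as) j = X (length as - j)" .
  have "as ! i \<in> arrows W (vert (pcat \<A> W) (X (length as), as) (length as - 1 - i))
      (vert (pcat \<A> W) (X (length as), as) (length as - i))" if "i < length as" for i
  proof -
    have "length as - (length as - 1 - i) = Suc i" "length as - (length as - i) = i" using that by auto
    then show ?thesis using that as[OF that] v[of "length as - 1 - i"] v[of "length as - i"] by simp
  qed
  then show "(X (length as), as) \<in> simplices (pcat \<A> W) (length as)"
    using X by (simp add: mem_simplices_iff[OF W])
qed

lemma simplex_vert_Ob:
  "a \<in> simplices (pcat \<A> W) q \<Longrightarrow> j \<le> q \<Longrightarrow> vert (pcat \<A> W) a j \<in> Ob (pcat \<A> W)"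
  by (simp add: simplices_def)

lemma simplex_snoc:
  assumes W: "W \<in> Ob \<U>" and a: "(B, xs) \<in> simplices (pcat \<A> W) q" and g: "g \<in> arrows W A B"
  shows "(A, xs @ [g]) \<in> simplices (pcat \<A> W) (Suc q)"
    and "vert (pcat \<A> W) (A, xs @ [g]) (Suc q) = vert (pcat \<A> W) (B, xs) q"
proof -
  have len: "length xs = q" using a by (simp add: simplices_def)
  let ?X = "\<lambda>i. if i \<le> q then vert (pcat \<A> W) (B, xs) (q - i) else A"
  have A: "A \<in> Ob (pcat \<A> W)" using arrows_Ob[OF g] by auto
  have 1: "(xs @ [g]) ! i \<in> arrows W (?X (Suc i)) (?X i)" if "i < Suc q" for i
  proof (cases "i = q")
    case True
    then show ?thesis using g len by (simp add: nth_append vert_def)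
  next
    case False
    then have "i < q" using that by simp
    then show ?thesis using a len mem_simplices_iff[OF W, of "(B, xs)" q] by (simp add: nth_append)
  qed
  note S = simplicesI[of W ?X "xs @ [g]"]
  show "(A, xs @ [g]) \<in> simplices (pcat \<A> W) (Suc q)"
    using S(1)[OF W] 1 A len by simp
  show "vert (pcat \<A> W) (A, xs @ [g]) (Suc q) = vert (pcat \<A> W) (B, xs) q"
    using S(2)[OF W _ _, of "Suc q"] 1 A len by simp
qed

text \<open>Composites of simplices occur as the arrows \<open>gr_comp\<close> and as the composites of paths; in both cases
  their type and the case of identities are needed.\<close>

lemma simplex_composite:
  assumes W: "W \<in> Ob \<U>" and a: "(A, xs) \<in> simplices (pcat \<A> W) q"
  shows "foldr (\<lambda>f g. f \<bullet>\<^bsub>pcat \<A> W\<^esub> g) xs (Idn (pcat \<A> W) A) \<in> arrows W A (vert (pcat \<A> W) (A, xs) q)"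
    and "(\<And>f. f \<in> set xs \<Longrightarrow> \<exists>X\<in>Ob (pcat \<A> W). f = Idn (pcat \<A> W) X) \<Longrightarrow>
      foldr (\<lambda>f g. f \<bullet>\<^bsub>pcat \<A> W\<^esub> g) xs (Idn (pcat \<A> W) A) = Idn (pcat \<A> W) A"
proof -
  let ?C = "pcat \<A> W"
  let ?f = "\<lambda>ys. foldr (\<lambda>f g. f \<bullet>\<^bsub>?C\<^esub> g) ys (Idn ?C A)"
  have len: "length xs = q" and A: "A \<in> Ob ?C" using a by (auto simp: mem_simplices_iff[OF W])
  have *: "?f (drop (q - k) xs) \<in> arrows W A (vert ?C (A, xs) k) \<and>
      ((\<forall>f\<in>set xs. \<exists>X\<in>Ob ?C. f = Idn ?C X) \<longrightarrow> ?f (drop (q - k) xs) = Idn ?C A)" if "k \<le> q" for k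
    using that
  proof (induction k)
    case 0
    then show ?case using Idn_arrows[OF W A] len by (simp add: vert_def)
  next
    case (Suc k)
    let ?x = "xs ! (q - Suc k)" and ?g = "?f (drop (q - k) xs)"
    have d: "drop (q - Suc k) xs = ?x # drop (q - k) xs"
      using Suc.prems len by (metis Cons_nth_drop_Suc Suc_diff_Suc Suc_le_lessD diff_less zero_less_Suc less_le_trans)
    have x: "?x \<in> arrows W (vert ?C (A, xs) k) (vert ?C (A, xs) (Suc k))"
    proof -
      have "q - Suc k < q" "q - 1 - (q - Suc k) = k" "q - (q - Suc k) = Suc k" using Suc.prems by auto
      then show ?thesis using a mem_simplices_iff[OF W, of "(A, xs)" q] by (metis snd_conv)
    qed
    have g: "?g \<in> arrows W A (vert ?C (A, xs) k)" using Suc by simp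
    have "?x \<bullet>\<^bsub>?C\<^esub> ?g = Idn ?C A" if id: "\<forall>f\<in>set xs. \<exists>X\<in>Ob ?C. f = Idn ?C X"
    proof -
      have "?x \<in> set xs" using Suc.prems len by simp
      then obtain X where X: "X \<in> Ob ?C" "?x = Idn ?C X" using id by blast
      then have "X = vert ?C (A, xs) k" using x Idn_arrows[OF W X(1)] by (auto simp: arrows_def)
      then show ?thesis using Comp_Idn(1)[OF g] X Suc id by simp
    qed
    then show ?case using Comp_arrows[OF x g] d by simp
  qed
  show "?f xs \<in> arrows W A (vert ?C (A, xs) q)" using *[of q] by simp
  show "(\<And>f. f \<in> set xs \<Longrightarrow> \<exists>X\<in>Ob ?C. f = Idn ?C X) \<Longrightarrow> ?f xs = Idn ?C A"
    using *[of q] by simp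
qed

lemma filter_shuffle:
  assumes "\<beta> \<in> shuffle_perms (length xs) (length ys)"
  defines "L \<equiv> place \<beta> (map Inl xs @ map Inr ys)"
  shows "filter isl L = map Inl xs" "filter (Not \<circ> isl) L = map Inr ys"
proof -
  let ?xs = "map Inl xs @ map Inr ys"
  have p: "\<beta> permutes {..<length ?xs}" using assms by (simp add: shuffle_perms_def)
  have isl_nth: "isl (?xs ! i) \<longleftrightarrow> i < length xs" if "i < length xs + length ys" for i
    using that by (cases "i < length xs") (simp_all add: nth_append)
  have "filter isl L = filter isl ?xs" unfolding L_def
    by (rule filter_place[OF p], rule monotone_on_subset[of "{..<length xs}"])
      (use assms isl_nth in \<open>auto simp: shuffle_perms_def\<close>)
  then show "filter isl L = map Inl xs" by (simp add: filter_map comp_def)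
  have "filter (Not \<circ> isl) L = filter (Not \<circ> isl) ?xs" unfolding L_def
    by (rule filter_place[OF p], rule monotone_on_subset[of "{length xs..<length xs + length ys}"])
      (use assms isl_nth in \<open>auto simp: shuffle_perms_def\<close>)
  then show "filter (Not \<circ> isl) L = map Inr ys" by (simp add: filter_map comp_def)
qed

text \<open>The vertices of \<open>\<beta>(a, r)\<close> are \<open>T (A)\<close>, where \<open>T\<close> and \<open>A\<close> are determined by the numbers of
  transformations and of arrows among the entries read so far; reading one more entry advances
  one of the two. Each entry of \<open>a\<close> and of \<open>r\<close> appears in the shuffle, under one of the functors or
  at one of the vertices, so identities survive.\<close>

lemma shuffle_chain_simplex:
  assumes a: "a \<in> simplices (pcat \<A> V) m" and r: "ntrans_chain V W r"
    and \<beta>: "\<beta> \<in> shuffle_perms m (length (snd r))" and V: "V \<in> Ob \<U>" and W: "W \<in> Ob \<U>"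
  defines "b \<equiv> (fst (fst r ! 0) (fst a), shuffle_chain (pcat \<A> V) \<beta> a r)"
  shows "b \<in> simplices (pcat \<A> W) (m + length (snd r))"
    and "vert (pcat \<A> W) b (m + length (snd r)) = fst (fst r ! length (snd r)) (vert (pcat \<A> V) a m)"
    and "has_identity V (snd a) \<or> (\<exists>t\<in>set (snd r). \<forall>A\<in>Ob (pcat \<A> V). \<exists>X\<in>Ob (pcat \<A> W). t A = Idn (pcat \<A> W) X)
      \<Longrightarrow> has_identity W (snd b)"
proof -
  define l where "l = length (snd r)"
  define L where "L = place \<beta> (map Inl (snd a) @ map Inr (snd r))"
  define na where "na x = length (filter isl (take x L))" for x
  define nr where "nr x = length (filter (Not \<circ> isl) (take x L))" for x
  define X where "X x = fst (fst r ! (l - nr x)) (vert (pcat \<A> V) a (m - na x))" for x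
  have m: "length (snd a) = m" and aA: "fst a \<in> Ob (pcat \<A> V)"
    and a_arr: "\<And>i. i < m \<Longrightarrow> snd a ! i \<in> arrows V (vert (pcat \<A> V) a (m - 1 - i)) (vert (pcat \<A> V) a (m - i))"
    using a by (auto simp: mem_simplices_iff[OF V])
  have fL: "filter isl L = map Inl (snd a)" "filter (Not \<circ> isl) L = map Inr (snd r)"
    unfolding L_def using filter_shuffle[of \<beta> "snd a" "snd r"] \<beta> m by auto
  have lenL: "length L = m + l" by (simp add: L_def m l_def)
  have Tl: "length (fst r) = l + 1" and TT: "\<And>j. j \<le> l \<Longrightarrow> fibre_map V W (fst r ! j)"
    and r_arr: "\<And>i A. i < l \<Longrightarrow> A \<in> Ob (pcat \<A> V) \<Longrightarrow> 
        (snd r ! i) A \<in> arrows W (fst (fst r ! (l - 1 - i)) A) (fst (fst r ! (l - i)) A)"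
    using r by (auto simp: ntrans_chain_def Let_def l_def)
  have sc: "shuffle_chain (pcat \<A> V) \<beta> a r = map (\<lambda>x. case L ! x of
       Inl f \<Rightarrow> snd (fst r ! (l - nr x)) f | Inr t \<Rightarrow> t (vert (pcat \<A> V) a (m - na x))) [0..<m + l]"
    unfolding shuffle_chain_def Let_def m L_def[symmetric] l_def[symmetric] na_def nr_def ..
  have Inl_case: "na x < m \<and> f = snd a ! na x \<and> na (Suc x) = Suc (na x) \<and> nr (Suc x) = nr x"
    if "x < m + l" "L ! x = Inl f" for x f
    using nth_filter_prefix[OF fL(1), of x] that lenL m
    by (simp add: na_def nr_def take_Suc_conv_app_nth)
  have Inr_case: "nr x < l \<and> t = snd r ! nr x \<and> nr (Suc x) = Suc (nr x) \<and> na (Suc x) = na x"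
    if "x < m + l" "L ! x = Inr t" for x t
    using nth_filter_prefix[OF fL(2), of x] that lenL
    by (simp add: na_def nr_def take_Suc_conv_app_nth l_def)
  have vO: "vert (pcat \<A> V) a (m - j) \<in> Ob (pcat \<A> V)" for j
    using simplex_vert_Ob[OF a] by simp
  have arr: "shuffle_chain (pcat \<A> V) \<beta> a r ! x \<in> arrows W (X (Suc x)) (X x)" if x: "x < m + l" for x
  proof (cases "L ! x")
    case (Inl f)
    note I = Inl_case[OF x Inl]
    have "f \<in> arrows V (vert (pcat \<A> V) a (m - na (Suc x))) (vert (pcat \<A> V) a (m - na x))"
      using a_arr[of "na x"] I by simp
    then show ?thesis using fibre_mapD(4)[OF TT[of "l - nr x"]] x Inl I by (simp add: sc X_def)
  next
    case (Inr t)
    note I = Inr_case[OF x Inr]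
    then show ?thesis using r_arr[of "nr x", OF _ vO[of "na x"]] x Inr I by (simp add: sc X_def)
  qed
  have len: "length (shuffle_chain (pcat \<A> V) \<beta> a r) = m + l" by (simp add: sc)
  have "na (m + l) = m" "nr (m + l) = l"
    using arg_cong[OF fL(1), of length] arg_cong[OF fL(2), of length] lenL m
    by (auto simp: na_def nr_def l_def)
  then have X_end: "X (m + l) = fst (fst r ! 0) (fst a)" by (simp add: X_def vert_def)
  have "na 0 = 0" "nr 0 = 0" by (auto simp: na_def nr_def)
  then have X_0: "X 0 = fst (fst r ! l) (vert (pcat \<A> V) a m)" by (simp add: X_def)
  have XO: "X (m + l) \<in> Ob (pcat \<A> W)" using X_end fibre_mapD(3)[OF TT[of 0] aA] by simp
  note S = simplicesI[of W X "shuffle_chain (pcat \<A> V) \<beta> a r", unfolded len, OF W XO arr]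
  show "b \<in> simplices (pcat \<A> W) (m + length (snd r))"
    using S(1) unfolding b_def X_end l_def[symmetric] by simp
  show "vert (pcat \<A> W) b (m + length (snd r)) = fst (fst r ! length (snd r)) (vert (pcat \<A> V) a m)"
    using S(2)[of "m + l"] unfolding b_def X_end l_def[symmetric] by (simp add: X_0)
  assume id: "has_identity V (snd a) \<or> (\<exists>t\<in>set (snd r). \<forall>A\<in>Ob (pcat \<A> V). \<exists>X\<in>Ob (pcat \<A> W). t A = Idn (pcat \<A> W) X)"
  have setL: "set L = Inl ` set (snd a) \<union> Inr ` set (snd r)"
    unfolding L_def using \<beta> m by (subst set_place) (auto simp: shuffle_perms_def)
  show "has_identity W (snd b)"
    using id
  proof
    assume "has_identity V (snd a)"
    then obtain f A where f: "f \<in> set (snd a)" "A \<in> Ob (pcat \<A> V)" "f = Idn (pcat \<A> V) A"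
      by (auto simp: has_identity_def)
    then have "Inl f \<in> set L" using setL by auto
    then obtain x where x: "x < m + l" "L ! x = Inl f" using lenL by (metis in_set_conv_nth)
    have "snd (fst r ! (l - nr x)) f \<in> set (shuffle_chain (pcat \<A> V) \<beta> a r)"
      unfolding sc using x by (auto intro!: image_eqI[of _ _ x])
    then show ?thesis
      using fibre_mapD(3,5)[OF TT[of "l - nr x"] f(2)] f(3) by (auto simp: b_def has_identity_def)
  next
    assume "\<exists>t\<in>set (snd r). \<forall>A\<in>Ob (pcat \<A> V). \<exists>X\<in>Ob (pcat \<A> W). t A = Idn (pcat \<A> W) X"
    then obtain t where t: "t \<in> set (snd r)" "\<forall>A\<in>Ob (pcat \<A> V). \<exists>X\<in>Ob (pcat \<A> W). t A = Idn (pcat \<A> W) X"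
      by auto
    then have "Inr t \<in> set L" using setL by auto
    then obtain x where x: "x < m + l" "L ! x = Inr t" using lenL by (metis in_set_conv_nth)
    have "t (vert (pcat \<A> V) a (m - na x)) \<in> set (shuffle_chain (pcat \<A> V) \<beta> a r)"
      unfolding sc using x by (auto intro!: image_eqI[of _ _ x])
    then show ?thesis using t(2) vO[of "na x"] unfolding b_def has_identity_def snd_conv by blast
  qed
qed

section \<open>Chains in the graded category\<close>

text \<open>Membership is rephrased in terms of the position \<open>i\<close> in the base string; the morphisms of a chain
  are listed in composition order, so the one over position \<open>i\<close> has index \<open>n - 1 - i\<close>.\<close>

lemma mem_gr_chains_iff:
  assumes \<tau>: "\<tau> \<in> nerve \<U> n"
  shows "c \<in> gr_chains \<U> \<A> \<tau> \<longleftrightarrow> length (fst c) = n + 1 \<and> length (snd c) = n \<and>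
    (\<forall>i\<le>n. fst c ! i \<in> Ob (pcat \<A> (nvert \<U> \<tau> i))) \<and>
    (\<forall>i<n. snd c ! (n - 1 - i) \<in> arrows (nvert \<U> \<tau> i) (fst c ! i) (pob \<A> (snd \<tau> ! i) (fst c ! Suc i)))"
proof -
  have len: "length (snd \<tau>) = n" using \<tau> by (simp add: nerve_def)
  let ?as = "snd c" and ?As = "fst c"
  have "?as \<in> listset (map carrier (gr_Homs \<U> \<A> \<tau> ?As)) \<longleftrightarrow> length ?as = n \<and>
     (\<forall>i<n. ?as ! (n - 1 - i) \<in> arrows (nvert \<U> \<tau> i) (?As ! i) (pob \<A> (snd \<tau> ! i) (?As ! Suc i)))"
    if O: "\<forall>i\<le>n. ?As ! i \<in> Ob (pcat \<A> (nvert \<U> \<tau> i))"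
  proof -
    have C: "carrier (gr_Hom \<U> \<A> (snd \<tau> ! i) (?As ! i) (?As ! Suc i))
        = arrows (nvert \<U> \<tau> i) (?As ! i) (pob \<A> (snd \<tau> ! i) (?As ! Suc i))" if "i < n" for i
    proof -
      note u = nerve_nth[OF \<tau> that]
      have "?As ! Suc i \<in> Ob (pcat \<A> (Tgt \<U> (snd \<tau> ! i)))" using O that u by simp
      then have "pob \<A> (snd \<tau> ! i) (?As ! Suc i) \<in> Ob (pcat \<A> (nvert \<U> \<tau> i))"
        using fibre_mapD(3)[OF fibre_map_pullback[OF u(1)]] u(2) by simp
      moreover have "nvert \<U> \<tau> i \<in> Ob \<U>" using nvert_Ob[OF \<tau>] that by simp
      ultimately show ?thesis using O that u(2) carrier_Hom by (simp add: gr_Hom_def)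
    qed
    have "?as \<in> listset (map carrier (gr_Homs \<U> \<A> \<tau> ?As)) \<longleftrightarrow> length ?as = n \<and>
      (\<forall>j<n. ?as ! j \<in> carrier (gr_Hom \<U> \<A> (snd \<tau> ! (n - Suc j)) (?As ! (n - Suc j)) (?As ! (n - j))))"
    proof -
      have "length (gr_Homs \<U> \<A> \<tau> ?As) = n" by (simp add: gr_Homs_def Let_def len)
      moreover have "gr_Homs \<U> \<A> \<tau> ?As ! j = gr_Hom \<U> \<A> (snd \<tau> ! (n - Suc j)) (?As ! (n - Suc j)) (?As ! (n - j))"
        if "j < n" for j
        using that by (simp add: gr_Homs_def Let_def len del: upt_Suc)
      ultimately show ?thesis by (auto simp: in_listset_iff)
    qed
    also have "(\<forall>j<n. ?as ! j \<in> carrier (gr_Hom \<U> \<A> (snd \<tau> ! (n - Suc j)) (?As ! (n - Suc j)) (?As ! (n - j)))) \<longleftrightarrow>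
      (\<forall>i<n. ?as ! (n - 1 - i) \<in> carrier (gr_Hom \<U> \<A> (snd \<tau> ! i) (?As ! i) (?As ! Suc i)))"
    proof (intro iffI allI impI)
      fix i assume H: "\<forall>j<n. ?as ! j \<in> carrier (gr_Hom \<U> \<A> (snd \<tau> ! (n - Suc j)) (?As ! (n - Suc j)) (?As ! (n - j)))"
        and i: "i < n"
      have "n - 1 - i < n" "n - Suc (n - 1 - i) = i" "n - (n - 1 - i) = Suc i" using i by auto
      then show "?as ! (n - 1 - i) \<in> carrier (gr_Hom \<U> \<A> (snd \<tau> ! i) (?As ! i) (?As ! Suc i))"
        using H by metis
    next
      fix j assume H: "\<forall>i<n. ?as ! (n - 1 - i) \<in> carrier (gr_Hom \<U> \<A> (snd \<tau> ! i) (?As ! i) (?As ! Suc i))"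
        and j: "j < n"
      have "n - Suc j < n" "n - 1 - (n - Suc j) = j" "Suc (n - Suc j) = n - j" using j by auto
      then show "?as ! j \<in> carrier (gr_Hom \<U> \<A> (snd \<tau> ! (n - Suc j)) (?As ! (n - Suc j)) (?As ! (n - j)))"
        using H by metis
    qed
    finally show ?thesis using C by auto
  qed
  then show ?thesis
    by (cases c) (auto simp: gr_chains_def gr_objects_def len)
qed

lemma gr_chainsD:
  assumes "\<tau> \<in> nerve \<U> n" "c \<in> gr_chains \<U> \<A> \<tau>"
  shows "length (fst c) = n + 1" "length (snd c) = n"
    "i \<le> n \<Longrightarrow> fst c ! i \<in> Ob (pcat \<A> (nvert \<U> \<tau> i))"
    "i < n \<Longrightarrow> snd c ! (n - 1 - i) \<in> arrows (nvert \<U> \<tau> i) (fst c ! i) (pob \<A> (snd \<tau> ! i) (fst c ! Suc i))"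
  using assms mem_gr_chains_iff by auto

lemma nth_snd_gr_tail:
  "length (snd c) = n \<Longrightarrow> k + i < n \<Longrightarrow> snd (gr_tail k c) ! (n - k - 1 - i) = snd c ! (n - 1 - (k + i))"
  by (simp add: gr_tail_def add.commute add.left_commute)

lemma gr_tail_chains:
  assumes \<tau>: "\<tau> \<in> nerve \<U> n" and c: "c \<in> gr_chains \<U> \<A> \<tau>" and k: "k \<le> n"
  shows "gr_tail k c \<in> gr_chains \<U> \<A> (nright \<U> k \<tau>)"
proof -
  note C = gr_chainsD[OF \<tau> c]
  have len: "length (snd \<tau>) = n" using \<tau> by (simp add: nerve_def)
  have v: "nvert \<U> (nright \<U> k \<tau>) i = nvert \<U> \<tau> (k + i)" if "i \<le> n - k" for i
    using nvert_nright that len k by (metis add_le_cancel_left le_add_diff_inverse)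
  have "snd (gr_tail k c) ! (n - k - 1 - i)
      \<in> arrows (nvert \<U> \<tau> (k + i)) (fst c ! (k + i)) (pob \<A> (snd \<tau> ! (k + i)) (fst c ! Suc (k + i)))"
    if "i < n - k" for i
    using nth_snd_gr_tail[OF C(2), of k i] C(4)[of "k + i"] that by simp
  then show ?thesis
    using C(1,2,3) k v len by (simp add: mem_gr_chains_iff[OF nright_nerve[OF \<tau> k]]) (simp add: gr_tail_def)
qed

definition arrow_identity_at :: "('o, 'u) nsimplex \<Rightarrow> 'a list \<times> 'h list \<Rightarrow> nat \<Rightarrow> bool" where
  "arrow_identity_at \<tau> c i \<longleftrightarrow>
     (\<exists>X\<in>Ob (pcat \<A> (nvert \<U> \<tau> i)). snd c ! (length (snd c) - 1 - i) = Idn (pcat \<A> (nvert \<U> \<tau> i)) X)"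

text \<open>The morphisms with indices \<open>n + 1 - k, \<dots>, n\<close> are those over the first \<open>k\<close> positions.\<close>

lemma gr_comp_arrows:
  assumes \<tau>: "\<tau> \<in> nerve \<U> n" and c: "c \<in> gr_chains \<U> \<A> \<tau>" and k: "k \<le> n"
  shows "gr_comp \<A> \<tau> c (n + 1 - k) \<in> arrows (fst \<tau>) (fst c ! 0) (fst (star \<A> (take k (snd \<tau>))) (fst c ! k))"
    and "(\<And>i. i < k \<Longrightarrow> arrow_identity_at \<tau> c i) \<Longrightarrow>
      gr_comp \<A> \<tau> c (n + 1 - k) = Idn (pcat \<A> (fst \<tau>)) (fst c ! 0)"
proof -
  note C = gr_chainsD[OF \<tau> c]
  let ?U = "fst \<tau>" and ?us = "snd \<tau>"
  define xs where "xs = map (gr_under \<A> \<tau> (snd c)) [n + 1 - k..<n + 1]"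
  define X where "X i = fst (star \<A> (take (k - i) ?us)) (fst c ! (k - i))" for i
  have len: "length ?us = n" using \<tau> by (simp add: nerve_def)
  have U: "?U \<in> Ob \<U>" using nvert_Ob[OF \<tau>, of 0] by simp
  have nth: "xs ! i = snd (star \<A> (take (k - 1 - i) ?us)) (snd c ! (n - 1 - (k - 1 - i)))" if "i < k" for i
  proof -
    have "xs ! i = gr_under \<A> \<tau> (snd c) (n + 1 - k + i)"
      using that k by (simp add: xs_def del: upt_Suc)
    moreover have "n - (n + 1 - k + i) = k - 1 - i" "n + 1 - k + i - 1 = n - 1 - (k - 1 - i)"
      using that k by auto
    ultimately show ?thesis by (simp add: gr_under_def len)
  qed
  have arr: "xs ! i \<in> arrows ?U (X (Suc i)) (X i)" if i: "i < k" for i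
  proof -
    let ?j = "k - 1 - i"
    have j: "?j < n" "Suc ?j = k - i" using i k by auto
    have "take (Suc ?j) ?us = take ?j ?us @ [?us ! ?j]"
      using j(1) len by (intro take_Suc_conv_app_nth) simp
    then have "X i = fst (star \<A> (take ?j ?us)) (pob \<A> (?us ! ?j) (fst c ! Suc ?j))"
      unfolding X_def j(2)[symmetric] by (simp add: star_append star_single)
    moreover have "X (Suc i) = fst (star \<A> (take ?j ?us)) (fst c ! ?j)" by (simp add: X_def)
    ultimately show ?thesis
      using fibre_mapD(4)[OF fibre_map_star[OF nerve_npath(1)[OF \<tau>]] C(4)[of ?j]] j nth[OF i] by simp
  qed
  have X: "X k = fst c ! 0" "X 0 = fst (star \<A> (take k ?us)) (fst c ! k)"
    by (auto simp: X_def star_Nil)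
  have lenx: "length xs = k" using k by (simp add: xs_def del: upt_Suc)
  have XO: "X k \<in> Ob (pcat \<A> ?U)" using C(3)[of 0] by (simp add: X)
  note S = simplicesI[of ?U X xs, unfolded lenx, OF U XO arr]
  have gc: "gr_comp \<A> \<tau> c (n + 1 - k) = foldr (\<lambda>f g. f \<bullet>\<^bsub>pcat \<A> ?U\<^esub> g) xs (Idn (pcat \<A> ?U) (fst c ! 0))"
    by (simp add: gr_comp_def len foldr_map comp_def xs_def del: upt_Suc)
  show "gr_comp \<A> \<tau> c (n + 1 - k) \<in> arrows ?U (fst c ! 0) (fst (star \<A> (take k ?us)) (fst c ! k))"
    using simplex_composite(1)[OF U S(1)] S(2)[of k] unfolding gc by (simp add: X)
  assume id: "\<And>i. i < k \<Longrightarrow> arrow_identity_at \<tau> c i"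
  have "\<exists>X\<in>Ob (pcat \<A> ?U). f = Idn (pcat \<A> ?U) X" if f: "f \<in> set xs" for f
  proof -
    obtain i where i: "i < k" "f = xs ! i" using f lenx by (metis in_set_conv_nth)
    let ?j = "k - 1 - i"
    have j: "?j < k" "?j \<le> n" using i k by auto
    then obtain Y where "Y \<in> Ob (pcat \<A> (nvert \<U> \<tau> ?j))"
      "snd c ! (n - 1 - ?j) = Idn (pcat \<A> (nvert \<U> \<tau> ?j)) Y"
      using id[OF j(1)] C(2) by (auto simp: arrow_identity_at_def)
    then show ?thesis
      using nth[OF i(1)] i(2) fibre_mapD(3,5)[OF fibre_map_star[OF nerve_npath(1)[OF \<tau> j(2)]]] by auto
  qed
  then show "gr_comp \<A> \<tau> c (n + 1 - k) = Idn (pcat \<A> ?U) (fst c ! 0)"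
    using simplex_composite(2)[OF U S(1)] unfolding gc X by blast
qed

section \<open>The simplices of Seq\<close>

lemma shuffle_chain_no_arrows: "shuffle_chain C id (A, []) (Ts, rs) = map (\<lambda>r. r A) rs"
  by (rule nth_equalityI) (simp_all add: shuffle_chain_def Let_def vert_def)

lemma shuffle_chain_no_transformations: "shuffle_chain C id (A, as) ([T], []) = map (snd T) as"
  by (rule nth_equalityI) (simp_all add: shuffle_chain_def Let_def)

text \<open>The two clauses for one part and for several parts agree, a single part being shuffled into the
  empty simplex.\<close>

lemma seq_arrows_Cons:
  assumes "length (snd \<tau>) = sum_list (m # ms)" "z' \<in> seq_index ms"
    and "ms = [] \<Longrightarrow> \<beta> = id"
  shows "seq_arrows \<U> \<A> \<tau> c (m # ms) ((is, \<beta>) # z') =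
    shuffle_chain (pcat \<A> (nvert \<U> \<tau> m)) \<beta>
      (fst c ! m, seq_arrows \<U> \<A> (nright \<U> m \<tau>) (gr_tail m c) ms z')
      (path_functs \<U> \<A> (take m (snd \<tau>)) is, path_nts \<U> \<A> (take m (snd \<tau>)) is)
    @ [gr_comp \<A> \<tau> c (length (snd \<tau>) + 1 - m)]"
proof (cases ms)
  case Nil
  then show ?thesis using assms by (simp add: shuffle_chain_no_arrows)
next
  case (Cons m' ms')
  then show ?thesis by (simp add: Let_def)
qed

text \<open>The last claim is the reason why \<open>G (F \<phi>)\<close> has so few nonzero summands. Suppose that at each
  position the degree or the morphism is an identity. If the first part meets only identity
  morphisms, then the composite appended for this part is an identity. Otherwise it meets an
  identity degree. If the part has size at least two, its path contains an identity
  transformation. If it has size one, it accounts neither for the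
  assumed identity morphism nor for the assumed part of size at least two, so this assumption
  passes to the rest, where the induction hypothesis yields an identity that the shuffle preserves.

  All three claims are proved in one induction because each refers to the simplex of the rest.\<close>

lemma seq_arrows_simplex:
  assumes "\<tau> \<in> nerve \<U> n" "c \<in> gr_chains \<U> \<A> \<tau>" "ms \<in> partitions n" "z \<in> seq_index ms"
  defines "a \<equiv> (fst c ! 0, seq_arrows \<U> \<A> \<tau> c ms z)"
  shows "a \<in> simplices (pcat \<A> (fst \<tau>)) n \<and>
    vert (pcat \<A> (fst \<tau>)) a n = fst (star \<A> (map (ncomp \<U>) (pieces \<U> \<tau> ms))) (fst c ! n) \<and>
    ((\<forall>i<n. (\<exists>Z\<in>Ob \<U>. snd \<tau> ! i = Idn \<U> Z) \<or> arrow_identity_at \<tau> c i) \<longrightarrow>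
     (\<exists>i<n. arrow_identity_at \<tau> c i) \<or> (\<exists>m\<in>set ms. 2 \<le> m) \<longrightarrow>
     has_identity (fst \<tau>) (snd a))"
  using assms(1-4) unfolding a_def
proof (induction ms arbitrary: \<tau> c z n)
  case Nil
  then have n: "n = 0" by (simp add: partitions_Nil)
  have U: "fst \<tau> \<in> Ob \<U>" using nvert_Ob[OF Nil.prems(1), of 0] by simp
  have "fst c ! 0 \<in> Ob (pcat \<A> (fst \<tau>))" using gr_chainsD(3)[OF Nil.prems(1,2), of 0] by simp
  then show ?case by (simp add: n mem_simplices_iff[OF U] vert_def star_Nil)
next
  case (Cons m ms)
  note \<tau> = Cons.prems(1) and c = Cons.prems(2)
  have m: "1 \<le> m" "m \<le> n" and ms: "ms \<in> partitions (n - m)"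
    using Cons.prems(3) by (auto simp: partitions_Cons)
  obtain "is" \<beta> z' where z: "z = (is, \<beta>) # z'" and is_len: "is \<in> path_choices m"
    and \<beta>: "\<beta> \<in> shuffle_perms (sum_list ms) (m - 1)" and z': "z' \<in> seq_index ms"
    using seq_index_Cons[OF Cons.prems(4)] by blast
  let ?U = "fst \<tau>" and ?us = "take m (snd \<tau>)" and ?\<tau>' = "nright \<U> m \<tau>" and ?c' = "gr_tail m c"
  let ?V = "nvert \<U> \<tau> m"
  let ?r = "(path_functs \<U> \<A> ?us is, path_nts \<U> \<A> ?us is)"
  let ?a' = "(fst c ! m, seq_arrows \<U> \<A> ?\<tau>' ?c' ms z')"
  let ?g = "gr_comp \<A> \<tau> c (n + 1 - m)"
  note C = gr_chainsD[OF \<tau> c]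
  have len: "length (snd \<tau>) = n" using \<tau> by (simp add: nerve_def)
  have lenu: "length ?us = m" using len m by simp
  have U: "?U \<in> Ob \<U>" "?V \<in> Ob \<U>" using nvert_Ob[OF \<tau>, of 0] nvert_Ob[OF \<tau>, of m] m by auto
  have path: "npath \<U> ?U ?us ?V" using nerve_npath(1)[OF \<tau> m(2)] .
  have is_len': "is \<in> path_choices (length ?us)" using is_len lenu by simp
  have lr: "length (snd ?r) = m - 1" using length_path_choices[OF is_len] by simp
  have r: "ntrans_chain ?V ?U ?r" using ntrans_chain_path[OF path is_len'] .
  have sum: "sum_list ms = n - m" using ms by (simp add: partitions_def)
  have c0: "fst ?c' ! 0 = fst c ! m" "fst ?c' ! (n - m) = fst c ! n"
    using C(1) m by (auto simp: gr_tail_def)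
  note IH = Cons.IH[OF nright_nerve[OF \<tau> m(2)] gr_tail_chains[OF \<tau> c m(2)] ms z', unfolded c0 fst_nright]
  have seq: "seq_arrows \<U> \<A> \<tau> c (m # ms) z = shuffle_chain (pcat \<A> ?V) \<beta> ?a' ?r @ [?g]"
  proof -
    have "length (snd \<tau>) = sum_list (m # ms)" using len sum m by simp
    moreover have "ms = [] \<Longrightarrow> \<beta> = id" using Cons.prems(4) z seq_index_single_id by blast
    ultimately show ?thesis using seq_arrows_Cons[OF _ z'] len unfolding z by metis
  qed
  let ?b = "(fst (fst ?r ! 0) (fst ?a'), shuffle_chain (pcat \<A> ?V) \<beta> ?a' ?r)"
  have a': "?a' \<in> simplices (pcat \<A> ?V) (n - m)" using IH by blast
  have \<beta>': "\<beta> \<in> shuffle_perms (n - m) (length (snd ?r))" using \<beta> sum lr by simp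
  note B = shuffle_chain_simplex[OF a' r \<beta>' U(2,1)]
  have src: "fst (fst ?r ! 0) (fst ?a') = fst (star \<A> ?us) (fst c ! m)"
    by (simp add: path_functs_0)
  have nm: "Suc (n - m + (m - 1)) = n" using m by simp
  note G = gr_comp_arrows[OF \<tau> c m(2)]
  note S = simplex_snoc[OF U(1) B(1)[unfolded src] G(1), unfolded lr nm]
  have last: "fst ?r ! (m - 1) = star \<A> [ncomp \<U> (?U, ?us)]"
    using path_functs_last[OF path is_len'] lenu m length_path_choices[OF is_len] by fastforce
  have IH_end: "vert (pcat \<A> ?V) ?a' (n - m) = fst (star \<A> (map (ncomp \<U>) (pieces \<U> ?\<tau>' ms))) (fst c ! n)"
    using IH by blast
  have "fst (star \<A> (map (ncomp \<U>) (pieces \<U> \<tau> (m # ms)))) (fst c ! n) =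
      fst (star \<A> [ncomp \<U> (?U, ?us)]) (fst (star \<A> (map (ncomp \<U>) (pieces \<U> ?\<tau>' ms))) (fst c ! n))"
    using star_append[of "[ncomp \<U> (?U, ?us)]" "map (ncomp \<U>) (pieces \<U> ?\<tau>' ms)"] by (simp add: nleft_def)
  then have tgt: "vert (pcat \<A> ?U) ?b (n - m + (m - 1)) =
     fst (star \<A> (map (ncomp \<U>) (pieces \<U> \<tau> (m # ms)))) (fst c ! n)"
    using B(2)[unfolded lr IH_end last] by (simp only:)
  have "has_identity ?U (seq_arrows \<U> \<A> \<tau> c (m # ms) z)"
    if triv: "\<forall>i<n. (\<exists>Z\<in>Ob \<U>. snd \<tau> ! i = Idn \<U> Z) \<or> arrow_identity_at \<tau> c i"
      and some: "(\<exists>i<n. arrow_identity_at \<tau> c i) \<or> (\<exists>m\<in>set (m # ms). 2 \<le> m)"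
  proof (cases "\<forall>i<m. arrow_identity_at \<tau> c i")
    case True
    then show ?thesis using G(2) C(3)[of 0] unfolding seq has_identity_def by auto
  next
    case False
    then obtain i Z where i: "i < m" "\<not> arrow_identity_at \<tau> c i" "Z \<in> Ob \<U>" "snd \<tau> ! i = Idn \<U> Z"
      using triv m by (meson less_le_trans)
    have "has_identity ?V (snd ?a') \<or>
      (\<exists>t\<in>set (snd ?r). \<forall>A\<in>Ob (pcat \<A> ?V). \<exists>X\<in>Ob (pcat \<A> ?U). t A = Idn (pcat \<A> ?U) X)"
    proof (cases "2 \<le> m")
      case True
      have "Idn \<U> Z \<in> set ?us" using i len m by (metis in_set_conv_nth lenu nth_take)
      then show ?thesis using path_contains_identity[OF path is_len' _ i(3)] True lenu by simp
    next
      case False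
      then have m1: "m = 1" using m by simp
      then have i0: "i = 0" using i by simp
      have shift: "arrow_identity_at ?\<tau>' ?c' j \<longleftrightarrow> arrow_identity_at \<tau> c (m + j)" if "j < n - m" for j
      proof -
        have "m + j \<le> length (snd \<tau>)" "m + j < n" using that m len by auto
        then show ?thesis
          using nvert_nright[of m j \<tau> \<U>] nth_snd_gr_tail[OF C(2), of m j] C(2)
            gr_chainsD(2)[OF nright_nerve[OF \<tau> m(2)] gr_tail_chains[OF \<tau> c m(2)]]
          by (simp add: arrow_identity_at_def)
      qed
      have "\<forall>j<n - m. (\<exists>Z\<in>Ob \<U>. snd ?\<tau>' ! j = Idn \<U> Z) \<or> arrow_identity_at ?\<tau>' ?c' j"
      proof (intro allI impI)
        fix j assume j: "j < n - m"
        then have "snd ?\<tau>' ! j = snd \<tau> ! (m + j)" using len m by simp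
        then show "(\<exists>Z\<in>Ob \<U>. snd ?\<tau>' ! j = Idn \<U> Z) \<or> arrow_identity_at ?\<tau>' ?c' j"
          using triv[rule_format, of "m + j"] shift[OF j] j by simp
      qed
      moreover have "(\<exists>j<n - m. arrow_identity_at ?\<tau>' ?c' j) \<or> (\<exists>m\<in>set ms. 2 \<le> m)"
      proof (rule disjE[OF some])
        assume "\<exists>j<n. arrow_identity_at \<tau> c j"
        then obtain j where j: "j < n" "arrow_identity_at \<tau> c j" by blast
        then have "j \<noteq> 0" using i(2) i0 by metis
        then have "j - 1 < n - m" "m + (j - 1) = j" using j m1 by auto
        then show ?thesis using shift[of "j - 1"] j by metis
      qed (use m1 in auto)
      ultimately show ?thesis using IH by simp
    qed
    then show ?thesis using B(3) unfolding seq has_identity_def by auto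
  qed
  then show ?case using S tgt[unfolded src] unfolding seq by simp
qed

section \<open>Twists and strings of identities\<close>

text \<open>The composites of the pieces form a string over the same end points as \<open>\<tau>\<close> and with the same
  composite; \<open>tw_part\<close> is the composite of a path of this string.\<close>

lemma ncomp_pieces:
  assumes "\<tau> \<in> nerve \<U> n" "ms \<in> partitions n"
  shows "npath \<U> (fst \<tau>) (map (ncomp \<U>) (pieces \<U> \<tau> ms)) (nend \<U> \<tau>) \<and>
    ncomp \<U> (fst \<tau>, map (ncomp \<U>) (pieces \<U> \<tau> ms)) = ncomp \<U> \<tau>"
  using assms
proof (induction ms arbitrary: \<tau> n)
  case Nil
  then have "snd \<tau> = []" "\<tau> \<in> nerve \<U> 0" by (auto simp: partitions_Nil nerve_def)
  then show ?case using nvert_Ob[of \<tau> 0 0] by (cases \<tau>) (auto simp: nend_Nil)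
next
  case (Cons m ms)
  have m: "1 \<le> m" "m \<le> n" and ms: "ms \<in> partitions (n - m)"
    using Cons.prems(2) by (auto simp: partitions_Cons)
  have len: "length (snd \<tau>) = n" using Cons.prems by (simp add: nerve_def)
  let ?U = "fst \<tau>" and ?us = "take m (snd \<tau>)" and ?V = "nvert \<U> \<tau> m" and ?\<tau>' = "nright \<U> m \<tau>"
  note p = nerve_npath[OF Cons.prems(1) m(2)]
  note u = ncomp_Arr[OF p(1)]
  note IH = Cons.IH[OF nright_nerve[OF Cons.prems(1) m(2)] ms]
  let ?w = "ncomp \<U> (nleft m \<tau>)" and ?ws = "map (ncomp \<U>) (pieces \<U> ?\<tau>' ms)"
  have 1: "npath \<U> ?U [?w] ?V" using u npath_Ob(2)[OF p(1)] by (simp add: nleft_def)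
  have 2: "npath \<U> ?V ?ws (nend \<U> \<tau>)" using IH nend_nright[of m \<tau> \<U>] len m by simp
  have "ncomp \<U> (?U, [?w] @ ?ws) = ncomp \<U> (?V, ?ws) \<bullet>\<^bsub>\<U>\<^esub> ncomp \<U> (?U, [?w])"
    by (rule ncomp_append[OF 1 2])
  also have "ncomp \<U> (?U, [?w]) = ncomp \<U> (?U, ?us)"
    using ncomp_singleton[OF u(1)] u(2) by (simp add: nleft_def)
  also have "ncomp \<U> (?V, ?ws) = ncomp \<U> (?V, drop m (snd \<tau>))" using IH by (simp add: nright_def)
  also have "\<dots> \<bullet>\<^bsub>\<U>\<^esub> ncomp \<U> (?U, ?us) = ncomp \<U> (?U, ?us @ drop m (snd \<tau>))"
    by (rule ncomp_append[OF p, symmetric])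
  finally show ?case using npath_append[of ?U "[?w]" ?ws] 1 2 by auto
qed

lemma path_comp_arrows:
  assumes p: "npath \<U> U us V" and "is": "is \<in> path_choices (length us)" and ne: "us \<noteq> []"
    and A: "A \<in> Ob (pcat \<A> V)"
  shows "path_comp \<U> \<A> U us is A \<in> arrows U (fst (star \<A> us) A) (pob \<A> (ncomp \<U> (U, us)) A)"
    and "(\<And>r. r \<in> set (path_nts \<U> \<A> us is) \<Longrightarrow> \<exists>X\<in>Ob (pcat \<A> U). r A = Idn (pcat \<A> U) X) \<Longrightarrow>
      path_comp \<U> \<A> U us is A = Idn (pcat \<A> U) (fst (star \<A> us) A)"
proof -
  let ?r = "(path_functs \<U> \<A> us is, path_nts \<U> \<A> us is)"
  let ?a = "(A, []) :: ('a, 'h) simplex"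
  let ?xs = "map (\<lambda>r. r A) (path_nts \<U> \<A> us is)"
  have U: "U \<in> Ob \<U>" "V \<in> Ob \<U>" using npath_Ob[OF p] by auto
  have a: "?a \<in> simplices (pcat \<A> V) 0" using A by (simp add: mem_simplices_iff[OF U(2)])
  have id: "id \<in> shuffle_perms 0 (length (snd ?r))"
    by (auto simp: shuffle_perms_def permutes_id strict_mono_on_def)
  note B = shuffle_chain_simplex[OF a ntrans_chain_path[OF p "is"] id U(2,1)]
  have sc: "shuffle_chain (pcat \<A> V) id ?a ?r = ?xs"
    by (rule shuffle_chain_no_arrows)
  have pc: "path_comp \<U> \<A> U us is A =
      foldr (\<lambda>f g. f \<bullet>\<^bsub>pcat \<A> U\<^esub> g) ?xs (Idn (pcat \<A> U) (fst (star \<A> us) A))"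
    by (simp add: path_comp_def foldr_map comp_def)
  have S: "(fst (star \<A> us) A, ?xs) \<in> simplices (pcat \<A> U) (length is)"
    using B(1) unfolding sc by (simp add: path_functs_0)
  have "vert (pcat \<A> U) (fst (star \<A> us) A, ?xs) (length is) = pob \<A> (ncomp \<U> (U, us)) A"
    using B(2) path_functs_last[OF p "is" ne] unfolding sc by (simp add: path_functs_0 vert_def star_single)
  then show "path_comp \<U> \<A> U us is A \<in> arrows U (fst (star \<A> us) A) (pob \<A> (ncomp \<U> (U, us)) A)"
    using simplex_composite(1)[OF U(1) S] pc by simp
  show "(\<And>r. r \<in> set (path_nts \<U> \<A> us is) \<Longrightarrow> \<exists>X\<in>Ob (pcat \<A> U). r A = Idn (pcat \<A> U) X) \<Longrightarrow>
      path_comp \<U> \<A> U us is A = Idn (pcat \<A> U) (fst (star \<A> us) A)"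
    using simplex_composite(2)[OF U(1) S] unfolding pc by auto
qed

lemma some_path: "(SOME is. is \<in> path_choices m) \<in> path_choices m"
  using path_choices_nonempty[of m] by (metis ex_in_conv someI)

lemma tw_part_arrows:
  assumes \<tau>: "\<tau> \<in> nerve \<U> n" and ms: "ms \<in> partitions n" and A: "A \<in> Ob (pcat \<A> (nend \<U> \<tau>))"
  shows "tw_part \<U> \<A> \<tau> ms A
    \<in> arrows (fst \<tau>) (fst (star \<A> (map (ncomp \<U>) (pieces \<U> \<tau> ms))) A) (pob \<A> (ncomp \<U> \<tau>) A)"
proof (cases "ms = []")
  case True
  then have "snd \<tau> = []" using \<tau> ms by (simp add: nerve_def partitions_Nil)
  then have t: "\<tau> = (fst \<tau>, [])" by (cases \<tau>) auto
  have U: "fst \<tau> \<in> Ob \<U>" using nvert_Ob[OF \<tau>, of 0] by simp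
  have A': "A \<in> Ob (pcat \<A> (fst \<tau>))" using A nend_Nil[of \<U> "fst \<tau>"] t by simp
  have "ncomp \<U> \<tau> = Idn \<U> (fst \<tau>)" using ncomp_Nil[of "fst \<tau>"] t by simp
  then show ?thesis using True Idn_arrows[OF U A'] pob_Idn[OF U A'] by (simp add: tw_part_def star_Nil)
next
  case False
  note P = ncomp_pieces[OF \<tau> ms]
  have "map (ncomp \<U>) (pieces \<U> \<tau> ms) \<noteq> []" using False by (metis length_0_conv length_map length_pieces)
  moreover have "(SOME is. is \<in> path_choices (length ms)) \<in> path_choices (length (map (ncomp \<U>) (pieces \<U> \<tau> ms)))"
    using some_path by simp
  ultimately show ?thesis
    using path_comp_arrows(1)[OF conjunct1[OF P] _ _ A] P False by (simp add: tw_part_def)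
qed

text \<open>In a string of identities every choice merges identities, so all steps of a path are identities,
  in contrast to \<open>path_contains_identity\<close>, where a single one is found.\<close>

lemma path_nts_identity:
  assumes "npath \<U> U us U" "is \<in> path_choices (length us)" "\<forall>u\<in>set us. u = Idn \<U> U"
    and "A \<in> Ob (pcat \<A> U)" "r \<in> set (path_nts \<U> \<A> us is)"
  shows "\<exists>X\<in>Ob (pcat \<A> U). r A = Idn (pcat \<A> U) X"
  using assms
proof (induction "is" arbitrary: us)
  case (Cons i "is")
  then have i: "1 \<le> i" "i < length us" and is_len: "is \<in> path_choices (length us - 1)"
    by (auto simp: path_choices_Cons)
  have U: "U \<in> Ob \<U>" using npath_Ob[OF Cons.prems(1)] by auto
  have "us ! i = Idn \<U> U" "us ! (i - 1) = Idn \<U> U" using Cons.prems(3) i by auto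
  then have 1: "eps \<A> us i A = Idn (pcat \<A> U) (fst (star \<A> us) A)"
    and 2: "\<forall>u\<in>set (face \<U> i us). u = Idn \<U> U"
    using eps_Idn[OF Cons.prems(1) i Cons.prems(4) U] Cons.prems(3) Comp_Idn_left[OF Idn_Arr[OF U]] Tgt_Idn[OF U]
    by (auto simp: face_def dest: in_set_takeD in_set_dropD)
  have 3: "is \<in> path_choices (length (face \<U> i us))" using is_len length_face[OF i] by metis
  have "r = eps \<A> us i \<or> r \<in> set (path_nts \<U> \<A> (face \<U> i us) is)" using Cons.prems(5) by auto
  then show ?case
    using Cons.IH[OF npath_face[OF Cons.prems(1) i] 3 2 Cons.prems(4)] 1
      fibre_mapD(3)[OF fibre_map_star[OF Cons.prems(1)] Cons.prems(4)] by blast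
qed auto

lemma star_identity:
  assumes "U \<in> Ob \<U>" "\<forall>u\<in>set us. u = Idn \<U> U" "A \<in> Ob (pcat \<A> U)"
  shows "fst (star \<A> us) A = A"
  using assms by (induction us) (auto simp: star_def pob_Idn)

lemma ncomp_identity:
  assumes "U \<in> Ob \<U>" "\<forall>u\<in>set us. u = Idn \<U> U"
  shows "ncomp \<U> (U, us) = Idn \<U> U"
proof -
  have "foldl (\<lambda>w u. u \<bullet>\<^bsub>\<U>\<^esub> w) (Idn \<U> U) us = Idn \<U> U"
    using assms(2) by (induction us) (use Comp_Idn_left[OF Idn_Arr[OF assms(1)]] Tgt_Idn[OF assms(1)] in auto)
  then show ?thesis by (simp add: ncomp_def)
qed

lemma pieces_identity:
  assumes "\<tau> \<in> nerve \<U> n" "ms \<in> partitions n" "U \<in> Ob \<U>" "fst \<tau> = U" "\<forall>u\<in>set (snd \<tau>). u = Idn \<U> U"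
  shows "\<forall>w\<in>set (map (ncomp \<U>) (pieces \<U> \<tau> ms)). w = Idn \<U> U"
  using assms
proof (induction ms arbitrary: \<tau> n)
  case (Cons m ms)
  have m: "1 \<le> m" "m \<le> n" and ms: "ms \<in> partitions (n - m)"
    using Cons.prems(2) by (auto simp: partitions_Cons)
  have len: "length (snd \<tau>) = n" using Cons.prems by (simp add: nerve_def)
  have "snd \<tau> ! (m - 1) = Idn \<U> U" using Cons.prems(5) m len by simp
  then have v: "nvert \<U> \<tau> m = U" using m Tgt_Idn[OF Cons.prems(3)] by (simp add: nvert_def)
  have "ncomp \<U> (nleft m \<tau>) = Idn \<U> U"
    using ncomp_identity[OF Cons.prems(3), of "take m (snd \<tau>)"] Cons.prems(4,5)
    by (auto simp: nleft_def dest: in_set_takeD)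
  then show ?case
    using Cons.IH[OF nright_nerve[OF Cons.prems(1) m(2)] ms Cons.prems(3)] v Cons.prems(5)
    by (auto dest: in_set_dropD)
qed auto

text \<open>Since \<open>tw_part\<close> depends on an arbitrary choice of a path, the twist over a string of identities is
  computed for all paths at once.\<close>

lemma tw_part_identity:
  assumes \<tau>: "\<tau> \<in> nerve \<U> n" and ms: "ms \<in> partitions n" and U: "U \<in> Ob \<U>" "fst \<tau> = U" "nend \<U> \<tau> = U"
    and us: "\<forall>u\<in>set (snd \<tau>). u = Idn \<U> U" and A: "A \<in> Ob (pcat \<A> U)"
  shows "tw_part \<U> \<A> \<tau> ms A = Idn (pcat \<A> U) A"
proof (cases "ms = []")
  case True
  then show ?thesis using U by (simp add: tw_part_def)
next
  case False
  let ?ws = "map (ncomp \<U>) (pieces \<U> \<tau> ms)"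
  have p: "npath \<U> U ?ws U" using ncomp_pieces[OF \<tau> ms] U by simp
  have "is": "(SOME is. is \<in> path_choices (length ms)) \<in> path_choices (length ?ws)"
    using some_path by simp
  have ne: "?ws \<noteq> []" using False by (metis length_0_conv length_map length_pieces)
  note i = pieces_identity[OF \<tau> ms U(1,2) us]
  show ?thesis
    using path_comp_arrows(2)[OF p "is" ne A] path_nts_identity[OF p "is" i A] star_identity[OF U(1) i A]
      False U(2) by (simp add: tw_part_def)
qed

text \<open>With all parts equal to one there are neither paths nor genuine shuffles, and over identities the
  pullbacks do nothing, so the chain is returned unchanged.\<close>

lemma seq_arrows_ones:
  assumes "\<tau> \<in> nerve \<U> n" "c \<in> gr_chains \<U> \<A> \<tau>" "\<forall>u\<in>set (snd \<tau>). u = Idn \<U> (fst \<tau>)"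
  shows "seq_arrows \<U> \<A> \<tau> c (replicate n 1) (replicate n ([], id)) = snd c"
  using assms
proof (induction n arbitrary: \<tau> c)
  case 0
  then show ?case using gr_chainsD(2)[OF 0(1,2)] by simp
next
  case (Suc n)
  note \<tau> = Suc.prems(1) and c = Suc.prems(2)
  note C = gr_chainsD[OF \<tau> c]
  let ?U = "fst \<tau>" and ?\<tau>' = "nright \<U> 1 \<tau>" and ?c' = "gr_tail 1 c"
  have U: "?U \<in> Ob \<U>" using nvert_Ob[OF \<tau>, of 0] by simp
  have len: "length (snd \<tau>) = Suc n" using \<tau> by (simp add: nerve_def)
  have u0: "snd \<tau> ! 0 = Idn \<U> ?U" using Suc.prems(3) len by simp
  then have take1: "take 1 (snd \<tau>) = [Idn \<U> ?U]" using len by (cases "snd \<tau>") auto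
  have v: "nvert \<U> \<tau> 1 = ?U" using u0 Tgt_Idn[OF U] by (simp add: nvert_def)
  have c': "?c' \<in> gr_chains \<U> \<A> ?\<tau>'" "?\<tau>' \<in> nerve \<U> n"
    using gr_tail_chains[OF \<tau> c, of 1] nright_nerve[OF \<tau>, of 1] by auto
  have all: "\<forall>u\<in>set (snd ?\<tau>'). u = Idn \<U> (fst ?\<tau>')"
    using Suc.prems(3) v by (auto dest: in_set_dropD)
  note IH = Suc.IH[OF c'(2,1) all]
  have z: "replicate n ([], id) \<in> seq_index (replicate n 1)" using seq_index_ones by auto
  have arr: "f \<in> Arr (pcat \<A> ?U)" if f: "f \<in> set (snd ?c')" for f
  proof -
    obtain j where j: "j < n" "f = snd ?c' ! j"
      using f gr_chainsD(2)[OF c'(2,1)] by (metis in_set_conv_nth)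
    let ?i = "n - 1 - j"
    have i: "?i < n" "n - 1 - ?i = j" using j by auto
    have "nvert \<U> ?\<tau>' ?i = ?U"
    proof (cases ?i)
      case 0
      then show ?thesis using v by simp
    next
      case (Suc i')
      then have "nvert \<U> ?\<tau>' ?i = Tgt \<U> (snd ?\<tau>' ! i')" by (simp add: nvert_def)
      moreover have "i' < length (snd ?\<tau>')" using Suc i len by simp
      then have "snd ?\<tau>' ! i' = Idn \<U> (fst ?\<tau>')" using all nth_mem by blast
      ultimately show ?thesis using v Tgt_Idn[OF U] by simp
    qed
    then show ?thesis using gr_chainsD(4)[OF c'(2,1) i(1)] i j by (simp add: arrows_def)
  qed
  have l: "length (snd \<tau>) = sum_list (1 # replicate n 1)" using len by (simp add: sum_list_replicate)
  have "seq_arrows \<U> \<A> \<tau> c (replicate (Suc n) 1) (replicate (Suc n) ([], id)) =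
    shuffle_chain (pcat \<A> ?U) id (fst c ! 1, snd ?c') ([star \<A> [Idn \<U> ?U]], [])
    @ [gr_comp \<A> \<tau> c (n + 1)]"
    using seq_arrows_Cons[OF l z refl, of c "[]", unfolded IH v take1 len] by simp
  also have "shuffle_chain (pcat \<A> ?U) id (fst c ! 1, snd ?c') ([star \<A> [Idn \<U> ?U]], []) = snd ?c'"
    using arr parr_Idn[OF U] by (simp add: shuffle_chain_no_transformations star_single map_idI)
  also have "gr_comp \<A> \<tau> c (n + 1) = snd c ! n"
  proof -
    have "snd c ! n \<in> arrows ?U (fst c ! 0) (pob \<A> (snd \<tau> ! 0) (fst c ! 1))" using C(4)[of 0] by simp
    then show ?thesis using len Comp_Idn(2)
      by (simp add: gr_comp_def gr_under_def star_Nil)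
  qed
  also have "snd ?c' @ [snd c ! n] = snd c"
    using C(2) take_Suc_conv_app_nth[of n "snd c"] by (simp add: gr_tail_def)
  finally show ?case .
qed

end

section \<open>The summands of F\<close>

lemma (in abelian_monoid) finsum_single:
  assumes "finite A" "x0 \<in> A" "f x0 \<in> carrier G" "\<And>x. x \<in> A \<Longrightarrow> x \<noteq> x0 \<Longrightarrow> f x = \<zero>"
  shows "finsum G f A = f x0"
proof -
  have "finsum G f A = finsum G (\<lambda>x. if x0 = x then f x else \<zero>) A"
    by (rule finsum_cong') (use assms in auto)
  also have "\<dots> = f x0"
  proof -
    have "(\<lambda>x. if x0 = x then f x else \<zero>) = (\<lambda>x. if x0 = x then f x0 else \<zero>)" by auto
    then show ?thesis using finsum_singleton[OF assms(2,1), of "\<lambda>_. f x0"] assms(3) by simp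
  qed
  finally show ?thesis .
qed

lemma linear_map_zero:
  assumes "module R M" "module R N" "linear_map R M N f"
  shows "f \<zero>\<^bsub>M\<^esub> = \<zero>\<^bsub>N\<^esub>"
proof -
  interpret M: module R M by fact
  interpret N: module R N by fact
  have f0: "f \<zero>\<^bsub>M\<^esub> \<in> carrier N" using assms(3) by (simp add: linear_map_def)
  have "f (\<zero>\<^bsub>R\<^esub> \<odot>\<^bsub>M\<^esub> \<zero>\<^bsub>M\<^esub>) = \<zero>\<^bsub>R\<^esub> \<odot>\<^bsub>N\<^esub> f \<zero>\<^bsub>M\<^esub>"
    using assms(3) M.R.zero_closed M.M.zero_closed unfolding linear_map_def by blast
  then show ?thesis using f0 N.smult_l_null[OF f0] M.smult_l_null[OF M.M.zero_closed] by simp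
qed

context prestack
begin

lemma ncomp_split:
  assumes "\<sigma> \<in> nerve \<U> n" "p \<le> n"
  shows "ncomp \<U> (nright \<U> p \<sigma>) \<bullet>\<^bsub>\<U>\<^esub> ncomp \<U> (nleft p \<sigma>) = ncomp \<U> \<sigma>"
  using ncomp_append[OF nerve_npath[OF assms]] by (cases \<sigma>) (simp add: nleft_def nright_def)

lemma ncomp_nerve:
  assumes "\<sigma> \<in> nerve \<U> n"
  shows "ncomp \<U> \<sigma> \<in> Arr \<U>" "Src \<U> (ncomp \<U> \<sigma>) = fst \<sigma>" "Tgt \<U> (ncomp \<U> \<sigma>) = nend \<U> \<sigma>"
  using ncomp_Arr[of "fst \<sigma>" "snd \<sigma>" "nend \<U> \<sigma>"] assms by (auto simp: mem_nerve_iff)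

end

context prestack_bimodule
begin

text \<open>The simplex at which a summand of \<open>F\<close> evaluates \<open>\<phi>\<close>.\<close>

definition F_simplex ::
  "('o, 'u) nsimplex \<Rightarrow> 'a list \<times> 'h list \<Rightarrow> nat \<Rightarrow> nat list \<Rightarrow> (nat list \<times> (nat \<Rightarrow> nat)) list \<Rightarrow> ('a, 'h) simplex" where
  "F_simplex \<sigma> c p ms z = (fst c ! p, seq_arrows \<U> \<A> (nright \<U> p \<sigma>) (gr_tail p c) ms z)"

text \<open>A summand of \<open>F\<close> without its sign.\<close>

definition F_term ::
  "(('o, 'u) nsimplex \<Rightarrow> ('a, 'h) simplex \<Rightarrow> 'm) \<Rightarrow> nat \<Rightarrow> ('o, 'u) nsimplex \<Rightarrow> 'a list \<times> 'h list
    \<Rightarrow> nat \<Rightarrow> nat list \<Rightarrow> (nat list \<times> (nat \<Rightarrow> nat)) list \<Rightarrow> 'm" where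
  "F_term \<phi> n \<sigma> c p ms z = bact M (fst \<sigma>)
     (tw_cut \<U> \<A> \<sigma> p (fst c ! n)
       \<bullet>\<^bsub>pcat \<A> (fst \<sigma>)\<^esub> parr \<A> (ncomp \<U> (nleft p \<sigma>)) (tw_part \<U> \<A> (nright \<U> p \<sigma>) ms (fst c ! n)))
     (\<phi> (nleft p \<sigma>) (F_simplex \<sigma> c p ms z))
     (gr_comp \<A> \<sigma> c (n + 1 - p))"

lemma F_map_eq:
  assumes "\<sigma> \<in> nerve \<U> n" "c \<in> gr_chains \<U> \<A> \<sigma>"
  defines "N \<equiv> bmod M (fst \<sigma>) (fst c ! 0) (pob \<A> (ncomp \<U> \<sigma>) (fst c ! n))"
  shows "F_map \<U> \<A> M n \<phi> \<sigma> c = (\<Oplus>\<^bsub>N\<^esub>p\<in>{0..n}. \<Oplus>\<^bsub>N\<^esub>ms\<in>partitions (n - p). \<Oplus>\<^bsub>N\<^esub>z\<in>seq_index ms.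
     [(part_sign (n - p) ms * seq_sign z)] \<cdot>\<^bsub>N\<^esub> F_term \<phi> n \<sigma> c p ms z)"
  using assms(1,2) ncomp_nerve(2)[OF assms(1)]
  by (simp add: F_map_def Let_def F_term_def F_simplex_def gr_bmod_def N_def)

lemma F_simplex_mem:
  assumes \<sigma>: "\<sigma> \<in> nerve \<U> n" and c: "c \<in> gr_chains \<U> \<A> \<sigma>" and p: "p \<le> n"
    and ms: "ms \<in> partitions (n - p)" and z: "z \<in> seq_index ms"
  defines "V \<equiv> nvert \<U> \<sigma> p" and "\<xi> \<equiv> F_simplex \<sigma> c p ms z"
  shows "\<xi> \<in> simplices (pcat \<A> V) (n - p)"
    and "vert (pcat \<A> V) \<xi> (n - p) =
      fst (star \<A> (map (ncomp \<U>) (pieces \<U> (nright \<U> p \<sigma>) ms))) (fst c ! n)"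
    and "(nleft p \<sigma>, \<xi>) \<in> GS_dom \<U> \<A> n"
    and "\<lbrakk>\<And>i. p \<le> i \<Longrightarrow> i < n \<Longrightarrow> (\<exists>Z\<in>Ob \<U>. snd \<sigma> ! i = Idn \<U> Z) \<or> arrow_identity_at \<sigma> c i;
      (\<exists>i. p \<le> i \<and> i < n \<and> arrow_identity_at \<sigma> c i) \<or> (\<exists>m\<in>set ms. 2 \<le> m)\<rbrakk> \<Longrightarrow> has_identity V (snd \<xi>)"
proof -
  note \<sigma>' = nright_nerve[OF \<sigma> p] and c' = gr_tail_chains[OF \<sigma> c p]
  note C = gr_chainsD[OF \<sigma> c]
  have len: "length (snd \<sigma>) = n" using \<sigma> by (simp add: nerve_def)
  have c0: "fst (gr_tail p c) ! 0 = fst c ! p" "fst (gr_tail p c) ! (n - p) = fst c ! n"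
    using C(1) p by (auto simp: gr_tail_def)
  note S = seq_arrows_simplex[OF \<sigma>' c' ms z, unfolded c0 fst_nright, folded V_def F_simplex_def, folded \<xi>_def]
  show 1: "\<xi> \<in> simplices (pcat \<A> V) (n - p)" using S by blast
  show "vert (pcat \<A> V) \<xi> (n - p) =
      fst (star \<A> (map (ncomp \<U>) (pieces \<U> (nright \<U> p \<sigma>) ms))) (fst c ! n)" using S by blast
  have "nend \<U> (nleft p \<sigma>) = V" using nend_nleft[of p \<sigma> \<U>] p len by (simp add: V_def)
  then show "(nleft p \<sigma>, \<xi>) \<in> GS_dom \<U> \<A> n"
    using 1 nleft_nerve[OF \<sigma> p] p unfolding GS_dom_def by (intro CollectI case_prodI exI[of _ p] exI[of _ "n - p"]) auto
  assume triv: "\<And>i. p \<le> i \<Longrightarrow> i < n \<Longrightarrow> (\<exists>Z\<in>Ob \<U>. snd \<sigma> ! i = Idn \<U> Z) \<or> arrow_identity_at \<sigma> c i"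
    and some: "(\<exists>i. p \<le> i \<and> i < n \<and> arrow_identity_at \<sigma> c i) \<or> (\<exists>m\<in>set ms. 2 \<le> m)"
  have shift: "arrow_identity_at (nright \<U> p \<sigma>) (gr_tail p c) j \<longleftrightarrow> arrow_identity_at \<sigma> c (p + j)" if "j < n - p" for j
  proof -
    have "p + j \<le> length (snd \<sigma>)" "p + j < n" using that p len by auto
    then show ?thesis
      using nvert_nright[of p j \<sigma> \<U>] nth_snd_gr_tail[OF C(2), of p j] C(2) gr_chainsD(2)[OF \<sigma>' c']
      by (simp add: arrow_identity_at_def)
  qed
  have "\<forall>j<n - p. (\<exists>Z\<in>Ob \<U>. snd (nright \<U> p \<sigma>) ! j = Idn \<U> Z) \<or> arrow_identity_at (nright \<U> p \<sigma>) (gr_tail p c) j"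
  proof (intro allI impI)
    fix j assume j: "j < n - p"
    then have "snd (nright \<U> p \<sigma>) ! j = snd \<sigma> ! (p + j)" using len p by simp
    then show "(\<exists>Z\<in>Ob \<U>. snd (nright \<U> p \<sigma>) ! j = Idn \<U> Z) \<or> arrow_identity_at (nright \<U> p \<sigma>) (gr_tail p c) j"
      using triv[of "p + j"] shift[OF j] j by simp
  qed
  moreover have "(\<exists>j<n - p. arrow_identity_at (nright \<U> p \<sigma>) (gr_tail p c) j) \<or> (\<exists>m\<in>set ms. 2 \<le> m)"
  proof (rule disjE[OF some])
    assume "\<exists>i. p \<le> i \<and> i < n \<and> arrow_identity_at \<sigma> c i"
    then obtain i where i: "p \<le> i" "i < n" "arrow_identity_at \<sigma> c i" by blast
    then have "i - p < n - p" "p + (i - p) = i" by auto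
    then show ?thesis using shift[of "i - p"] i by metis
  qed blast
  ultimately show "has_identity V (snd \<xi>)" using S by blast
qed

text \<open>The two twists compose: the pieces of the right part are first joined to its composite, under the
  pullback along the left part, and the result is then joined with the left part.\<close>

lemma F_left_arrows:
  assumes \<sigma>: "\<sigma> \<in> nerve \<U> n" and p: "p \<le> n" and ms: "ms \<in> partitions (n - p)"
    and A: "A \<in> Ob (pcat \<A> (nend \<U> \<sigma>))"
  shows "tw_cut \<U> \<A> \<sigma> p A
       \<bullet>\<^bsub>pcat \<A> (fst \<sigma>)\<^esub> parr \<A> (ncomp \<U> (nleft p \<sigma>)) (tw_part \<U> \<A> (nright \<U> p \<sigma>) ms A)
    \<in> arrows (fst \<sigma>)
        (pob \<A> (ncomp \<U> (nleft p \<sigma>)) (fst (star \<A> (map (ncomp \<U>) (pieces \<U> (nright \<U> p \<sigma>) ms))) A))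
        (pob \<A> (ncomp \<U> \<sigma>) A)"
proof -
  have len: "length (snd \<sigma>) = n" using \<sigma> by (simp add: nerve_def)
  note L = ncomp_nerve[OF nleft_nerve[OF \<sigma> p]] and R = ncomp_nerve[OF nright_nerve[OF \<sigma> p]]
  have e: "nend \<U> (nleft p \<sigma>) = nvert \<U> \<sigma> p" "nend \<U> (nright \<U> p \<sigma>) = nend \<U> \<sigma>"
    using nend_nleft[of p \<sigma> \<U>] nend_nright[of p \<sigma> \<U>] p len by auto
  have "tw_part \<U> \<A> (nright \<U> p \<sigma>) ms A \<in> arrows (nvert \<U> \<sigma> p)
      (fst (star \<A> (map (ncomp \<U>) (pieces \<U> (nright \<U> p \<sigma>) ms))) A) (pob \<A> (ncomp \<U> (nright \<U> p \<sigma>)) A)"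
    using tw_part_arrows[OF nright_nerve[OF \<sigma> p] ms] A e by simp
  then have 1: "parr \<A> (ncomp \<U> (nleft p \<sigma>)) (tw_part \<U> \<A> (nright \<U> p \<sigma>) ms A) \<in> arrows (fst \<sigma>)
      (pob \<A> (ncomp \<U> (nleft p \<sigma>)) (fst (star \<A> (map (ncomp \<U>) (pieces \<U> (nright \<U> p \<sigma>) ms))) A))
      (pob \<A> (ncomp \<U> (nleft p \<sigma>)) (pob \<A> (ncomp \<U> (nright \<U> p \<sigma>)) A))"
    using fibre_mapD(4)[OF fibre_map_pullback[OF L(1)]] L e by simp
  have 2: "tw_cut \<U> \<A> \<sigma> p A \<in> arrows (fst \<sigma>)
      (pob \<A> (ncomp \<U> (nleft p \<sigma>)) (pob \<A> (ncomp \<U> (nright \<U> p \<sigma>)) A)) (pob \<A> (ncomp \<U> \<sigma>) A)"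
    using tw_arrows[OF R(1) L(1)] L R e A ncomp_split[OF \<sigma> p] by (simp add: tw_cut_def)
  show ?thesis by (rule Comp_arrows[OF 2 1])
qed

lemma F_term_zero:
  assumes \<sigma>: "\<sigma> \<in> nerve \<U> n" and c: "c \<in> gr_chains \<U> \<A> \<sigma>" and p: "p \<le> n"
    and ms: "ms \<in> partitions (n - p)" and z: "z \<in> seq_index ms"
    and zero: "\<phi> (nleft p \<sigma>) (F_simplex \<sigma> c p ms z) = GS_zero \<U> \<A> M (nleft p \<sigma>) (F_simplex \<sigma> c p ms z)"
  shows "F_term \<phi> n \<sigma> c p ms z = \<zero>\<^bsub>bmod M (fst \<sigma>) (fst c ! 0) (pob \<A> (ncomp \<U> \<sigma>) (fst c ! n))\<^esub>"
proof -
  note S = F_simplex_mem[OF \<sigma> c p ms z]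
  have len: "length (snd \<sigma>) = n" using \<sigma> by (simp add: nerve_def)
  have A: "fst c ! n \<in> Ob (pcat \<A> (nend \<U> \<sigma>))"
    using gr_chainsD(3)[OF \<sigma> c, of n] len by (simp add: nend_def)
  note b = F_left_arrows[OF \<sigma> p ms A] and a = gr_comp_arrows(1)[OF \<sigma> c p]
  have U: "fst \<sigma> \<in> Ob \<U>" using arrows_Ob[OF a] by blast
  note aO = arrows_Ob[OF a] and bO = arrows_Ob[OF b]
  let ?E = "fst (star \<A> (map (ncomp \<U>) (pieces \<U> (nright \<U> p \<sigma>) ms))) (fst c ! n)"
  let ?X = "bmod M (fst \<sigma>) (fst (star \<A> (take p (snd \<sigma>))) (fst c ! p)) (pob \<A> (ncomp \<U> (nleft p \<sigma>)) ?E)"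
  have "nend \<U> (nleft p \<sigma>) = nvert \<U> \<sigma> p" using nend_nleft[of p \<sigma> \<U>] p len by auto
  then have "GS_zero \<U> \<A> M (nleft p \<sigma>) (F_simplex \<sigma> c p ms z) = \<zero>\<^bsub>?X\<^esub>"
    using S(1,2) by (simp add: GS_zero_def GS_bmod_def simplices_def) (simp add: F_simplex_def)
  then show ?thesis unfolding F_term_def zero
    using linear_map_zero[OF _ _ bact_linear[OF U aO(3) bO(2) aO(2) bO(3) arrows_carrier[OF a] arrows_carrier[OF b]]]
      bmod_module[OF U aO(3) bO(2)] bmod_module[OF U aO(2) bO(3)] by simp
qed

lemma GS_cochain_carrier:
  assumes \<phi>: "\<phi> \<in> GS_cochains \<U> \<A> R M n" and \<sigma>: "\<sigma> \<in> nerve \<U> p" and p: "p + q = n"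
    and a: "a \<in> simplices (pcat \<A> (nend \<U> \<sigma>)) q"
  shows "\<phi> \<sigma> a \<in> carrier (GS_bmod \<U> \<A> M \<sigma> (fst a) (vert (pcat \<A> (nend \<U> \<sigma>)) a q))"
proof -
  let ?C = "pcat \<A> (nend \<U> \<sigma>)"
  let ?As = "map (vert ?C a) [0..<q + 1]"
  let ?Ms = "map (\<lambda>i. Hom ?C (?As ! (q - i)) (?As ! (q - i + 1))) [1..<q + 1]"
  have As: "length ?As = q + 1" "set ?As \<subseteq> Ob ?C"
    using simplex_vert_Ob[OF a] by auto
  have nth: "?As ! j = vert ?C a j" if "j \<le> q" for j
    using that by (simp del: upt_Suc)
  have "multilinear R ?Ms (GS_bmod \<U> \<A> M \<sigma> (?As ! 0) (?As ! q)) (\<lambda>as. \<phi> \<sigma> (?As ! 0, as))"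
    using \<phi> \<sigma> p As unfolding GS_cochains_def by blast
  moreover have "snd a \<in> listset (map carrier ?Ms)"
  proof -
    have "snd a ! i \<in> carrier (Hom ?C (vert ?C a (q - Suc i)) (vert ?C a (q - i)))" if "i < q" for i
      using a that unfolding simplices_def by (auto dest!: bspec[of _ _ "Suc i"] simp: Suc_diff_Suc)
    moreover have "length ?Ms = q" by simp
    moreover have "?Ms ! i = Hom ?C (vert ?C a (q - Suc i)) (vert ?C a (q - i))" if "i < q" for i
      using that nth[of "q - Suc i"] nth[of "q - i"] by (simp add: Suc_diff_Suc del: upt_Suc)
    ultimately show ?thesis using a unfolding in_listset_iff by (simp add: simplices_def del: upt_Suc)
  qed
  ultimately have "\<phi> \<sigma> (?As ! 0, snd a) \<in> carrier (GS_bmod \<U> \<A> M \<sigma> (?As ! 0) (?As ! q))"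
    unfolding multilinear_def by blast
  moreover have "(?As ! 0, snd a) = a" using nth[of 0] by (simp add: vert_def)
  ultimately show ?thesis using nth[of 0] nth[of q] by (simp add: vert_def)
qed

lemma F_map_zero:
  assumes \<sigma>: "\<sigma> \<in> nerve \<U> n" and c: "c \<in> gr_chains \<U> \<A> \<sigma>"
  defines "N \<equiv> bmod M (fst \<sigma>) (fst c ! 0) (pob \<A> (ncomp \<U> \<sigma>) (fst c ! n))"
  assumes zero: "\<And>p ms z. \<lbrakk>p \<le> n; ms \<in> partitions (n - p); z \<in> seq_index ms\<rbrakk> \<Longrightarrow> F_term \<phi> n \<sigma> c p ms z = \<zero>\<^bsub>N\<^esub>"
    and N: "module R N"
  shows "F_map \<U> \<A> M n \<phi> \<sigma> c = \<zero>\<^bsub>N\<^esub>"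
proof -
  interpret N: module R N by fact
  show ?thesis
    unfolding F_map_eq[OF \<sigma> c, folded N_def]
    by (intro N.add.finprod_one_eqI) (simp add: zero N.add.int_pow_one)
qed

text \<open>The surviving index has sign one: the partition into ones has as many parts as its sum, its paths
  are empty and its shuffles are identities.\<close>

lemma F_map_single:
  assumes \<sigma>: "\<sigma> \<in> nerve \<U> n" and c: "c \<in> gr_chains \<U> \<A> \<sigma>"
  defines "N \<equiv> bmod M (fst \<sigma>) (fst c ! 0) (pob \<A> (ncomp \<U> \<sigma>) (fst c ! n))"
  assumes p: "p \<le> n"
    and zero: "\<And>p' ms z. \<lbrakk>p' \<le> n; ms \<in> partitions (n - p'); z \<in> seq_index ms;
        p' \<noteq> p \<or> ms \<noteq> replicate (n - p) 1\<rbrakk> \<Longrightarrow> F_term \<phi> n \<sigma> c p' ms z = \<zero>\<^bsub>N\<^esub>"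
    and N: "module R N"
    and car: "F_term \<phi> n \<sigma> c p (replicate (n - p) 1) (replicate (n - p) ([], id)) \<in> carrier N"
  shows "F_map \<U> \<A> M n \<phi> \<sigma> c = F_term \<phi> n \<sigma> c p (replicate (n - p) 1) (replicate (n - p) ([], id))"
proof -
  interpret N: module R N by fact
  let ?T = "F_term \<phi> n \<sigma> c p (replicate (n - p) 1) (replicate (n - p) ([], id))"
  let ?t = "\<lambda>p ms z. [(part_sign (n - p) ms * seq_sign z)] \<cdot>\<^bsub>N\<^esub> F_term \<phi> n \<sigma> c p ms z"
  have sgn: "seq_sign (replicate k ([], id)) = 1" for k
    by (induction k) auto
  have t: "?t p (replicate (n - p) 1) (replicate (n - p) ([], id)) = ?T"
    using car by (simp add: part_sign_def sgn[simplified] N.add.int_pow_1)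
  have 1: "(\<Oplus>\<^bsub>N\<^esub>z\<in>seq_index (replicate (n - p) 1). ?t p (replicate (n - p) 1) z) = ?T"
    unfolding seq_index_ones using N.finsum_single[of "{replicate (n - p) ([], id)}" _ "?t p (replicate (n - p) 1)"] t car
    by simp
  have ones: "replicate (n - p) 1 \<in> partitions (n - p)"
    by (auto simp: partitions_def sum_list_replicate)
  have 2: "(\<Oplus>\<^bsub>N\<^esub>ms\<in>partitions (n - p). \<Oplus>\<^bsub>N\<^esub>z\<in>seq_index ms. ?t p ms z) = ?T"
    unfolding 1[symmetric]
  proof (rule N.finsum_single[OF _ ones])
    fix ms assume "ms \<in> partitions (n - p)" "ms \<noteq> replicate (n - p) 1"
    then show "(\<Oplus>\<^bsub>N\<^esub>z\<in>seq_index ms. ?t p ms z) = \<zero>\<^bsub>N\<^esub>"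
      using p by (intro N.add.finprod_one_eqI) (simp add: zero N.add.int_pow_one)
  qed (use car 1 in auto)
  show ?thesis
    unfolding F_map_eq[OF \<sigma> c, folded N_def] 2[symmetric]
  proof (rule N.finsum_single)
    fix p' assume "p' \<in> {0..n}" "p' \<noteq> p"
    then show "(\<Oplus>\<^bsub>N\<^esub>ms\<in>partitions (n - p'). \<Oplus>\<^bsub>N\<^esub>z\<in>seq_index ms. ?t p' ms z) = \<zero>\<^bsub>N\<^esub>"
      by (intro N.add.finprod_one_eqI) (simp add: zero N.add.int_pow_one)
  qed (use p car 2 in auto)
qed

text \<open>If the last \<open>n - p\<close> degrees and the first \<open>p\<close> morphisms are identities, the summand for \<open>p\<close> and
  the partition into ones is a value of \<open>\<phi>\<close>: the twists over identities are identities, and so is the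
  composite of the first \<open>p\<close> morphisms.\<close>

lemma F_term_main:
  assumes \<phi>: "\<phi> \<in> GS_cochains \<U> \<A> R M n"
    and \<sigma>: "\<sigma> \<in> nerve \<U> n" and c: "c \<in> gr_chains \<U> \<A> \<sigma>" and p: "p \<le> n"
    and left: "\<And>i. i < p \<Longrightarrow> arrow_identity_at \<sigma> c i"
    and right: "\<And>i. p \<le> i \<Longrightarrow> i < n \<Longrightarrow> snd \<sigma> ! i = Idn \<U> (nvert \<U> \<sigma> p)"
  shows "F_term \<phi> n \<sigma> c p (replicate (n - p) 1) (replicate (n - p) ([], id))
      = \<phi> (nleft p \<sigma>) (fst c ! p, take (n - p) (snd c))" (is ?eq)
    and "F_term \<phi> n \<sigma> c p (replicate (n - p) 1) (replicate (n - p) ([], id))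
      \<in> carrier (bmod M (fst \<sigma>) (fst c ! 0) (pob \<A> (ncomp \<U> \<sigma>) (fst c ! n)))" (is ?car)
proof -
  let ?ms = "replicate (n - p) 1 :: nat list" and ?z = "replicate (n - p) ([] :: nat list, id :: nat \<Rightarrow> nat)"
  let ?V = "nvert \<U> \<sigma> p" and ?r = "nright \<U> p \<sigma>" and ?l = "nleft p \<sigma>" and ?U = "fst \<sigma>" and ?A = "fst c ! n"
  note C = gr_chainsD[OF \<sigma> c]
  have ms: "?ms \<in> partitions (n - p)" by (auto simp: partitions_def sum_list_replicate)
  have z: "?z \<in> seq_index ?ms" unfolding seq_index_ones by simp
  have len: "length (snd \<sigma>) = n" using \<sigma> by (simp add: nerve_def)
  have V: "?V \<in> Ob \<U>" using nvert_Ob[OF \<sigma> p] .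
  have U: "?U \<in> Ob \<U>" using nvert_Ob[OF \<sigma>, of 0] by simp
  have e: "nend \<U> \<sigma> = ?V"
  proof (cases "p = n")
    case True
    then show ?thesis by (simp add: nend_def len)
  next
    case False
    then have "nvert \<U> \<sigma> n = Tgt \<U> (snd \<sigma> ! (n - 1))" using p by (simp add: nvert_def)
    then show ?thesis using right[of "n - 1"] Tgt_Idn[OF V] False p by (simp add: nend_def len)
  qed
  have er: "nend \<U> ?r = ?V" using nend_nright[of p \<sigma> \<U>] p len e by simp
  have el: "nend \<U> ?l = ?V" using nend_nleft[of p \<sigma> \<U>] p len by simp
  have A: "?A \<in> Ob (pcat \<A> ?V)" using C(3)[of n] e len by (simp add: nend_def)
  have ru: "\<forall>u\<in>set (snd ?r). u = Idn \<U> ?V"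
  proof
    fix u assume "u \<in> set (snd ?r)"
    then obtain j where "j < n - p" "u = snd \<sigma> ! (p + j)"
      using len p by (auto simp: in_set_conv_nth)
    then show "u = Idn \<U> ?V" using right[of "p + j"] by simp
  qed
  note r = nright_nerve[OF \<sigma> p] and l = nleft_nerve[OF \<sigma> p]
  note L = ncomp_nerve[OF l] and R = ncomp_nerve[OF r]
  have nr: "ncomp \<U> ?r = Idn \<U> ?V" using ncomp_identity[OF V] ru by (simp add: nright_def)
  have "ncomp \<U> \<sigma> = ncomp \<U> ?l"
    using ncomp_split[OF \<sigma> p] nr Comp_Idn_left[OF L(1)] L(3) el by simp
  note nc = this
  have pl: "pob \<A> (ncomp \<U> ?l) ?A \<in> Ob (pcat \<A> ?U)"
    using fibre_mapD(3)[OF fibre_map_pullback[OF L(1)]] A L el by simp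
  have tp: "tw_part \<U> \<A> ?r ?ms ?A = Idn (pcat \<A> ?V) ?A"
    by (rule tw_part_identity[OF r ms V _ er ru A]) simp
  have pt: "parr \<A> (ncomp \<U> ?l) (tw_part \<U> \<A> ?r ?ms ?A) = Idn (pcat \<A> ?U) (pob \<A> (ncomp \<U> ?l) ?A)"
    unfolding tp using fibre_mapD(5)[OF fibre_map_pullback[OF L(1)]] A L el by simp
  have tc: "tw_cut \<U> \<A> \<sigma> p ?A = Idn (pcat \<A> ?U) (pob \<A> (ncomp \<U> ?l) ?A)"
    using tw_Idn_left[OF L(1), of ?A] A L el nr by (simp add: tw_cut_def)
  have b: "tw_cut \<U> \<A> \<sigma> p ?A \<bullet>\<^bsub>pcat \<A> ?U\<^esub> parr \<A> (ncomp \<U> ?l) (tw_part \<U> \<A> ?r ?ms ?A)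
      = Idn (pcat \<A> ?U) (pob \<A> (ncomp \<U> ?l) ?A)"
    unfolding pt tc using Comp_Idn(1)[OF Idn_arrows[OF U pl]] .
  have A0: "fst c ! 0 \<in> Ob (pcat \<A> ?U)" using C(3)[of 0] by simp
  have a: "gr_comp \<A> \<sigma> c (n + 1 - p) = Idn (pcat \<A> ?U) (fst c ! 0)"
    using gr_comp_arrows(2)[OF \<sigma> c p] left by blast
  then have src: "fst (star \<A> (take p (snd \<sigma>))) (fst c ! p) = fst c ! 0"
    using gr_comp_arrows(1)[OF \<sigma> c p] Idn_arrows[OF U A0] by (auto simp: arrows_def)
  note S = F_simplex_mem[OF \<sigma> c p ms z]
  have tgt: "vert (pcat \<A> ?V) (F_simplex \<sigma> c p ?ms ?z) (n - p) = ?A"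
    using S(2) star_identity[OF V pieces_identity[OF r ms V _ ru] A] by simp
  have sq: "F_simplex \<sigma> c p ?ms ?z = (fst c ! p, take (n - p) (snd c))"
    using seq_arrows_ones[OF r gr_tail_chains[OF \<sigma> c p]] ru C(2) by (simp add: F_simplex_def gr_tail_def)
  let ?x = "\<phi> ?l (fst c ! p, take (n - p) (snd c))"
  have "?x \<in> carrier (GS_bmod \<U> \<A> M ?l (fst c ! p) ?A)"
    using GS_cochain_carrier[OF \<phi> l, of "n - p" "F_simplex \<sigma> c p ?ms ?z"] S(1) tgt p el unfolding sq by simp
  then have x: "?x \<in> carrier (bmod M ?U (fst c ! 0) (pob \<A> (ncomp \<U> ?l) ?A))"
    by (simp add: GS_bmod_def src)
  show ?eq unfolding F_term_def a b sq by (rule bact_Idn[OF U A0 pl x])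
  then show ?car using x nc by simp
qed

lemma F_term_zero_reduced:
  assumes \<sigma>: "\<sigma> \<in> nerve \<U> n" and c: "c \<in> gr_chains \<U> \<A> \<sigma>" and p: "p \<le> n"
    and ms: "ms \<in> partitions (n - p)" and z: "z \<in> seq_index ms"
    and red: "reduced \<U> \<A> M n \<phi>" and i: "i < p" "Z \<in> Ob \<U>" "snd \<sigma> ! i = Idn \<U> Z"
  shows "F_term \<phi> n \<sigma> c p ms z = \<zero>\<^bsub>bmod M (fst \<sigma>) (fst c ! 0) (pob \<A> (ncomp \<U> \<sigma>) (fst c ! n))\<^esub>"
proof (rule F_term_zero[OF \<sigma> c p ms z])
  have len: "length (snd \<sigma>) = n" using \<sigma> by (simp add: nerve_def)
  have "snd \<sigma> ! i \<in> set (snd (nleft p \<sigma>))"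
    using i p len by (auto simp: in_set_conv_nth intro!: exI[of _ i])
  then show "\<phi> (nleft p \<sigma>) (F_simplex \<sigma> c p ms z) = GS_zero \<U> \<A> M (nleft p \<sigma>) (F_simplex \<sigma> c p ms z)"
    using red F_simplex_mem(3)[OF \<sigma> c p ms z] i(2,3) unfolding reduced_def by fastforce
qed

lemma F_term_zero_normalized:
  assumes \<sigma>: "\<sigma> \<in> nerve \<U> n" and c: "c \<in> gr_chains \<U> \<A> \<sigma>" and p: "p \<le> n"
    and ms: "ms \<in> partitions (n - p)" and z: "z \<in> seq_index ms"
    and norm: "normalized \<U> \<A> M n \<phi>"
    and triv: "\<And>i. p \<le> i \<Longrightarrow> i < n \<Longrightarrow> (\<exists>Z\<in>Ob \<U>. snd \<sigma> ! i = Idn \<U> Z) \<or> arrow_identity_at \<sigma> c i"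
    and some: "(\<exists>i. p \<le> i \<and> i < n \<and> arrow_identity_at \<sigma> c i) \<or> (\<exists>m\<in>set ms. 2 \<le> m)"
  shows "F_term \<phi> n \<sigma> c p ms z = \<zero>\<^bsub>bmod M (fst \<sigma>) (fst c ! 0) (pob \<A> (ncomp \<U> \<sigma>) (fst c ! n))\<^esub>"
proof (rule F_term_zero[OF \<sigma> c p ms z])
  have len: "length (snd \<sigma>) = n" using \<sigma> by (simp add: nerve_def)
  have "nend \<U> (nleft p \<sigma>) = nvert \<U> \<sigma> p" using nend_nleft[of p \<sigma> \<U>] p len by auto
  then show "\<phi> (nleft p \<sigma>) (F_simplex \<sigma> c p ms z) = GS_zero \<U> \<A> M (nleft p \<sigma>) (F_simplex \<sigma> c p ms z)"
    using norm F_simplex_mem(3,4)[OF \<sigma> c p ms z] triv some unfolding normalized_def has_identity_def by fastforce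
qed

end

section \<open>The words behind conditioned shuffles\<close>

definition in_block :: "nat \<Rightarrow> entry \<Rightarrow> bool" where
  "in_block j e \<longleftrightarrow> e = Head j \<or> (\<exists>i. e = Step j i)"

definition block :: "nat list \<Rightarrow> nat \<Rightarrow> entry list" where
  "block ms j = Head j # map (Step j) [1..<part ms j]"

text \<open>What conditioned shuffles and shuffles with \<open>a\<close> retain of the original list: the order of the
  arrows, of the heads, and within each block. Everything about the chain of a word follows from
  this; the permutations themselves are only needed again to identify the trivial ones.\<close>

definition star_word :: "nat \<Rightarrow> nat list \<Rightarrow> entry list \<Rightarrow> bool" where
  "star_word q ms es \<longleftrightarrow> filter is_Arrow es = map Arrow [1..<q + 1] \<and>
     filter is_Head es = map Head [1..<length ms + 1] \<and>
     (\<forall>j\<in>{1..length ms}. filter (in_block j) es = block ms j) \<and>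
     (\<forall>e\<in>set es. is_Arrow e \<or> (\<exists>j\<in>{1..length ms}. in_block j e))"

lemma in_block_simps [simp]: "in_block j (Head i) \<longleftrightarrow> i = j" "in_block j (Step i l) \<longleftrightarrow> i = j" "\<not> in_block j (Arrow i)"
  by (auto simp: in_block_def)

lemma in_block_unique: "in_block i e \<Longrightarrow> in_block j e \<Longrightarrow> i = j"
  by (auto simp: in_block_def)

lemma block_start_Suc: "block_start ms (Suc j) = (if j = 0 then 0 else block_start ms j + part ms j)"
  by (simp add: block_start_def)

lemma sum_list_drop_part:
  "j \<le> length ms \<Longrightarrow> sum_list (drop (length ms - j) ms) = block_start ms (Suc j)"
proof (induction j)
  case (Suc j)
  have "drop (length ms - Suc j) ms = ms ! (length ms - Suc j) # drop (length ms - j) ms"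
    using Suc.prems by (metis Cons_nth_drop_Suc Suc_diff_Suc Suc_le_lessD diff_less_Suc diff_less less_le_trans zero_less_Suc)
  moreover have "block_start ms (Suc (Suc j)) = block_start ms (Suc j) + part ms (Suc j)"
    by (simp add: block_start_Suc[of ms "Suc j"])
  ultimately show ?case using Suc by (simp add: part_def)
qed (simp add: block_start_Suc)

lemma sum_list_eq_block_start: "sum_list ms = block_start ms (Suc (length ms))"
  using sum_list_drop_part[of "length ms" ms] by simp

lemma sum_list_take_part:
  "j \<le> length ms \<Longrightarrow> sum_list (take (length ms - j) ms) = sum_list ms - block_start ms (Suc j)"
  using sum_list_drop_part[of j ms] sum_list_append[of "take (length ms - j) ms" "drop (length ms - j) ms"]
  by simp

lemma block_start_mono: "i \<le> j \<Longrightarrow> block_start ms i \<le> block_start ms j"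
  unfolding block_start_def by (rule sum_mono2) auto

lemma part_pos: "ms \<in> partitions p \<Longrightarrow> j \<in> {1..length ms} \<Longrightarrow> 1 \<le> part ms j"
  unfolding partitions_def part_def by auto

lemma length_block: "1 \<le> part ms j \<Longrightarrow> length (block ms j) = part ms j"
  by (simp add: block_def)

lemma nth_block: "block ms j ! 0 = Head j" "Suc t < length (block ms j) \<Longrightarrow> block ms j ! Suc t = Step j (Suc t)"
  by (auto simp: block_def)

lemma in_block_block: "e \<in> set (block ms j) \<Longrightarrow> in_block j e"
  by (auto simp: block_def)

lemma seqq_list_block: "seqq_list ms = concat (map (block ms) [1..<length ms + 1])"
  by (simp add: seqq_list_def block_def[abs_def] del: upt_Suc)

lemma length_concat_blocks:
  assumes "\<And>j. j \<in> {1..k} \<Longrightarrow> 1 \<le> part ms j"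
  shows "length (concat (map (block ms) [1..<k + 1])) = block_start ms (Suc k)"
  using assms by (induction k) (auto simp: block_start_Suc length_block)

lemma nth_concat_blocks:
  assumes "\<And>j. j \<in> {1..k} \<Longrightarrow> 1 \<le> part ms j" "s < block_start ms (Suc k)"
  shows "\<exists>j\<in>{1..k}. block_start ms j \<le> s \<and> s < block_start ms j + part ms j \<and>
    concat (map (block ms) [1..<k + 1]) ! s = block ms j ! (s - block_start ms j)"
  using assms
proof (induction k)
  case (Suc k)
  let ?c = "concat (map (block ms) [1..<k + 1])"
  have len: "length ?c = block_start ms (Suc k)" using Suc.prems(1) by (intro length_concat_blocks) auto
  have c: "concat (map (block ms) [1..<Suc k + 1]) = ?c @ block ms (Suc k)" by simp
  show ?case
  proof (cases "s < block_start ms (Suc k)")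
    case True
    then have "\<exists>j\<in>{1..k}. block_start ms j \<le> s \<and> s < block_start ms j + part ms j \<and>
        ?c ! s = block ms j ! (s - block_start ms j)" using Suc by auto
    then show ?thesis unfolding c using True len by (auto simp: nth_append)
  next
    case False
    have "s < block_start ms (Suc k) + part ms (Suc k)"
      using Suc.prems(2) block_start_Suc[of ms "Suc k"] by simp
    then show ?thesis unfolding c using False len by (intro bexI[of _ "Suc k"]) (auto simp: nth_append)
  qed
qed (simp add: block_start_Suc)

lemma filter_is_Head_block: "filter is_Head (block ms j) = [Head j]"
  by (auto simp: block_def filter_empty_conv)

lemma filter_in_block_block: "filter (in_block j) (block ms i) = (if i = j then block ms j else [])"
  by (auto simp: block_def filter_empty_conv filter_id_conv)

lemma seqq_list_facts:
  assumes ms: "ms \<in> partitions p"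
  shows "length (seqq_list ms) = p" "filter is_Head (seqq_list ms) = map Head [1..<length ms + 1]"
    "j \<in> {1..length ms} \<Longrightarrow> filter (in_block j) (seqq_list ms) = block ms j"
    "e \<in> set (seqq_list ms) \<Longrightarrow> \<exists>j\<in>{1..length ms}. in_block j e"
proof -
  show "length (seqq_list ms) = p"
    using length_concat_blocks[of "length ms" ms] part_pos[OF ms] sum_list_eq_block_start[of ms] ms
    by (simp add: seqq_list_block partitions_def)
  show "filter is_Head (seqq_list ms) = map Head [1..<length ms + 1]"
    by (simp add: seqq_list_block filter_concat comp_def filter_is_Head_block concat_map_singleton del: upt_Suc)
  show "e \<in> set (seqq_list ms) \<Longrightarrow> \<exists>j\<in>{1..length ms}. in_block j e"
    by (auto simp: seqq_list_block simp del: upt_Suc dest: in_block_block)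
  have "filter (in_block j) (concat (map (block ms) [1..<k + 1])) = (if j \<in> {1..k} then block ms j else [])" for k
    by (induction k) (auto simp: filter_in_block_block)
  then show "j \<in> {1..length ms} \<Longrightarrow> filter (in_block j) (seqq_list ms) = block ms j"
    by (simp add: seqq_list_block del: upt_Suc)
qed

text \<open>Apply \<open>filter_place\<close> to both permutations. The arrows fill the first \<open>q\<close> positions and the rest
  the others, so the outer shuffle keeps both subwords; the inner permutation is increasing on the
  interval of each block and on the set of the heads by definition.\<close>

lemma star_word_star_entries:
  assumes ms: "ms \<in> partitions p" and \<beta>: "\<beta> \<in> shuffle_perms q p" and \<gamma>: "\<gamma> \<in> cond_shuffles ms"
  shows "star_word q ms (star_entries q ms \<beta> \<gamma>)" "length (star_entries q ms \<beta> \<gamma>) = q + p"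
    and "filter (Not \<circ> is_Arrow) (star_entries q ms \<beta> \<gamma>) = place \<gamma> (seqq_list ms)"
proof -
  let ?S = "seqq_list ms" and ?w = "place \<gamma> (seqq_list ms)" and ?as = "map Arrow [1..<q + 1]"
  let ?es = "star_entries q ms \<beta> \<gamma>"
  note S = seqq_list_facts[OF ms]
  have lenas: "length ?as = q" by (simp del: upt_Suc)
  have sum: "sum_list ms = p" using ms by (simp add: partitions_def)
  have p\<gamma>: "\<gamma> permutes {..<length ?S}" using \<gamma> S(1) sum by (simp add: cond_shuffles_def)
  have p\<beta>: "\<beta> permutes {..<length (?as @ ?w)}" using \<beta> S(1) lenas by (simp add: shuffle_perms_def)
  show "length ?es = q + p" using S(1) lenas by (simp add: star_entries_def)
  have setw: "set ?w = set ?S" by (rule set_place[OF p\<gamma>])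
  have no_arrow: "\<not> is_Arrow e" if "e \<in> set ?w" for e
    using S(4)[of e] that setw by (auto simp: in_block_def)
  have nth_w: "(?as @ ?w) ! i \<in> set ?w \<longleftrightarrow> q \<le> i" "is_Arrow ((?as @ ?w) ! i) \<longleftrightarrow> i < q" if "i < q + p" for i
  proof -
    have 1: "i < q \<Longrightarrow> is_Arrow ((?as @ ?w) ! i)" using lenas by (simp add: nth_append del: upt_Suc)
    have 2: "q \<le> i \<Longrightarrow> (?as @ ?w) ! i \<in> set ?w" using lenas that S(1) by (auto simp: nth_append simp del: upt_Suc)
    show "(?as @ ?w) ! i \<in> set ?w \<longleftrightarrow> q \<le> i" "is_Arrow ((?as @ ?w) ! i) \<longleftrightarrow> i < q"
      using 1 2 no_arrow by (metis not_le)+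
  qed
  have lenb: "length (?as @ ?w) = q + p" using lenas S(1) by simp
  have m\<beta>: "strict_mono_on {..<q} \<beta>" "strict_mono_on {q..<q + p} \<beta>" using \<beta> by (auto simp: shuffle_perms_def)
  have "filter is_Arrow ?es = filter is_Arrow (?as @ ?w)"
    unfolding star_entries_def
    by (rule filter_place[OF p\<beta>], rule monotone_on_subset[OF m\<beta>(1)]) (use nth_w lenb in auto)
  also have "\<dots> = ?as" using no_arrow by (auto simp: filter_empty_conv filter_id_conv simp del: upt_Suc)
  finally have 1: "filter is_Arrow ?es = ?as" .
  \<comment> \<open>subwords without arrows lie in the second range of the outer shuffle\<close>
  have other: "filter P ?es = filter P ?w" if P: "\<And>e. P e \<Longrightarrow> \<not> is_Arrow e" for P
  proof -
    have "filter P ?es = filter P (?as @ ?w)"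
      unfolding star_entries_def
    proof (rule filter_place[OF p\<beta>], rule monotone_on_subset[OF m\<beta>(2)], intro subsetI)
      fix i assume "i \<in> {i. i < length (?as @ ?w) \<and> P ((?as @ ?w) ! i)}"
      then have "i < q + p" "\<not> is_Arrow ((?as @ ?w) ! i)" using lenb P by auto
      then show "i \<in> {q..<q + p}" using nth_w(2)[of i] by simp
    qed
    also have "\<dots> = filter P ?w" using P[of "Arrow _"] by (auto simp: filter_empty_conv simp del: upt_Suc)
    finally show ?thesis .
  qed
  have nth_S: "\<exists>j\<in>{1..length ms}. block_start ms j \<le> s \<and> s < block_start ms j + part ms j \<and>
      ?S ! s = block ms j ! (s - block_start ms j)" if "s < p" for s
    unfolding seqq_list_block using nth_concat_blocks[of "length ms" ms s] part_pos[OF ms] that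
      sum_list_eq_block_start[of ms] sum by simp
  have "filter is_Head ?w = filter is_Head ?S"
  proof (rule filter_place[OF p\<gamma>], rule monotone_on_subset)
    show "strict_mono_on (block_start ms ` {1..length ms}) \<gamma>" using \<gamma> by (simp add: cond_shuffles_def)
    show "{i. i < length ?S \<and> is_Head (?S ! i)} \<subseteq> block_start ms ` {1..length ms}"
    proof
      fix s assume "s \<in> {i. i < length ?S \<and> is_Head (?S ! i)}"
      then have s: "s < p" "is_Head (?S ! s)" using S(1) by auto
      then obtain j where j: "j \<in> {1..length ms}" "block_start ms j \<le> s" "s < block_start ms j + part ms j"
        "?S ! s = block ms j ! (s - block_start ms j)" using nth_S by blast
      have "s - block_start ms j = 0"
      proof (rule ccontr)
        assume "s - block_start ms j \<noteq> 0"
        then obtain t where t: "s - block_start ms j = Suc t" by (cases "s - block_start ms j") auto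
        then have "t < part ms j - 1" using j by auto
        then show False using s(2) j(4) t by (simp add: block_def)
      qed
      then show "s \<in> block_start ms ` {1..length ms}" using j by force
    qed
  qed
  then have 2: "filter is_Head ?es = map Head [1..<length ms + 1]"
    using other[of is_Head] S(2) by (metis entry.distinct_disc(1))
  have 3: "filter (in_block j) ?es = block ms j" if j: "j \<in> {1..length ms}" for j
  proof -
    have "filter (in_block j) ?w = filter (in_block j) ?S"
    proof (rule filter_place[OF p\<gamma>], rule monotone_on_subset)
      show "strict_mono_on {block_start ms j..<block_start ms j + part ms j} \<gamma>"
        using \<gamma> j by (simp add: cond_shuffles_def)
      show "{i. i < length ?S \<and> in_block j (?S ! i)} \<subseteq> {block_start ms j..<block_start ms j + part ms j}"
      proof
        fix s assume "s \<in> {i. i < length ?S \<and> in_block j (?S ! i)}"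
        then have s: "s < p" "in_block j (?S ! s)" using S(1) by auto
        then obtain i where i: "i \<in> {1..length ms}" "block_start ms i \<le> s" "s < block_start ms i + part ms i"
          "?S ! s = block ms i ! (s - block_start ms i)" using nth_S by blast
        have "s - block_start ms i < length (block ms i)"
          using i length_block[OF part_pos[OF ms i(1)]] by simp
        then have "in_block i (?S ! s)" using in_block_block[of "?S ! s" ms i] i(4) by simp
        then have "i = j" using s in_block_unique by blast
        then show "s \<in> {block_start ms j..<block_start ms j + part ms j}" using i by simp
      qed
    qed
    moreover have "in_block j e \<Longrightarrow> \<not> is_Arrow e" for e by (auto simp: in_block_def)
    ultimately show ?thesis using other[of "in_block j"] S(3)[OF j] by simp
  qed
  have "set ?es = set (?as @ ?w)" unfolding star_entries_def by (rule set_place[OF p\<beta>])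
  then have 4: "is_Arrow e \<or> (\<exists>j\<in>{1..length ms}. in_block j e)" if "e \<in> set ?es" for e
    using that S(4)[of e] setw by auto
  show "star_word q ms ?es" using 1 2 3 4 unfolding star_word_def by blast
  have "filter (Not \<circ> is_Arrow) ?es = filter (Not \<circ> is_Arrow) ?w" by (rule other) simp
  then show "filter (Not \<circ> is_Arrow) ?es = ?w" using no_arrow by (simp add: filter_id_conv)
qed

lemma filter_take: "filter P (take x xs) = take (length (filter P (take x xs))) (filter P xs)"
proof -
  have "filter P xs = filter P (take x xs) @ filter P (drop x xs)"
    by (metis append_take_drop_id filter_append)
  then show ?thesis by simp
qed

text \<open>In a prefix of the word the head of a block is the first letter of the block to appear; the
  truncated subtraction covers the case that it has not yet appeared.\<close>

lemma n_steps_block: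
  assumes w: "star_word q ms es" and j: "j \<in> {1..length ms}"
  shows "n_steps j (take x es) = length (filter (in_block j) (take x es)) - 1"
proof -
  let ?l = "length (filter (in_block j) (take x es))"
  let ?P = "\<lambda>e. \<exists>i. e = Step j i"
  have "filter (in_block j) (take x es) = take ?l (block ms j)"
    using w j filter_take[of "in_block j" x es] unfolding star_word_def by metis
  moreover have "filter ?P (filter (in_block j) (take x es)) = filter ?P (take x es)"
    by (auto intro: filter_cong)
  ultimately have *: "filter ?P (take x es) = filter ?P (take ?l (block ms j))" by simp
  have l: "?l \<le> length (block ms j)"
    using arg_cong[OF filter_take[of "in_block j" x es], of length] w j unfolding star_word_def by simp
  have "filter ?P (take l (block ms j)) = take (l - 1) (map (Step j) [1..<part ms j])" for l
    by (cases l) (auto simp: block_def filter_id_conv dest!: in_set_takeD)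
  then show ?thesis using * l unfolding n_steps_def by (simp add: block_def)
qed

lemma star_word_counts:
  assumes w: "star_word q ms es"
  shows "n_arrows es = q" "n_heads es = length ms"
    "j \<in> {1..length ms} \<Longrightarrow> n_steps j es = part ms j - 1"
    "n_arrows (take x es) \<le> q" "n_heads (take x es) \<le> length ms"
proof -
  show "n_arrows es = q" "n_heads es = length ms"
    using w by (simp_all add: star_word_def n_arrows_def n_heads_def del: upt_Suc)
  show "j \<in> {1..length ms} \<Longrightarrow> n_steps j es = part ms j - 1"
    using n_steps_block[OF w, of j "length es"] w by (simp add: star_word_def block_def)
  show "n_arrows (take x es) \<le> q" "n_heads (take x es) \<le> length ms"
    using arg_cong[OF filter_take[of is_Arrow x es], of length] arg_cong[OF filter_take[of is_Head x es], of length] w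
    by (simp_all add: star_word_def n_arrows_def n_heads_def del: upt_Suc)
qed

lemma star_word_Arrow:
  assumes w: "star_word q ms es" and x: "x < length es" "es ! x = Arrow i"
  shows "i = n_arrows (take x es) + 1" "n_arrows (take x es) < q"
  using nth_filter_prefix[of is_Arrow es _ x, OF _ x(1)] x(2) w
  by (simp_all add: star_word_def n_arrows_def del: upt_Suc)

lemma star_word_Head:
  assumes w: "star_word q ms es" and x: "x < length es" "es ! x = Head j"
  shows "j = n_heads (take x es) + 1" "j \<in> {1..length ms}" "n_steps j (take x es) = 0"
proof -
  have 1: "j = n_heads (take x es) + 1" "n_heads (take x es) < length ms"
    using nth_filter_prefix[of is_Head es _ x, OF _ x(1)] x(2) w
    by (simp_all add: star_word_def n_heads_def del: upt_Suc)
  then show "j = n_heads (take x es) + 1" and j: "j \<in> {1..length ms}" by auto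
  let ?l = "length (filter (in_block j) (take x es))"
  have l: "?l < length (block ms j)" "Head j = block ms j ! ?l"
    using nth_filter_prefix[of "in_block j" es "block ms j" x, OF _ x(1)] x(2) w j
    by (simp_all add: star_word_def)
  have "?l = 0"
  proof (rule ccontr)
    assume "?l \<noteq> 0"
    then obtain t where t: "?l = Suc t" by (meson not0_implies_Suc)
    show False using l nth_block(2)[of t ms j] unfolding t by simp
  qed
  then show "n_steps j (take x es) = 0" using n_steps_block[OF w j, of x] by simp
qed

lemma star_word_Step:
  assumes w: "star_word q ms es" and x: "x < length es" "es ! x = Step j i"
  shows "j \<in> {1..length ms}" "i = n_steps j (take x es) + 1" "i < part ms j"
    "Head j \<in> set (take x es)" "j \<le> n_heads (take x es)"
proof -
  have "Step j i \<in> set es" using x by (metis nth_mem)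
  then show j: "j \<in> {1..length ms}" using w unfolding star_word_def by fastforce
  let ?f = "filter (in_block j) (take x es)" and ?l = "length (filter (in_block j) (take x es))"
  have l: "?l < length (block ms j)" "Step j i = block ms j ! ?l"
    using nth_filter_prefix[of "in_block j" es "block ms j" x, OF _ x(1)] x(2) w j
    by (simp_all add: star_word_def)
  have "?l \<noteq> 0"
  proof
    assume l0: "?l = 0"
    show False using l(2) nth_block(1)[of ms j] unfolding l0 by simp
  qed
  then obtain t where t: "?l = Suc t" by (meson not0_implies_Suc)
  have tm: "t < part ms j - 1" using l(1) unfolding t by (simp add: block_def)
  have "i = Suc t" using l nth_block(2)[of t ms j] unfolding t by simp
  then show "i = n_steps j (take x es) + 1" "i < part ms j"
    using n_steps_block[OF w j, of x] t tm by auto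
  have "?f = take ?l (block ms j)"
    using w j filter_take[of "in_block j" x es] unfolding star_word_def by metis
  then have "Head j \<in> set ?f" using t by (simp add: block_def)
  then show H: "Head j \<in> set (take x es)" by simp
  then obtain y where y: "y < length es" "y < x" "es ! y = Head j" by (auto simp: in_set_conv_nth)
  have "j = n_heads (take y es) + 1" by (rule star_word_Head(1)[OF w y(1,3)])
  moreover have "n_heads (take x es) \<ge> n_heads (take y es) + 1"
  proof -
    have "take x es = take (Suc y) (take x es) @ drop (Suc y) (take x es)"
      by (rule append_take_drop_id[symmetric])
    also have "take (Suc y) (take x es) = take y es @ [es ! y]"
      using y by (simp add: take_Suc_conv_app_nth min_def)
    finally have "n_heads (take x es) = n_heads ((take y es @ [es ! y]) @ drop (Suc y) (take x es))"
      by (rule arg_cong)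
    then show ?thesis using y(3) by (simp add: n_heads_def)
  qed
  ultimately show "j \<le> n_heads (take x es)" by simp
qed

lemma counts_snoc:
  "n_arrows (pre @ [e]) = n_arrows pre + (if is_Arrow e then 1 else 0)"
  "n_heads (pre @ [e]) = n_heads pre + (if is_Head e then 1 else 0)"
  "n_steps j (pre @ [e]) = n_steps j pre + (if \<exists>i. e = Step j i then 1 else 0)"
  by (auto simp: n_arrows_def n_heads_def n_steps_def)

text \<open>A step comes after the head of its block, so an initial segment of the word without heads
  consists of arrows. Counting letters then leaves as many heads, and so as many parts, as \<open>p\<close>;
  since the parts add up to \<open>p\<close>, each of them is one.\<close>

lemma star_word_split:
  assumes w: "star_word q ms es" and len: "length es = q + p" and ms: "ms \<in> partitions p" and p': "p' \<le> q + p"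
    and tail: "\<And>x. q + p - p' \<le> x \<Longrightarrow> x < q + p \<Longrightarrow> is_Head (es ! x)"
    and init: "\<And>x. x < q + p - p' \<Longrightarrow> \<not> is_Head (es ! x)"
  shows "p' = p" "ms = replicate p 1" "es = map Arrow [1..<q + 1] @ map Head [1..<p + 1]"
proof -
  let ?a = "take (q + p - p') es" and ?b = "drop (q + p - p') es"
  have a: "is_Arrow e" if e: "e \<in> set ?a" for e
  proof -
    obtain x where x: "x < q + p - p'" "e = es ! x" using e len by (auto simp: in_set_conv_nth)
    show ?thesis
    proof (cases e)
      case (Step j i)
      have "Head j \<in> set (take x es)" using star_word_Step(4)[OF w, of x j i] x Step len by simp
      then obtain y where "y < x" "es ! y = Head j" by (auto simp: in_set_conv_nth)
      then show ?thesis using init[of y] x by simp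
    qed (use init[OF x(1)] x in auto)
  qed
  have b: "is_Head e" if e: "e \<in> set ?b" for e
  proof -
    obtain y where "y < length ?b" "e = ?b ! y" using e by (metis in_set_conv_nth)
    then show ?thesis using tail[of "q + p - p' + y"] len p' by simp
  qed
  have excl: "is_Head e \<longleftrightarrow> \<not> is_Arrow e" if "is_Arrow e \<or> is_Head e" for e
    using that by (cases e) auto
  have "filter is_Arrow ?a = ?a" "filter is_Arrow ?b = []" "filter is_Head ?a = []" "filter is_Head ?b = ?b"
    unfolding filter_id_conv filter_empty_conv using a b excl by blast+
  then have fil: "filter is_Arrow (?a @ ?b) = ?a" "filter is_Head (?a @ ?b) = ?b"
    by (simp_all only: filter_append append_Nil append_Nil2)
  have A: "?a = map Arrow [1..<q + 1]"
    using w fil(1) unfolding star_word_def append_take_drop_id by simp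
  have B: "?b = map Head [1..<length ms + 1]"
    using w fil(2) unfolding star_word_def append_take_drop_id by simp
  have "q + p - p' = q" using arg_cong[OF A, of length] len by (simp del: upt_Suc)
  then show p'_eq: "p' = p" using p' by simp
  have k: "length ms = p" using arg_cong[OF B, of length] len p'_eq by (simp del: upt_Suc)
  show "es = map Arrow [1..<q + 1] @ map Head [1..<p + 1]" using A B k append_take_drop_id by metis
  have "xs = replicate (length xs) 1" if "\<forall>m\<in>set xs. 1 \<le> m" "sum_list xs \<le> length xs" for xs :: "nat list"
    using that
  proof (induction xs)
    case (Cons m xs)
    then have "m = 1" "sum_list xs \<le> length xs" using length_le_sum_list[of xs] by auto
    then show ?case using Cons by simp
  qed simp
  from this[of ms] show "ms = replicate p 1" using ms k by (simp add: partitions_def)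
qed

lemma seqq_list_ones: "seqq_list (replicate p 1) = map Head [1..<p + 1]"
proof -
  let ?ms = "replicate p 1 :: nat list"
  have "part ?ms j = 1" if "j \<in> {1..p}" for j using that by (auto simp: part_def)
  then have "map (\<lambda>j. Head j # map (Step j) [1..<part ?ms j]) [1..<length ?ms + 1] = map (\<lambda>j. [Head j]) [1..<p + 1]"
    by (intro map_cong) auto
  then show ?thesis unfolding seqq_list_def by (simp only: concat_map_singleton)
qed

lemma star_entries_main:
  assumes \<beta>: "\<beta> \<in> shuffle_perms q p" and \<gamma>: "\<gamma> \<in> cond_shuffles (replicate p 1)"
    and es: "star_entries q (replicate p 1) \<beta> \<gamma> = map Arrow [1..<q + 1] @ map Head [1..<p + 1]"
  shows "\<gamma> = id" "\<beta> = id"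
proof -
  let ?ms = "replicate p 1 :: nat list" and ?H = "map Head [1..<p + 1]" and ?as = "map Arrow [1..<q + 1]"
  have ms: "?ms \<in> partitions p" by (auto simp: partitions_def sum_list_replicate)
  have S: "seqq_list ?ms = ?H" by (rule seqq_list_ones)
  have "place \<gamma> (seqq_list ?ms) = filter (Not \<circ> is_Arrow) (?as @ ?H)"
    using star_word_star_entries(3)[OF ms \<beta> \<gamma>] unfolding es by (rule sym)
  then have w: "place \<gamma> ?H = ?H"
    unfolding S by (simp add: filter_empty_conv filter_id_conv del: upt_Suc)
  have "\<gamma> permutes {..<length ?H}" using \<gamma> by (simp add: cond_shuffles_def sum_list_replicate del: upt_Suc)
  then show "\<gamma> = id" by (rule place_eq_imp_id[OF _ _ w]) (simp add: distinct_map inj_on_def del: upt_Suc)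
  have "place \<beta> (?as @ ?H) = ?as @ ?H" using es unfolding star_entries_def S w .
  moreover have "\<beta> permutes {..<length (?as @ ?H)}" using \<beta> by (simp add: shuffle_perms_def del: upt_Suc)
  ultimately show "\<beta> = id" by (intro place_eq_imp_id) (auto simp: distinct_map inj_on_def simp del: upt_Suc)
qed

section \<open>The chain of a word\<close>

lemma pieces_nth:
  "\<lbrakk>i < length ms; sum_list ms \<le> length (snd \<sigma>)\<rbrakk> \<Longrightarrow>
    pieces C \<sigma> ms ! i = nleft (ms ! i) (nright C (sum_list (take i ms)) \<sigma>)"
proof (induction ms arbitrary: \<sigma> i)
  case (Cons m ms)
  show ?case
  proof (cases i)
    case (Suc i')
    have "sum_list (take i' ms) \<le> sum_list ms"
      using sum_list_append[of "take i' ms" "drop i' ms"] by simp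
    then show ?thesis
      using Suc Cons nvert_nright[of m "sum_list (take i' ms)" \<sigma> C]
      by (simp add: nleft_def nright_def add.commute)
  qed (simp add: nleft_def nright_def)
qed simp

context prestack
begin

lemma fibre_map_fold:
  assumes "\<And>j. a < j \<Longrightarrow> j \<le> b \<Longrightarrow> fibre_map (v (j - 1)) (v j) (F j)" "a \<le> b" "v a \<in> Ob \<U>"
  shows "fibre_map (v a) (v b) (fold (\<lambda>j. fst (F j)) [a + 1..<b + 1], fold (\<lambda>j. snd (F j)) [a + 1..<b + 1])"
  using assms(2,1)
proof (induction b rule: dec_induct)
  case base
  then show ?case using fibre_map_id[OF assms(3)] by (simp add: id_def)
next
  case (step b)
  have 1: "fibre_map (v b) (v (Suc b)) (F (Suc b))" using step.prems[of "Suc b"] step.hyps by simp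
  have 2: "fibre_map (v a) (v b) (fold (\<lambda>j. fst (F j)) [a + 1..<b + 1], fold (\<lambda>j. snd (F j)) [a + 1..<b + 1])"
    using step by simp
  have "[a + 1..<Suc b + 1] = [a + 1..<b + 1] @ [Suc b]" using step.hyps by simp
  then show ?case using fibre_map_comp[OF 2 1] by (simp only: fold_append fst_conv snd_conv) (simp add: comp_def)
qed

end

text \<open>A word over the blocks of a partition of \<open>\<sigma>\<close>, paths for the blocks and a simplex \<open>a\<close>; these are
  the data from which \<open>G\<close> builds a chain.\<close>

locale starred = prestack R \<U> \<A>
  for R :: "('k, 'r) ring_scheme" and \<U> :: "('o, 'u) cat"
    and \<A> :: "('k, 'o, 'u, 'a, 'h) prestack" +
  fixes \<sigma> :: "('o, 'u) nsimplex" and p :: nat and ms :: "nat list" and rs :: "nat list list"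
    and a :: "('a, 'h) simplex" and q :: nat and es :: "entry list"
  assumes \<sigma>: "\<sigma> \<in> nerve \<U> p" and ms: "ms \<in> partitions p"
    and rs: "\<And>j. j \<in> {1..length ms} \<Longrightarrow> rs ! (j - 1) \<in> path_choices (part ms j)"
    and a: "a \<in> simplices (pcat \<A> (nend \<U> \<sigma>)) q"
    and word: "star_word q ms es" and length_es: "length es = q + p"
begin

text \<open>The index in \<open>\<sigma>\<close> of the vertex that is reached when the heads \<open>1, \<dots>, j\<close> have been read. Reading
  heads moves backwards along \<open>\<sigma>\<close>, from its last vertex for \<open>j = 0\<close> to its first.\<close>

definition cut :: "nat \<Rightarrow> nat" where
  "cut j = p - block_start ms (Suc j)"

definition vtx :: "nat \<Rightarrow> 'o" where
  "vtx j = nvert \<U> \<sigma> (cut j)"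

definition obj :: "nat \<Rightarrow> 'a" where
  "obj x = star_object \<U> \<A> \<sigma> ms rs a (take x es)"

definition deg :: "nat \<Rightarrow> 'u" where
  "deg x = star_degree \<U> \<sigma> ms (take x es) (es ! x)"

definition arr :: "nat \<Rightarrow> 'h" where
  "arr x = star_arrow \<U> \<A> \<sigma> ms rs a (take x es) (es ! x)"

abbreviation heads :: "nat \<Rightarrow> nat" where
  "heads x \<equiv> n_heads (take x es)"

lemma length_\<sigma>: "length (snd \<sigma>) = p"
  using \<sigma> by (simp add: nerve_def)

lemma sum_ms: "sum_list ms = p"
  using ms by (simp add: partitions_def)

lemma cut_0: "cut 0 = p" and cut_last: "cut (length ms) = 0"
  unfolding cut_def using sum_list_eq_block_start[of ms] sum_ms by (simp_all add: block_start_Suc[of ms 0])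

lemma cut_step: "j \<in> {1..length ms} \<Longrightarrow> cut (j - 1) = cut j + part ms j"
proof -
  assume j: "j \<in> {1..length ms}"
  have "block_start ms (Suc j) \<le> p"
    using block_start_mono[of "Suc j" "Suc (length ms)" ms] j sum_list_eq_block_start[of ms] sum_ms by simp
  then show ?thesis unfolding cut_def using j block_start_Suc[of ms j] by simp
qed

lemma cut_le: "cut j \<le> p"
  by (simp add: cut_def)

lemma vtx_Ob: "vtx j \<in> Ob \<U>"
  unfolding vtx_def using nvert_Ob[OF \<sigma> cut_le] .

lemma vtx_0: "vtx 0 = nend \<U> \<sigma>"
  by (simp add: vtx_def cut_0 nend_def length_\<sigma>)

lemma vtx_last: "vtx (length ms) = fst \<sigma>"
  by (simp add: vtx_def cut_last)

lemma piece_eq: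
  assumes "j \<in> {1..length ms}"
  shows "piece \<U> \<sigma> ms j = nleft (part ms j) (nright \<U> (cut j) \<sigma>)"
proof -
  have "length ms - j < length ms" "j \<le> length ms" using assms by auto
  then show ?thesis
    using pieces_nth[of "length ms - j" ms \<sigma> \<U>] sum_list_take_part[of j ms] length_\<sigma> sum_ms
    by (simp add: piece_def part_def cut_def)
qed

lemma piece_npath:
  assumes j: "j \<in> {1..length ms}"
  shows "fst (piece \<U> \<sigma> ms j) = vtx j" "length (snd (piece \<U> \<sigma> ms j)) = part ms j"
    "npath \<U> (vtx j) (snd (piece \<U> \<sigma> ms j)) (vtx (j - 1))"
proof -
  have c: "cut j + part ms j \<le> p" using cut_step[OF j] cut_le by metis
  have n: "nright \<U> (cut j) \<sigma> \<in> nerve \<U> (p - cut j)" by (rule nright_nerve[OF \<sigma> cut_le])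
  show "fst (piece \<U> \<sigma> ms j) = vtx j" by (simp add: piece_eq[OF j] vtx_def)
  show "length (snd (piece \<U> \<sigma> ms j)) = part ms j"
    using c length_\<sigma> by (simp add: piece_eq[OF j])
  have "nvert \<U> (nright \<U> (cut j) \<sigma>) (part ms j) = vtx (j - 1)"
    using nvert_nright[of "cut j" "part ms j" \<sigma> \<U>] c length_\<sigma> cut_step[OF j] by (simp add: vtx_def)
  then show "npath \<U> (vtx j) (snd (piece \<U> \<sigma> ms j)) (vtx (j - 1))"
    using nerve_npath(1)[OF n, of "part ms j"] c by (simp add: piece_eq[OF j] vtx_def)
qed

lemma piece_chain:
  assumes j: "j \<in> {1..length ms}"
  defines "us \<equiv> snd (piece \<U> \<sigma> ms j)" and "r \<equiv> rs ! (j - 1)"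
  shows "ntrans_chain (vtx (j - 1)) (vtx j) (path_functs \<U> \<A> us r, path_nts \<U> \<A> us r)"
    "length r = part ms j - 1"
    "path_functs \<U> \<A> us r ! (part ms j - 1) = (pob \<A> (ncomp \<U> (piece \<U> \<sigma> ms j)), parr \<A> (ncomp \<U> (piece \<U> \<sigma> ms j)))"
proof -
  note P = piece_npath[OF j, folded us_def]
  have r: "r \<in> path_choices (length us)" using rs[OF j] P(2) by (simp add: r_def)
  show "ntrans_chain (vtx (j - 1)) (vtx j) (path_functs \<U> \<A> us r, path_nts \<U> \<A> us r)"
    by (rule ntrans_chain_path[OF P(3) r])
  show l: "length r = part ms j - 1" using length_path_choices[OF r] P(2) by simp
  have "us \<noteq> []" using P(2) part_pos[OF ms j] by auto
  moreover have "ncomp \<U> (vtx j, us) = ncomp \<U> (piece \<U> \<sigma> ms j)"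
    using P(1) by (cases "piece \<U> \<sigma> ms j") (simp add: us_def)
  ultimately show "path_functs \<U> \<A> us r ! (part ms j - 1) = (pob \<A> (ncomp \<U> (piece \<U> \<sigma> ms j)), parr \<A> (ncomp \<U> (piece \<U> \<sigma> ms j)))"
    using path_functs_last[OF P(3) r] l by (simp add: star_single)
qed

abbreviation funct :: "nat \<Rightarrow> nat \<Rightarrow> ('a, 'h) funct" where
  "funct x \<equiv> star_funct \<U> \<A> \<sigma> ms rs (take x es)"

lemma funct_fibre_map:
  assumes j: "j \<in> {1..length ms}"
  shows "fibre_map (vtx (j - 1)) (vtx j) (funct x j)"
  using piece_chain(1,2)[OF j] unfolding star_funct_def ntrans_chain_def Let_def by simp

lemma fold_functs:
  assumes "i \<le> l" "l \<le> length ms"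
  shows "fibre_map (vtx i) (vtx l)
    (fold (\<lambda>j. fst (funct x j)) [i + 1..<l + 1], fold (\<lambda>j. snd (funct x j)) [i + 1..<l + 1])"
proof (rule fibre_map_fold)
  show "fibre_map (vtx (j - 1)) (vtx j) (funct x j)" if "i < j" "j \<le> l" for j
    by (rule funct_fibre_map) (use that assms in auto)
qed (use assms vtx_Ob in auto)

lemma base_Ob: "star_base \<U> \<A> \<sigma> a (take x es) \<in> Ob (pcat \<A> (vtx 0))"
  using simplex_vert_Ob[OF a] a by (simp add: star_base_def vtx_0 simplices_def)

lemma heads_le: "heads x \<le> length ms"
  by (rule star_word_counts(5)[OF word])

lemma obj_Ob: "obj x \<in> Ob (pcat \<A> (vtx (heads x)))"
  using fibre_mapD(3)[OF fold_functs[of 0 "heads x" x] base_Ob[of x]] heads_le by (simp add: obj_def star_object_def)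

lemma take_Suc_es: "x < q + p \<Longrightarrow> take (Suc x) es = take x es @ [es ! x]"
  by (simp add: take_Suc_conv_app_nth length_es)

lemma heads_Suc: "x < q + p \<Longrightarrow> heads (Suc x) = heads x + (if is_Head (es ! x) then 1 else 0)"
  by (simp add: take_Suc_es counts_snoc)

lemma deg_not_Head:
  assumes "\<not> is_Head (es ! x)"
  shows "deg x = Idn \<U> (vtx (heads x))"
proof -
  have "block_start ms (Suc (heads x)) = (\<Sum>j\<in>{1..heads x}. part ms j)"
    by (simp add: block_start_def atLeastLessThanSuc_atLeastAtMost)
  then have "deg x = Idn \<U> (nvert \<U> \<sigma> (length (snd \<sigma>) - block_start ms (Suc (heads x))))"
    using assms by (cases "es ! x") (simp_all add: deg_def)
  then show ?thesis by (simp add: vtx_def cut_def length_\<sigma>)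
qed

lemma deg_Arr:
  assumes x: "x < q + p"
  shows "deg x \<in> Arr \<U>" "Src \<U> (deg x) = vtx (heads (Suc x))" "Tgt \<U> (deg x) = vtx (heads x)"
proof -
  have "deg x \<in> Arr \<U> \<and> Src \<U> (deg x) = vtx (heads (Suc x)) \<and> Tgt \<U> (deg x) = vtx (heads x)"
  proof (cases "is_Head (es ! x)")
    case True
    then obtain j where j: "es ! x = Head j" by (cases "es ! x") auto
    note H = star_word_Head[OF word _ j] 
    have jj: "j = heads x + 1" "j \<in> {1..length ms}" using H x length_es by auto
    have "deg x = ncomp \<U> (vtx j, snd (piece \<U> \<sigma> ms j))"
      using piece_npath(1)[OF jj(2)] j by (cases "piece \<U> \<sigma> ms j") (simp add: deg_def)
    then show ?thesis using ncomp_Arr[OF piece_npath(3)[OF jj(2)]] heads_Suc[OF x] True jj by simp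
  next
    case False
    then show ?thesis
      using deg_not_Head[OF False] heads_Suc[OF x] vtx_Ob Idn_Arr Src_Idn Tgt_Idn by simp
  qed
  then show "deg x \<in> Arr \<U>" "Src \<U> (deg x) = vtx (heads (Suc x))" "Tgt \<U> (deg x) = vtx (heads x)" by auto
qed

lemma fold_funct_cong:
  assumes "\<And>j. j \<in> set js \<Longrightarrow> n_steps j (take x es) = n_steps j (take y es)"
  shows "fold (\<lambda>j. fst (funct x j)) js = fold (\<lambda>j. fst (funct y j)) js"
    "fold (\<lambda>j. snd (funct x j)) js = fold (\<lambda>j. snd (funct y j)) js"
  using assms by (auto simp: star_funct_def intro!: fold_cong)

text \<open>Reading a letter changes a single ingredient of the object \<open>F\<^sub>l \<dots> F\<^sub>1 A\<close>: an arrow moves \<open>A\<close>, a step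
  of block \<open>j\<close> moves \<open>F\<^sub>j\<close> backwards along its path, and a head applies a further functor, which
  is the pullback along the whole piece because no step of the block has been read yet.\<close>

lemma arr_arrows:
  assumes x: "x < q + p"
  shows "arr x \<in> arrows (vtx (heads (Suc x))) (obj (Suc x)) (pob \<A> (deg x) (obj x))"
proof (cases "es ! x")
  case (Arrow i)
  have xl: "x < length es" using x length_es by simp
  note W = star_word_Arrow[OF word xl Arrow]
  have h: "heads (Suc x) = heads x" using heads_Suc[OF x] Arrow by simp
  have st: "n_steps l (take (Suc x) es) = n_steps l (take x es)" for l
    by (simp add: take_Suc_es[OF x] counts_snoc Arrow)
  have len_a: "length (snd a) = q" using a by (simp add: simplices_def)
  have "snd a ! (i - 1) \<in> arrows (vtx 0) (vert (pcat \<A> (vtx 0)) a (q - 1 - (i - 1))) (vert (pcat \<A> (vtx 0)) a (q - (i - 1)))"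
    using a W mem_simplices_iff[OF vtx_Ob[of 0], of a q] unfolding vtx_0 by simp
  moreover have "star_base \<U> \<A> \<sigma> a (take (Suc x) es) = vert (pcat \<A> (vtx 0)) a (q - 1 - (i - 1))"
    "star_base \<U> \<A> \<sigma> a (take x es) = vert (pcat \<A> (vtx 0)) a (q - (i - 1))"
    using W Arrow by (simp_all add: star_base_def vtx_0 len_a take_Suc_es[OF x] counts_snoc)
  ultimately have "snd a ! (i - 1) \<in> arrows (vtx 0) (star_base \<U> \<A> \<sigma> a (take (Suc x) es)) (star_base \<U> \<A> \<sigma> a (take x es))"
    by simp
  then have "arr x \<in> arrows (vtx (heads x))
      (fold (\<lambda>j. fst (funct x j)) [1..<heads x + 1] (star_base \<U> \<A> \<sigma> a (take (Suc x) es))) (obj x)"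
    using fibre_mapD(4)[OF fold_functs[of 0 "heads x" x]] heads_le Arrow
    by (simp add: arr_def obj_def star_object_def del: upt_Suc)
  moreover have "fold (\<lambda>j. fst (funct x j)) [1..<heads x + 1] = fold (\<lambda>j. fst (funct (Suc x) j)) [1..<heads x + 1]"
    by (rule fold_funct_cong(1)) (rule st[symmetric])
  moreover have "pob \<A> (deg x) (obj x) = obj x"
    using deg_not_Head[of x] Arrow pob_Idn[OF vtx_Ob obj_Ob] by simp
  ultimately show ?thesis using h by (simp add: obj_def star_object_def del: upt_Suc)
next
  case (Head j)
  have xl: "x < length es" using x length_es by simp
  note W = star_word_Head[OF word xl Head]
  have h: "heads (Suc x) = j" using heads_Suc[OF x] Head W by simp
  have deg: "deg x = ncomp \<U> (piece \<U> \<sigma> ms j)" using Head by (simp add: deg_def)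
  have st: "n_steps i (take (Suc x) es) = n_steps i (take x es)" for i
    by (simp add: take_Suc_es[OF x] counts_snoc Head)
  have base: "star_base \<U> \<A> \<sigma> a (take (Suc x) es) = star_base \<U> \<A> \<sigma> a (take x es)"
    by (simp add: star_base_def take_Suc_es[OF x] counts_snoc Head)
  have "fst (funct (Suc x) j) = pob \<A> (deg x)"
    using piece_chain(3)[OF W(2)] W(3) deg by (simp add: star_funct_def st)
  moreover have "[1..<j + 1] = [1..<heads x + 1] @ [j]" using W(1) by simp
  moreover have "fold (\<lambda>j. fst (funct (Suc x) j)) [1..<heads x + 1] = fold (\<lambda>j. fst (funct x j)) [1..<heads x + 1]"
    by (rule fold_funct_cong(1)) (rule st)
  ultimately have o: "obj (Suc x) = pob \<A> (deg x) (obj x)"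
    unfolding obj_def star_object_def h base by (simp only: fold_append) simp
  have "arr x = Idn (pcat \<A> (vtx j)) (pob \<A> (deg x) (obj x))"
    using Head piece_npath(1)[OF W(2)] by (simp add: arr_def deg obj_def)
  then show ?thesis using Idn_arrows[OF vtx_Ob obj_Ob[of "Suc x"]] o h by simp
next
  case (Step j i)
  have xl: "x < length es" using x length_es by simp
  note W = star_word_Step[OF word xl Step]
  have h: "heads (Suc x) = heads x" using heads_Suc[OF x] Step by simp
  have st: "n_steps l (take (Suc x) es) = n_steps l (take x es)" if "l \<noteq> j" for l
    using that by (simp add: take_Suc_es[OF x] counts_snoc Step)
  have stj: "n_steps j (take (Suc x) es) = i" "n_steps j (take x es) = i - 1"
    using W(2) by (simp_all add: take_Suc_es[OF x] counts_snoc Step)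
  have base: "star_base \<U> \<A> \<sigma> a (take (Suc x) es) = star_base \<U> \<A> \<sigma> a (take x es)"
    by (simp add: star_base_def take_Suc_es[OF x] counts_snoc Step)
  let ?B = "fold (\<lambda>l. fst (funct x l)) [1..<j] (star_base \<U> \<A> \<sigma> a (take x es))"
  have j1: "j = j - 1 + 1" "j - 1 \<le> length ms" using W(1) by auto
  have B: "?B \<in> Ob (pcat \<A> (vtx (j - 1)))"
    using fibre_mapD(3)[OF fold_functs[of 0 "j - 1" x] base_Ob[of x]] j1 by (simp del: upt_Suc)
  let ?r = "path_nts \<U> \<A> (snd (piece \<U> \<sigma> ms j)) (rs ! (j - 1)) ! (i - 1)"
  have r: "?r ?B \<in> arrows (vtx j) (fst (funct (Suc x) j) ?B) (fst (funct x j) ?B)"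
  proof -
    have l: "length (rs ! (j - 1)) = part ms j - 1" "i - 1 < part ms j - 1" "1 \<le> i"
      using piece_chain(2)[OF W(1)] W(2,3) by auto
    let ?T = "path_functs \<U> \<A> (snd (piece \<U> \<sigma> ms j)) (rs ! (j - 1))"
    have "\<forall>i<part ms j - 1. \<forall>A\<in>Ob (pcat \<A> (vtx (j - 1))).
        (path_nts \<U> \<A> (snd (piece \<U> \<sigma> ms j)) (rs ! (j - 1)) ! i) A
          \<in> arrows (vtx j) (fst (?T ! (part ms j - 1 - 1 - i)) A) (fst (?T ! (part ms j - 1 - i)) A)"
      using piece_chain(1)[OF W(1)] unfolding ntrans_chain_def Let_def snd_conv fst_conv length_path_nts l(1)
      by blast
    then have "?r ?B \<in> arrows (vtx j) (fst (?T ! (part ms j - 1 - 1 - (i - 1))) ?B) (fst (?T ! (part ms j - 1 - (i - 1))) ?B)"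
      using l(2) B by blast
    moreover have "part ms j - 1 - 1 - (i - 1) = part ms j - 1 - i" using l by simp
    ultimately show ?thesis unfolding star_funct_def stj by simp
  qed
  let ?f = "fold (\<lambda>l. fst (funct x l)) [j + 1..<heads x + 1]"
  have "arr x \<in> arrows (vtx (heads x)) (?f (fst (funct (Suc x) j) ?B)) (?f (fst (funct x j) ?B))"
    using fibre_mapD(4)[OF fold_functs[of j "heads x" x] r] W(5) heads_le Step
    by (simp add: arr_def del: upt_Suc)
  \<comment> \<open>separates \<open>F\<^sub>j\<close>, which the step moves, from the functors applied before and after it\<close>
  moreover have split: "[1..<heads x + 1] = [1..<j] @ [j] @ [j + 1..<heads x + 1]"
  proof -
    have "[1..<heads x + 1] = [1..<j] @ [j..<heads x + 1]"
      using W(1,5) upt_add_eq_append[of 1 j "heads x + 1 - j"] by simp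
    then show ?thesis using W(5) by (simp add: upt_conv_Cons del: upt_Suc)
  qed
  moreover have "?f (fst (funct x j) ?B) = obj x"
    unfolding obj_def star_object_def split by simp
  moreover have "?f (fst (funct (Suc x) j) ?B) = obj (Suc x)"
  proof -
    have "fold (\<lambda>l. fst (funct (Suc x) l)) [1..<j] = fold (\<lambda>l. fst (funct x l)) [1..<j]"
      by (rule fold_funct_cong(1), rule st) auto
    moreover have "fold (\<lambda>l. fst (funct (Suc x) l)) [j + 1..<heads x + 1] = ?f"
      by (rule fold_funct_cong(1), rule st) (simp del: upt_Suc)
    ultimately show ?thesis unfolding obj_def star_object_def h base split by simp
  qed
  moreover have "pob \<A> (deg x) (obj x) = obj x"
    using deg_not_Head[of x] Step pob_Idn[OF vtx_Ob obj_Ob] by simp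
  ultimately show ?thesis using h by simp
qed

definition chain_base :: "('o, 'u) nsimplex" where
  "chain_base = (fst \<sigma>, rev (map deg [0..<q + p]))"

definition chain :: "'a list \<times> 'h list" where
  "chain = (rev (map obj [0..<q + p + 1]), map arr [0..<q + p])"

lemma nth_chain_base: "i < q + p \<Longrightarrow> snd chain_base ! i = deg (q + p - 1 - i)"
  by (simp add: chain_base_def rev_nth)

lemma heads_end: "heads (q + p) = length ms"
  using star_word_counts(2)[OF word] length_es by simp

lemma heads_0: "heads 0 = 0"
  by (simp add: n_heads_def)

lemma nvert_chain_base: "i \<le> q + p \<Longrightarrow> nvert \<U> chain_base i = vtx (heads (q + p - i))"
proof (cases i)
  case 0
  then show ?thesis using heads_end by (simp add: chain_base_def vtx_last)
next
  case (Suc j)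
  assume "i \<le> q + p"
  then show ?thesis using Suc nth_chain_base[of j] deg_Arr(3)[of "q + p - 1 - j"]
    by (simp add: nvert_def)
qed

lemma chain_base_nerve: "chain_base \<in> nerve \<U> (q + p)"
proof -
  have "snd chain_base ! i \<in> Arr \<U> \<and> Src \<U> (snd chain_base ! i) = nvert \<U> chain_base i" if i: "i < q + p" for i
  proof -
    have "q + p - 1 - i < q + p" "Suc (q + p - 1 - i) = q + p - i" using i by auto
    then show ?thesis using nth_chain_base[OF i] deg_Arr(1,2)[of "q + p - 1 - i"] nvert_chain_base[of i] i by simp
  qed
  moreover have "fst chain_base \<in> Ob \<U>" using vtx_Ob[of "length ms"] by (simp add: chain_base_def vtx_last)
  ultimately show ?thesis by (simp add: nerve_def) (simp add: chain_base_def)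
qed

lemma fst_chain: "i \<le> q + p \<Longrightarrow> fst chain ! i = obj (q + p - i)"
  by (simp add: chain_def rev_nth del: upt_Suc)

lemma chain_mem: "chain \<in> gr_chains \<U> \<A> chain_base"
proof -
  have "snd chain ! (q + p - 1 - i) \<in> arrows (nvert \<U> chain_base i) (fst chain ! i) (pob \<A> (snd chain_base ! i) (fst chain ! Suc i))"
    if i: "i < q + p" for i
  proof -
    let ?x = "q + p - 1 - i"
    have x: "?x < q + p" "Suc ?x = q + p - i" "?x = q + p - Suc i" using i by auto
    have "snd chain ! ?x = arr ?x" using x(1) by (simp add: chain_def)
    moreover have "fst chain ! i = obj (Suc ?x)" "fst chain ! Suc i = obj ?x"
      using fst_chain[of i] fst_chain[of "Suc i"] i x(2,3) by simp_all
    ultimately show ?thesis using arr_arrows[OF x(1)] nth_chain_base[OF i] nvert_chain_base[of i] i x(2) by simp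
  qed
  moreover have "fst chain ! i \<in> Ob (pcat \<A> (nvert \<U> chain_base i))" if "i \<le> q + p" for i
    using fst_chain[OF that] nvert_chain_base[OF that] obj_Ob by simp
  ultimately show ?thesis
    unfolding mem_gr_chains_iff[OF chain_base_nerve] by (simp add: chain_def del: upt_Suc)
qed

lemma obj_0: "obj 0 = vert (pcat \<A> (nend \<U> \<sigma>)) a q"
  using a by (simp add: obj_def star_object_def star_base_def n_heads_def n_arrows_def simplices_def)

text \<open>When all steps have been read, each functor has moved back to the start of its path, where it is
  the successive pullback along the piece; together they give the pullback along \<open>\<sigma>\<close>.\<close>

lemma obj_end: "obj (q + p) = fst (star \<A> (snd \<sigma>)) (fst a)"
proof -
  have full: "take (q + p) es = es" using length_es by simp
  have len_a: "length (snd a) = q" using a by (simp add: simplices_def)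
  have base: "star_base \<U> \<A> \<sigma> a es = fst a"
    using star_word_counts(1)[OF word] by (simp add: star_base_def len_a vert_def)
  have F: "funct (q + p) j = star \<A> (snd (piece \<U> \<sigma> ms j))" if "j \<in> {1..length ms}" for j
    using star_word_counts(3)[OF word that] by (simp add: star_funct_def full path_functs_0)
  have "fold (\<lambda>j. fst (funct (q + p) j)) [1..<l + 1] A = fst (star \<A> (drop (cut l) (snd \<sigma>))) A"
    if "l \<le> length ms" for l A
    using that
  proof (induction l)
    case 0
    then show ?case by (simp add: cut_0 length_\<sigma> star_Nil)
  next
    case (Suc l)
    then have l: "Suc l \<in> {1..length ms}" by simp
    have c: "cut l = cut (Suc l) + part ms (Suc l)" using cut_step[OF l] by simp
    have "drop (cut (Suc l)) (snd \<sigma>) = snd (piece \<U> \<sigma> ms (Suc l)) @ drop (cut l) (snd \<sigma>)"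
      unfolding piece_eq[OF l] c
      by (metis append_take_drop_id drop_drop add.commute snd_nleft snd_nright)
    then show ?case using Suc F[OF l] by (simp add: star_append)
  qed
  from this[of "length ms" "fst a"] show ?thesis
    using heads_end star_word_counts(2)[OF word]
    by (simp add: obj_def star_object_def full base cut_last del: upt_Suc)
qed

text \<open>The degrees of the letters read so far compose to that part of \<open>\<sigma>\<close> that their heads cover.\<close>

lemma ncomp_chain_base: "ncomp \<U> chain_base = ncomp \<U> \<sigma>"
proof -
  have "npath \<U> (vtx (heads x)) (rev (map deg [0..<x])) (vtx 0) \<and>
      ncomp \<U> (vtx (heads x), rev (map deg [0..<x])) = ncomp \<U> (nright \<U> (cut (heads x)) \<sigma>)"
    if "x \<le> q + p" for x
    using that
  proof (induction x)
    case 0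
    then show ?case using vtx_Ob[of 0] by (simp add: heads_0[simplified] cut_0 vtx_def nright_def length_\<sigma>)
  next
    case (Suc x)
    then have x: "x < q + p" by simp
    note IH = Suc.IH[OF less_imp_le[OF x]]
    note D = deg_Arr[OF x]
    let ?w = "rev (map deg [0..<x])"
    have w: "rev (map deg [0..<Suc x]) = [deg x] @ ?w" by simp
    have 1: "npath \<U> (vtx (heads (Suc x))) [deg x] (vtx (heads x))" using D vtx_Ob by simp
    have 2: "npath \<U> (vtx (heads (Suc x))) ([deg x] @ ?w) (vtx 0)" using npath_append 1 IH by blast
    have "ncomp \<U> (vtx (heads (Suc x)), [deg x] @ ?w) = ncomp \<U> (nright \<U> (cut (heads x)) \<sigma>) \<bullet>\<^bsub>\<U>\<^esub> deg x"
      using ncomp_append[OF 1 conjunct1[OF IH]] IH ncomp_singleton[OF D(1)] D(2) by simp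
    also have "\<dots> = ncomp \<U> (nright \<U> (cut (heads (Suc x))) \<sigma>)"
    proof (cases "is_Head (es ! x)")
      case True
      then obtain j where j: "es ! x = Head j" by (cases "es ! x") auto
      have jj: "j = heads x + 1" "j \<in> {1..length ms}"
        using star_word_Head[OF word _ j] x length_es by auto
      have h: "heads (Suc x) = j" using heads_Suc[OF x] True jj by simp
      have c: "cut (heads x) = cut j + part ms j" using cut_step[OF jj(2)] jj(1) by simp
      then have le: "part ms j \<le> p - cut j" using cut_le[of "heads x"] by simp
      have "nright \<U> (part ms j) (nright \<U> (cut j) \<sigma>) = nright \<U> (cut (heads x)) \<sigma>"
        using nvert_nright[of "cut j" "part ms j" \<sigma> \<U>] c cut_le[of "heads x"] length_\<sigma>
        by (simp add: nright_def add.commute)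
      then show ?thesis
        using ncomp_split[OF nright_nerve[OF \<sigma> cut_le[of j]] le] piece_eq[OF jj(2)] j h by (simp add: deg_def)
    next
      case False
      have r: "ncomp \<U> (nright \<U> (cut (heads x)) \<sigma>) \<in> Arr \<U>" "Src \<U> (ncomp \<U> (nright \<U> (cut (heads x)) \<sigma>)) = vtx (heads x)"
        using ncomp_nerve[OF nright_nerve[OF \<sigma> cut_le[of "heads x"]]] by (simp_all add: vtx_def)
      then show ?thesis using deg_not_Head[OF False] heads_Suc[OF x] False Comp_Idn_right[OF r(1)] r(2) by simp
    qed
    finally show ?case using 2 w by simp
  qed
  from this[of "q + p"] show ?thesis
    using heads_end by (simp add: chain_base_def vtx_last cut_last) (simp add: nright_def)
qed

lemma head_position:
  assumes i: "i < q + p" and "is_Head (es ! (q + p - 1 - i))"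
  shows "arrow_identity_at chain_base chain i"
proof -
  let ?x = "q + p - 1 - i"
  have x: "?x < q + p" "Suc ?x = q + p - i" using i by auto
  obtain j where j: "es ! ?x = Head j" using assms(2) by (cases "es ! ?x") auto
  have jj: "j = heads ?x + 1" "j \<in> {1..length ms}"
    using star_word_Head[OF word _ j] x length_es by auto
  have h: "heads (Suc ?x) = j" using heads_Suc[OF x(1)] j jj by simp
  have "arr ?x = Idn (pcat \<A> (vtx j)) (pob \<A> (deg ?x) (obj ?x))"
    using j piece_npath(1)[OF jj(2)] by (simp add: arr_def deg_def obj_def)
  moreover have "pob \<A> (deg ?x) (obj ?x) \<in> Ob (pcat \<A> (vtx j))"
    using arrows_Ob(3)[OF arr_arrows[OF x(1)]] h by simp
  moreover have "nvert \<U> chain_base i = vtx j" using nvert_chain_base[of i] i x h by simp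
  moreover have "snd chain ! (length (snd chain) - 1 - i) = arr ?x" using x(1) by (simp add: chain_def)
  ultimately show ?thesis by (auto simp: arrow_identity_at_def)
qed

lemma non_head_position:
  assumes i: "i < q + p" and "\<not> is_Head (es ! (q + p - 1 - i))"
  shows "snd chain_base ! i = Idn \<U> (nvert \<U> chain_base i)" "nvert \<U> chain_base i \<in> Ob \<U>"
proof -
  let ?x = "q + p - 1 - i"
  have x: "?x < q + p" "Suc ?x = q + p - i" using i by auto
  show "snd chain_base ! i = Idn \<U> (nvert \<U> chain_base i)"
    using deg_not_Head[OF assms(2)] heads_Suc[OF x(1)] assms(2) nth_chain_base[OF i] nvert_chain_base[of i] x(2) i by simp
  show "nvert \<U> chain_base i \<in> Ob \<U>" using nvert_chain_base[of i] vtx_Ob i by simp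
qed

end

section \<open>The composite of G and F\<close>

context prestack_bimodule
begin

text \<open>Each summand of \<open>F\<close> is zero, either because \<open>\<phi>\<close> is reduced or because it is normalized, unless
  the word consists of the arrows followed by the heads of blocks of length one.\<close>

lemma F_map_starred:
  assumes st: "starred R \<U> \<A> \<sigma> p ms rs a q es"
    and \<phi>: "\<phi> \<in> GS_cochains \<U> \<A> R M n" and norm: "normalized \<U> \<A> M n \<phi>" and red: "reduced \<U> \<A> M n \<phi>"
    and n: "q + p = n"
  defines "\<tau> \<equiv> starred.chain_base \<U> \<sigma> p ms q es" and "c \<equiv> starred.chain \<U> \<A> \<sigma> p ms rs a q es"
    and "N \<equiv> GS_bmod \<U> \<A> M \<sigma> (fst a) (vert (pcat \<A> (nend \<U> \<sigma>)) a q)"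
    and "main \<equiv> es = map Arrow [1..<q + 1] @ map Head [1..<p + 1] \<and> ms = replicate p 1"
  shows "F_map \<U> \<A> M n \<phi> \<tau> c = (if main then \<phi> \<sigma> a else \<zero>\<^bsub>N\<^esub>)"
proof -
  interpret S: starred R \<U> \<A> \<sigma> p ms rs a q es by fact
  have t: "\<tau> \<in> nerve \<U> n" and c: "c \<in> gr_chains \<U> \<A> \<tau>"
    using S.chain_base_nerve S.chain_mem n by (simp_all add: \<tau>_def c_def)
  have c0: "fst c ! 0 = fst (star \<A> (snd \<sigma>)) (fst a)" and cn: "fst c ! n = vert (pcat \<A> (nend \<U> \<sigma>)) a q"
    using S.fst_chain[of 0] S.fst_chain[of n] S.obj_0 S.obj_end n by (simp_all add: c_def)
  have N: "N = bmod M (fst \<tau>) (fst c ! 0) (pob \<A> (ncomp \<U> \<tau>) (fst c ! n))"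
    unfolding N_def GS_bmod_def c0 cn \<tau>_def S.ncomp_chain_base by (simp add: S.chain_base_def)
  have len_t: "length (snd \<tau>) = n" using t by (simp add: nerve_def)
  have U: "fst \<tau> \<in> Ob \<U>" using nvert_Ob[OF t, of 0] by simp
  have "fst c ! n \<in> Ob (pcat \<A> (nend \<U> \<tau>))"
    using gr_chainsD(3)[OF t c, of n] len_t by (simp add: nend_def)
  then have modN: "module R N"
    unfolding N using gr_chainsD(3)[OF t c, of 0] fibre_mapD(3)[OF fibre_map_pullback[OF ncomp_nerve(1)[OF t]]]
      ncomp_nerve[OF t] U by (intro bmod_module) auto
  have head: "arrow_identity_at \<tau> c i" if "i < n" "is_Head (es ! (n - 1 - i))" for i
    using S.head_position[of i] that n by (simp add: \<tau>_def c_def)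
  have nonhead: "snd \<tau> ! i = Idn \<U> (nvert \<U> \<tau> i) \<and> nvert \<U> \<tau> i \<in> Ob \<U>"
    if "i < n" "\<not> is_Head (es ! (n - 1 - i))" for i
    using S.non_head_position[of i] that n by (simp add: \<tau>_def)
  have triv: "(\<exists>Z\<in>Ob \<U>. snd \<tau> ! i = Idn \<U> Z) \<or> arrow_identity_at \<tau> c i" if "i < n" for i
    using head[OF that] nonhead[OF that] by blast
  have zero: "F_term \<phi> n \<tau> c p' ms' z = \<zero>\<^bsub>N\<^esub>"
    if p': "p' \<le> n" and ms': "ms' \<in> partitions (n - p')" and z: "z \<in> seq_index ms'"
      and other: "\<not> (main \<and> p' = p)" for p' ms' z
  \<comment> \<open>position \<open>i\<close> of the base string belongs to the letter with index \<open>n - 1 - i\<close>, so the last \<open>p'\<close> letters are those over the first \<open>p'\<close> positions\<close>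
  proof (cases "\<forall>i<p'. is_Head (es ! (n - 1 - i))")
    case False
    then obtain i where i: "i < p'" "\<not> is_Head (es ! (n - 1 - i))" by blast
    then show ?thesis unfolding N
      using F_term_zero_reduced[OF t c p' ms' z red i(1)] nonhead[of i] p' by auto
  next
    case tail: True
    have "\<exists>i. p' \<le> i \<and> i < n \<and> is_Head (es ! (n - 1 - i))"
    proof (rule ccontr)
      assume neg: "\<not> (\<exists>i. p' \<le> i \<and> i < n \<and> is_Head (es ! (n - 1 - i)))"
      have 1: "is_Head (es ! x)" if "q + p - p' \<le> x" "x < q + p" for x
      proof -
        have "n - 1 - x < p'" "n - 1 - (n - 1 - x) = x" using that n p' by auto
        then show ?thesis using tail by metis
      qed
      have 2: "\<not> is_Head (es ! x)" if "x < q + p - p'" for x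
      proof -
        have "p' \<le> n - 1 - x" "n - 1 - x < n" "n - 1 - (n - 1 - x) = x" using that n p' by auto
        then show ?thesis using neg by metis
      qed
      have "p' \<le> q + p" using p' n by simp
      from star_word_split[OF S.word S.length_es S.ms this 1 2] show False
        using other by (simp add: main_def)
    qed
    then have "\<exists>i. p' \<le> i \<and> i < n \<and> arrow_identity_at \<tau> c i" using head by blast
    then show ?thesis unfolding N
      using F_term_zero_normalized[OF t c p' ms' z norm] triv by blast
  qed
  show ?thesis
  proof (cases main)
    case False
    then show ?thesis using F_map_zero[OF t c, folded N, OF _ modN] zero by simp
  next
    case True
    have es: "es = map Arrow [1..<q + 1] @ map Head [1..<p + 1]" using True by (simp add: main_def)
    have ms1: "ms = replicate p 1" using True by (simp add: main_def)
    have p: "p \<le> n" and np: "n - p = q" using n by auto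
    have lenA: "length (map Arrow [1..<q + 1]) = q" by (simp del: upt_Suc)
    have es_a: "es ! x = Arrow (Suc x)" if "x < q" for x
      using that lenA by (simp add: es nth_append del: upt_Suc)
    have es_h: "es ! x = Head (Suc (x - q))" if "q \<le> x" "x < n" for x
      using that lenA n by (simp add: es nth_append del: upt_Suc)
    have heads0: "S.heads x = 0" if "x \<le> q" for x
      using that lenA by (auto simp: es n_heads_def filter_empty_conv dest!: in_set_takeD simp del: upt_Suc)
    have left: "arrow_identity_at \<tau> c i" if "i < p" for i
      using head[of i] es_h[of "n - 1 - i"] that n by simp
    have vt: "nvert \<U> \<tau> i = nend \<U> \<sigma>" if "p \<le> i" "i \<le> n" for i
      using S.nvert_chain_base[of i] heads0[of "n - i"] that n S.vtx_0 by (simp add: \<tau>_def)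
    have right: "snd \<tau> ! i = Idn \<U> (nvert \<U> \<tau> p)" if "p \<le> i" "i < n" for i
    proof -
      have "\<not> is_Head (es ! (n - 1 - i))" using es_a[of "n - 1 - i"] that n by simp
      then show ?thesis using nonhead[of i] vt[of i] vt[of p] that p by simp
    qed
    have part1: "part ms j = 1" if "j \<in> {1..p}" for j using that by (auto simp: part_def ms1)
    have snd_t: "snd \<tau> ! i = snd \<sigma> ! i" if i: "i < p" for i
    proof -
      let ?j = "p - i"
      have j: "?j \<in> {1..length ms}" using i by (simp add: ms1)
      have "(\<Sum>l\<in>{1..<Suc ?j}. part ms l) = (\<Sum>l\<in>{1..<Suc ?j}. 1)"
        by (rule sum.cong) (use part1 in auto)
      then have "block_start ms (Suc ?j) = ?j" unfolding block_start_def by (simp del: sum.op_ivl_Suc)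
      then have cut: "S.cut ?j = i" using i by (simp add: S.cut_def)
      have "Suc (n - 1 - i - q) = ?j" using i n by simp
      then have e: "es ! (n - 1 - i) = Head ?j" using es_h[of "n - 1 - i"] i n by simp
      have "snd \<tau> ! i = ncomp \<U> (piece \<U> \<sigma> ms ?j)"
        using S.nth_chain_base[of i] i n e by (simp add: \<tau>_def S.deg_def)
      also have "\<dots> = ncomp \<U> (nvert \<U> \<sigma> i, [snd \<sigma> ! i])"
      proof -
        have "take 1 (drop i (snd \<sigma>)) = [snd \<sigma> ! i]"
          using i S.length_\<sigma> by (simp add: take_Suc_conv_app_nth)
        moreover have "part ms ?j = 1" using part1 i by simp
        ultimately show ?thesis using S.piece_eq[OF j] cut by (simp add: nleft_def nright_def)
      qed
      also have "\<dots> = snd \<sigma> ! i" using nerve_nth[OF S.\<sigma> i] ncomp_singleton by metis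
      finally show ?thesis .
    qed
    have left_eq: "nleft p \<tau> = \<sigma>"
    proof -
      \<comment> \<open>each head covers one arrow of \<open>\<sigma>\<close>, so the degrees of the heads recover \<open>\<sigma>\<close>\<close>
      have "take p (snd \<tau>) = snd \<sigma>"
        by (rule nth_equalityI) (use snd_t S.length_\<sigma> len_t p in auto)
      moreover have "fst \<tau> = fst \<sigma>" by (simp add: \<tau>_def S.chain_base_def)
      ultimately show ?thesis by (simp add: nleft_def)
    qed
    have simplex_eq: "(fst c ! p, take (n - p) (snd c)) = a"
    proof -
      have len_a: "length (snd a) = q" using S.a by (simp add: simplices_def)
      have arr_eq: "S.arr x = snd a ! x" if "x < q" for x
        using es_a[OF that] heads0[of x] that by (simp add: S.arr_def)
      have n_arr: "n_arrows (take q es) = q"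
        using lenA by (simp add: es n_arrows_def filter_id_conv del: upt_Suc)
      have "S.obj q = fst a"
        using heads0[of q] n_arr by (simp add: S.obj_def star_object_def star_base_def len_a vert_def)
      then have "fst c ! p = fst a" using S.fst_chain[of p] n np by (simp add: c_def)
      moreover have "take q (snd c) = snd a"
        by (rule nth_equalityI) (use len_a arr_eq n in \<open>auto simp: c_def S.chain_def\<close>)
      ultimately show ?thesis using np by simp
    qed
    note main = F_term_main[OF \<phi> t c p left right, unfolded left_eq simplex_eq, folded N]
    have "F_map \<U> \<A> M n \<phi> \<tau> c = F_term \<phi> n \<tau> c p (replicate (n - p) 1) (replicate (n - p) ([], id))"
    proof (rule F_map_single[OF t c p, folded N, OF _ modN main(2)])
      fix p' ms' z
      assume *: "p' \<le> n" "ms' \<in> partitions (n - p')" "z \<in> seq_index ms'" "p' \<noteq> p \<or> ms' \<noteq> replicate (n - p) 1"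
      show "F_term \<phi> n \<tau> c p' ms' z = \<zero>\<^bsub>N\<^esub>"
      proof (cases "p' = p")
        case False
        then show ?thesis using zero[OF *(1-3)] by simp
      next
        case True
        \<comment> \<open>over the arrows of \<open>a\<close> all degrees are identities, so a part of size at least two gives an identity in the simplex\<close>
        have "\<exists>m\<in>set ms'. 2 \<le> m"
        proof (rule ccontr)
          assume no: "\<not> (\<exists>m\<in>set ms'. 2 \<le> m)"
          have "\<forall>m\<in>set ms'. m = 1"
          proof
            fix m assume m: "m \<in> set ms'"
            then have "1 \<le> m" "\<not> 2 \<le> m" using *(2) no by (auto simp: partitions_def)
            then show "m = 1" by simp
          qed
          then have "ms' = replicate (length ms') 1" by (simp add: replicate_length_same)
          then obtain k where k: "ms' = replicate k 1" by blast
          then have "k = n - p" using *(2) True by (simp add: partitions_def sum_list_replicate)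
          then have "ms' = replicate (n - p) 1" using k by simp
          then show False using * True by simp
        qed
        then show ?thesis unfolding N
          using F_term_zero_normalized[OF t c *(1-3) norm] triv by blast
      qed
    qed
    then show ?thesis using main(1) True by simp
  qed
qed

text \<open>By \<open>F_map_starred\<close> and \<open>star_entries_main\<close> one index contributes to the sum that defines \<open>G\<close>: the
  partition into ones with identity permutations. Its sign is one.\<close>

lemma G_map_F_map_apply:
  assumes \<phi>: "\<phi> \<in> GS_cochains \<U> \<A> R M n" and norm: "normalized \<U> \<A> M n \<phi>" and red: "reduced \<U> \<A> M n \<phi>"
    and n: "p + q = n" and \<sigma>: "\<sigma> \<in> nerve \<U> p" and a: "a \<in> simplices (pcat \<A> (nend \<U> \<sigma>)) q"
  shows "G_map \<U> \<A> M n (F_map \<U> \<A> M n \<phi>) \<sigma> a = \<phi> \<sigma> a"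
proof -
  define N where "N = GS_bmod \<U> \<A> M \<sigma> (fst a) (vert (pcat \<A> (nend \<U> \<sigma>)) a q)"
  define t where "t ms z \<beta> = [(sign \<beta> * seqq_sign z)] \<cdot>\<^bsub>N\<^esub>
     F_map \<U> \<A> M n \<phi> (star_simplex \<U> \<sigma> ms q \<beta> z) (star_chain \<U> \<A> \<sigma> ms a \<beta> z)" for ms z \<beta>
  have len: "length (snd \<sigma>) = p" "length (snd a) = q" using \<sigma> a by (simp_all add: nerve_def simplices_def)
  have dom: "(\<sigma>, a) \<in> GS_dom \<U> \<A> n" using n \<sigma> a by (auto simp: GS_dom_def)
  have G: "G_map \<U> \<A> M n (F_map \<U> \<A> M n \<phi>) \<sigma> a =
     (\<Oplus>\<^bsub>N\<^esub>ms\<in>partitions p. \<Oplus>\<^bsub>N\<^esub>z\<in>seqq_index ms. \<Oplus>\<^bsub>N\<^esub>\<beta>\<in>shuffle_perms q p. t ms z \<beta>)"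
    using dom by (simp add: G_map_def Let_def len N_def t_def)
  have car: "\<phi> \<sigma> a \<in> carrier N"
    unfolding N_def by (rule GS_cochain_carrier[OF \<phi> \<sigma> n a])
  have e: "nend \<U> \<sigma> \<in> Ob \<U>" using nvert_Ob[OF \<sigma>, of p] len by (simp add: nend_def)
  have modN: "module R N"
  proof -
    have "npath \<U> (fst \<sigma>) (snd \<sigma>) (nend \<U> \<sigma>)" using \<sigma> by (simp add: mem_nerve_iff)
    then have "fst (star \<A> (snd \<sigma>)) (fst a) \<in> Ob (pcat \<A> (fst \<sigma>))"
      using fibre_mapD(3)[OF fibre_map_star] a mem_simplices_iff[OF e] by blast
    moreover have "pob \<A> (ncomp \<U> \<sigma>) (vert (pcat \<A> (nend \<U> \<sigma>)) a q) \<in> Ob (pcat \<A> (fst \<sigma>))"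
      using fibre_mapD(3)[OF fibre_map_pullback[OF ncomp_nerve(1)[OF \<sigma>]]] ncomp_nerve[OF \<sigma>] simplex_vert_Ob[OF a] by simp
    moreover have "fst \<sigma> \<in> Ob \<U>" using nvert_Ob[OF \<sigma>, of 0] by simp
    ultimately show ?thesis unfolding N_def GS_bmod_def by (intro bmod_module)
  qed
  interpret N: module R N by (rule modN)
  let ?ms = "replicate p 1 :: nat list" and ?z = "(id :: nat \<Rightarrow> nat, replicate p ([] :: nat list))"
  let ?main = "\<lambda>ms z \<beta>. ms = ?ms \<and> z = ?z \<and> \<beta> = id"
  have t: "t ms z \<beta> = (if ?main ms z \<beta> then \<phi> \<sigma> a else \<zero>\<^bsub>N\<^esub>)"
    if ms: "ms \<in> partitions p" and z: "z \<in> seqq_index ms" and \<beta>: "\<beta> \<in> shuffle_perms q p" for ms z \<beta>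
  proof -
    obtain \<gamma> rs where z_eq: "z = (\<gamma>, rs)" by (cases z)
    have \<gamma>: "\<gamma> \<in> cond_shuffles ms" and rs: "length rs = length ms"
      "\<And>j. j \<in> {1..length ms} \<Longrightarrow> rs ! (j - 1) \<in> path_choices (part ms j)"
      using z by (auto simp: seqq_index_def z_eq)
    let ?es = "star_entries q ms \<beta> \<gamma>"
    note W = star_word_star_entries[OF ms \<beta> \<gamma>]
    have S: "starred R \<U> \<A> \<sigma> p ms rs a q ?es"
      by unfold_locales (use \<sigma> ms rs(2) a W in auto)
    interpret S: starred R \<U> \<A> \<sigma> p ms rs a q ?es by (rule S)
    have tau: "star_simplex \<U> \<sigma> ms q \<beta> z = S.chain_base"
      unfolding star_simplex_def Let_def S.chain_base_def z_eq fst_conv W(2) S.deg_def ..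
    have ch: "star_chain \<U> \<A> \<sigma> ms a \<beta> z = S.chain"
      unfolding star_chain_def Let_def S.chain_def z_eq fst_conv snd_conv len(2) W(2) S.obj_def S.arr_def ..
    have qp: "q + p = n" using n by simp
    note F = F_map_starred[OF S \<phi> norm red qp, folded N_def]
    have "?es = map Arrow [1..<q + 1] @ map Head [1..<p + 1] \<and> ms = ?ms \<longleftrightarrow> ?main ms z \<beta>"
    proof
      assume *: "?es = map Arrow [1..<q + 1] @ map Head [1..<p + 1] \<and> ms = ?ms"
      have "\<gamma> = id" "\<beta> = id" using star_entries_main[of \<beta> q p \<gamma>] * \<beta> \<gamma> by auto
      moreover have "rs = replicate p []"
      proof (rule nth_equalityI)
        fix i assume i: "i < length rs"
        then have "rs ! i \<in> path_choices (part ms (Suc i))" using rs by (metis Suc_le_eq atLeastAtMost_iff diff_Suc_1 le_add1 plus_1_eq_Suc)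
        moreover have "part ms (Suc i) = 1" using * i rs(1) by (simp add: part_def)
        ultimately show "rs ! i = replicate p [] ! i" using i rs(1) * by simp
      qed (use rs(1) * in simp)
      ultimately show "?main ms z \<beta>" using * z_eq by simp
    next
      assume *: "?main ms z \<beta>"
      have "seqq_list ?ms = map Head [1..<p + 1]" by (rule seqq_list_ones)
      then show "?es = map Arrow [1..<q + 1] @ map Head [1..<p + 1] \<and> ms = ?ms"
        using * z_eq by (simp add: star_entries_def)
    qed
    then have "t ms z \<beta> = [(sign \<beta> * seqq_sign z)] \<cdot>\<^bsub>N\<^esub> (if ?main ms z \<beta> then \<phi> \<sigma> a else \<zero>\<^bsub>N\<^esub>)"
      unfolding t_def tau ch F by simp
    moreover have "sign \<beta> * seqq_sign z = 1" if "?main ms z \<beta>"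
    proof -
      have "(\<Prod>r\<leftarrow>replicate p []. path_sign r) = 1" by (induction p) auto
      then show ?thesis using that by (simp add: seqq_sign_def sign_id)
    qed
    ultimately show ?thesis using car by (simp add: N.add.int_pow_one N.add.int_pow_1)
  qed
  have ms0: "?ms \<in> partitions p" by (auto simp: partitions_def sum_list_replicate)
  have z0: "?z \<in> seqq_index ?ms"
  proof -
    have "part ?ms j = 1" if "j \<in> {1..p}" for j using that by (auto simp: part_def)
    then show ?thesis
      by (auto simp: seqq_index_def cond_shuffles_def permutes_id strict_mono_on_def)
  qed
  have \<beta>0: "id \<in> shuffle_perms q p" by (auto simp: shuffle_perms_def permutes_id strict_mono_on_def)
  have t0: "t ?ms ?z id = \<phi> \<sigma> a" using t[OF ms0 z0 \<beta>0] by simp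
  have 1: "(\<Oplus>\<^bsub>N\<^esub>\<beta>\<in>shuffle_perms q p. t ?ms ?z \<beta>) = \<phi> \<sigma> a"
    unfolding t0[symmetric] by (rule N.finsum_single) (use \<beta>0 t[OF ms0 z0] car in auto)
  have 2: "(\<Oplus>\<^bsub>N\<^esub>z\<in>seqq_index ?ms. \<Oplus>\<^bsub>N\<^esub>\<beta>\<in>shuffle_perms q p. t ?ms z \<beta>) = \<phi> \<sigma> a"
    unfolding 1[symmetric]
  proof (rule N.finsum_single)
    fix z assume z: "z \<in> seqq_index ?ms" "z \<noteq> ?z"
    show "(\<Oplus>\<^bsub>N\<^esub>\<beta>\<in>shuffle_perms q p. t ?ms z \<beta>) = \<zero>\<^bsub>N\<^esub>"
      by (rule N.add.finprod_one_eqI) (use t[OF ms0 z(1)] z(2) in auto)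
  qed (use z0 1 car in auto)
  have 3: "(\<Oplus>\<^bsub>N\<^esub>ms\<in>partitions p. \<Oplus>\<^bsub>N\<^esub>z\<in>seqq_index ms. \<Oplus>\<^bsub>N\<^esub>\<beta>\<in>shuffle_perms q p. t ms z \<beta>) = \<phi> \<sigma> a"
    unfolding 2[symmetric]
  proof (rule N.finsum_single)
    fix ms assume ms: "ms \<in> partitions p" "ms \<noteq> ?ms"
    show "(\<Oplus>\<^bsub>N\<^esub>z\<in>seqq_index ms. \<Oplus>\<^bsub>N\<^esub>\<beta>\<in>shuffle_perms q p. t ms z \<beta>) = \<zero>\<^bsub>N\<^esub>"
      by (intro N.add.finprod_one_eqI) (use t[OF ms(1)] ms(2) in auto)
  qed (use ms0 2 car in auto)
  show ?thesis unfolding G 3 ..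
qed

end

theorem proposition4p9:
  fixes R :: "('k, 'r) ring_scheme"
    and \<U> :: "('o, 'u) cat"
    and \<A> :: "('k, 'o, 'u, 'a, 'h) prestack"
    and M :: "('k, 'o, 'u, 'a, 'h, 'm) bimodule"
    and n :: nat
    and \<phi> :: "('o, 'u) nsimplex \<Rightarrow> ('a, 'h) simplex \<Rightarrow> 'm"
  assumes "prestack_bimodule R \<U> \<A> M"
    and "\<phi> \<in> GS_cochains \<U> \<A> R M n"
    and "normalized \<U> \<A> M n \<phi>"
    and "reduced \<U> \<A> M n \<phi>"
  shows "G_map \<U> \<A> M n (F_map \<U> \<A> M n \<phi>) = \<phi>"
proof (intro ext)
  fix \<sigma> :: "('o, 'u) nsimplex" and a :: "('a, 'h) simplex"
  interpret prestack_bimodule R \<U> \<A> M by fact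
  show "G_map \<U> \<A> M n (F_map \<U> \<A> M n \<phi>) \<sigma> a = \<phi> \<sigma> a"
  proof (cases "(\<sigma>, a) \<in> GS_dom \<U> \<A> n")
    case True
    then obtain p q where "p + q = n" "\<sigma> \<in> nerve \<U> p" "a \<in> simplices (pcat \<A> (nend \<U> \<sigma>)) q"
      by (auto simp: GS_dom_def)
    then show ?thesis by (rule G_map_F_map_apply[OF assms(2-4)])
  next
    case False
    then have "\<phi> \<sigma> a = undefined" using assms(2) unfolding GS_cochains_def by blast
    then show ?thesis using False by (simp add: G_map_def)
  qed
qed

end
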